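(* Let $d \ge 4$, $S \in \mathcal{S}^d(1)$ with $0 \in \operatorname{int}(S)$, and $l \in \{1,\ldots,d\}$. Then \[ \max_{F \in \mathcal{F}_l(S^* )} \operatorname{vol}_{\mathbb{Z}}(F) \le \frac{2(s_d-1)^2}{l!\,(s_{d-l+1}-1)}. \] Moreover: (a) if $S$ is unimodularly equivalent to $(S^d_1 - e)^*$, where $e=(1,\ldots,1)$ (equivalently, to $\operatorname{conv}\big((T^{d-1}_{1,d}\times\{0\}) \cup \{\pm e_d\}\big)$ translated so that its unique interior integral point is $0$), then equality holds for every $l$; (b) if $l \in \{1, d\}$, equality holds if and only if $S$ is unimodularly equivalent to $(S^d_1 - e)^*$.
   Context: The Sylvester sequence: $s_1 = 2$, $s_i = \prod_{j=1}^{i-1} s_j + 1$ for $i\ge2$. $\mathcal{S}^d(1)$: $d$-dimensional simplices in $\mathbb{R}^d$ with integral vertices and exactly one interior integral point. $S^*$ denotes the polar $\{y:\langle x,y\rangle\le1\ \forall x\in S\}$. $\mathcal{F}_l$: set of $l$-dimensional faces. $\operatorname{vol}_{\mathbb{Z}}(F) := \operatorname{vol}_i(F)/\det(\mathbb{Z}^d\cap\operatorname{lin}\{x-y:x,y\in F\})$ for an $i$-dimensional rational polytope $F$. $S^d_1 := \operatorname{conv}(\{0, s_1 e_1, \ldots, s_{d-1}e_{d-1}, 2(s_d-1)e_d\})$, whose unique interior integral point is $e=(1,\ldots,1)$. $T^{d-1}_{1,d} := \operatorname{conv}(\{0, s_1e_1,\ldots,s_{d-1}e_{d-1}\}) \subseteq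 \mathbb{R}^{d-1}$. Unimodular equivalence: existence of an affine bijection of $\mathbb{R}^d$ preserving $\mathbb{Z}^d$ mapping one onto the other. *)

theory Defs
  imports "HOL-Analysis.Analysis"
begin

(* Sylvester sequence: s_1 = 2, s_i = (prod_{j=1}^{i-1} s_j) + 1 for i >= 2.
   (s_0 is an irrelevant dummy value.) *)
function sylv :: "nat \<Rightarrow> nat" where
  "sylv i = (if i \<le> 1 then 2 else (\<Prod>j\<in>{1..<i}. sylv j) + 1)"
  by auto
termination by (relation "Wellfounded.measure id") auto

definition int_points :: "(real^'n) set" where
  "int_points = {x. \<forall>i. x $ i \<in> \<int>}"

definition polar_set :: "(real^'n) set \<Rightarrow> (real^'n) set" where
  "polar_set S = {y. \<forall>x\<in>S. inner x y \<le> 1}"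

definition lattice_simplices_one :: "(real^'n) set set" where
  "lattice_simplices_one = {S. (\<exists>C. C \<subseteq> int_points \<and> \<not> affine_dependent C \<and>
        card C = CARD('n) + 1 \<and> S = convex hull C)
      \<and> card (interior S \<inter> int_points) = 1}"

definition unimod_equiv :: "(real^'n) set \<Rightarrow> (real^'n) set \<Rightarrow> bool" where
  "unimod_equiv P Q \<longleftrightarrow> (\<exists>L c. linear L \<and> bij (\<lambda>x. L x + c)
      \<and> (\<lambda>x. L x + c) ` int_points = int_points \<and> (\<lambda>x. L x + c) ` P = Q)"

definition lattice_basis :: "(real^'n) set \<Rightarrow> nat \<Rightarrow> (nat \<Rightarrow> real^'n) \<Rightarrow> bool" where
  "lattice_basis L k b \<longleftrightarrow> inj_on b {..<k} \<and> independent (b ` {..<k})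
      \<and> L = {(\<Sum>i<k. of_int (c i) *\<^sub>R b i) | c :: nat \<Rightarrow> int. True}"

(* vol_Z(F) = vol_k(F) / det(Z^d \<inter> lin(F - F)), k = dim F, computed as the
   k-dimensional Lebesgue measure of the coordinates of F with respect to a
   lattice basis of Z^d \<inter> lin(F - F) (based at a point of F). *)
definition volZ :: "(real^'n) set \<Rightarrow> real" where
  "volZ F = (let k = nat (aff_dim F);
                 L = int_points \<inter> span {x - y | x y. x \<in> F \<and> y \<in> F};
                 b = (SOME b. lattice_basis L k b);
                 x0 = (SOME x. x \<in> F)
             in measure (PiM {..<k} (\<lambda>_. lborel))
                  {t \<in> space (PiM {..<k} (\<lambda>_. lborel)). x0 + (\<Sum>i<k. t i *\<^sub>R b i) \<in> F})"

definition coord_index :: "'n::finite \<Rightarrow> nat" where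
  "coord_index = (SOME \<pi>. bij_betw \<pi> (UNIV :: 'n set) {1..CARD('n)})"

definition sylv_simplex :: "(real^'n) set" where
  "sylv_simplex = convex hull (insert 0
      {(if coord_index i = CARD('n) then 2 * (real (sylv CARD('n)) - 1)
        else real (sylv (coord_index i))) *\<^sub>R axis i 1 | i. True})"

definition ones :: "real^'n" where
  "ones = (\<chi> i. 1)"

end

theory Submission
  imports Defs
begin

text \<open>
  Let \<open>\<beta>\<^sub>0 \<ge> \<dots> \<ge> \<beta>\<^sub>d\<close> be the barycentric coordinates of \<open>0\<close> in \<open>S\<close>. Minkowski's theorem on linear forms
  yields \<open>\<beta>\<^sub>0 \<cdots> \<beta>\<^bsub>m-1\<^esub> \<le> \<beta>\<^sub>m + \<dots> + \<beta>\<^sub>d\<close> for every \<open>m\<close>, since otherwise \<open>S\<close> has a second interior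
  integral point. These inequalities force every tail sum of \<open>\<beta>\<close> to be at least the corresponding
  tail sum of \<open>1/s\<^sub>1, 1/s\<^sub>2, \<dots>\<close>, and a decreasing sequence with larger tail sums has the larger
  product; this bounds \<open>\<beta>\<^bsub>d-l\<^esub> \<cdots> \<beta>\<^bsub>d-1\<^esub>\<close> from below, with equality for a single \<open>\<beta>\<close>.

  The vertices \<open>w\<^sub>k\<close> of the polar satisfy \<open>\<langle>v\<^sub>i, w\<^sub>k\<rangle> = 1 - \<delta>\<^bsub>ik\<^esub> / \<beta>\<^sub>k\<close>. Hence the lattice volume of its face
  spanned by \<open>w\<^sub>i\<close>, \<open>i \<in> I\<close>, is the product of the \<open>1/\<beta>\<^sub>i\<close>, \<open>i \<in> I - {i\<^sub>0}\<close>, divided by \<open>l!\<close> and by a positive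
  integer \<open>D\<close>, where \<open>i\<^sub>0 \<in> I\<close> is arbitrary. In the equality case \<open>D = 1\<close>, and for \<open>l \<in> {1, d}\<close> this
  makes \<open>v\<^sub>0, \<dots>, v\<^bsub>d-1\<^esub>\<close> a basis of the integral lattice, so that \<open>\<beta>\<close> determines \<open>S\<close>.
\<close>

section \<open>Product comparison under tail domination\<close>

text \<open>The index left out of a face product is the largest one, so the product never contains
  \<open>\<beta> d\<close>, and the tail sums that matter end at \<open>d - 1\<close>. Subtracting
  \<open>\<beta> d\<close> from the Sylvester bounds is harmless only while \<open>\<beta> d\<close>
  is at most its extremal value \<open>1 / (2 * sylp (d - 1))\<close>. For larger
  \<open>\<beta> d\<close> the monotonicity of \<open>\<beta>\<close> has to make up for the loss,
  and this is where \<open>4 \<le> d\<close> enters. In dimension 3 the weights (1/2, 1/3, 1/12,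
  1/12) and (1/2, 1/6, 1/6, 1/6) both give 1/72 as product of the first three, so equality would not
  determine \<open>\<beta>\<close>. The number \<open>D\<close> is a lattice index: pairing with the
  vertices \<open>v i\<close>, \<open>i\<close> in \<open>I - {i0}\<close>, embeds the integral
  directions of the face into the integral vectors indexed by \<open>I - {i0}\<close>, and
  \<open>D\<close> is the index of the image. For an edge, \<open>D = 1\<close> concerns one dual
  vector only; the others become integral through a second use of Minkowski's theorem, on the full
  integral lattice instead of the lattice generated by the vertices.\<close>

lemma prod_ge_of_tail_sums:
  fixes x y :: "nat \<Rightarrow> real"
  assumes x: "\<And>i. p \<le> i \<Longrightarrow> i < m \<Longrightarrow> 0 < x i"
    and dec: "\<And>i. p \<le> i \<Longrightarrow> Suc i < m \<Longrightarrow> x (Suc i) \<le> x i"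
    and y: "\<And>i. p \<le> i \<Longrightarrow> i < m \<Longrightarrow> 0 < y i"
    and tails: "\<And>k. p \<le> k \<Longrightarrow> k < m \<Longrightarrow> sum y {k..<m} \<le> sum x {k..<m}"
  shows "prod y {p..<m} \<le> prod x {p..<m}"
    and "prod x {p..<m} = prod y {p..<m} \<Longrightarrow> p \<le> i \<Longrightarrow> i < m \<Longrightarrow> x i = y i"
proof -
  define E where "E k = (\<Sum>i=k..<m. y i - x i)" for k
  have E: "E k \<le> 0" if "p \<le> k" for k
    using tails[of k] that by (cases "k < m") (auto simp: E_def sum_subtractf)
  \<comment> \<open>Abel summation from the right: \<open>E\<close> is nonpositive and
    \<open>1 / x\<close> increases, so passing from \<open>1 / x (Suc n)\<close> to
    \<open>1 / x n\<close> can only enlarge the term.\<close>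
  have abel: "(\<Sum>i=k..<m. (y i - x i) / x i) \<le> E k / x k" if "p \<le> k" "k \<le> m" for k
    using that(2,1)
  proof (induction k rule: inc_induct)
    case base
    then show ?case by (simp add: E_def)
  next
    case (step n)
    have E_Suc: "E n = (y n - x n) + E (Suc n)"
      using step by (simp add: E_def sum.atLeast_Suc_lessThan)
    have "E (Suc n) / x (Suc n) \<le> E (Suc n) / x n"
    proof (cases "Suc n < m")
      case True
      then show ?thesis
        using E[of "Suc n"] dec[of n] x[of "Suc n"] step.prems
        by (intro divide_left_mono_neg) (auto intro!: mult_pos_pos x)
    next
      case False
      then show ?thesis by (simp add: E_def)
    qed
    then show ?case
      using step E_Suc by (simp add: sum.atLeast_Suc_lessThan add_divide_distrib)
  qed
  \<comment> \<open>The defect in \<open>ln t \<le> t - 1\<close> at \<open>t = y i / x i\<close>.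
    Equal products force all defects to vanish, which happens only at \<open>t = 1\<close>.\<close>
  define e where "e i = (y i / x i - 1) - ln (y i / x i)" for i
  have e: "0 \<le> e i" if "p \<le> i" "i < m" for i
    using ln_le_minus_one[of "y i / x i"] x[OF that] y[OF that] by (simp add: e_def)
  have le0: "(\<Sum>i=p..<m. y i / x i - 1) \<le> 0"
  proof (cases "p < m")
    case True
    have "(\<Sum>i=p..<m. y i / x i - 1) = (\<Sum>i=p..<m. (y i - x i) / x i)"
    proof (intro sum.cong refl)
      fix i assume "i \<in> {p..<m}"
      then show "y i / x i - 1 = (y i - x i) / x i"
        using x[of i] by (simp add: field_simps)
    qed
    also have "\<dots> \<le> E p / x p" using abel[of p] True by simp
    also have "\<dots> \<le> 0" using E[of p] x[of p] True by (simp add: divide_nonpos_pos)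
    finally show ?thesis .
  qed simp
  have px: "0 < prod x {p..<m}" and py: "0 < prod y {p..<m}"
    using x y by (auto intro!: prod_pos)
  have "ln (prod y {p..<m}) - ln (prod x {p..<m}) = (\<Sum>i=p..<m. ln (y i / x i))"
  proof -
    have "ln (prod y {p..<m}) = (\<Sum>i=p..<m. ln (y i))" using y by (intro ln_prod) force+
    moreover have "ln (prod x {p..<m}) = (\<Sum>i=p..<m. ln (x i))" using x by (intro ln_prod) force+
    moreover have "(\<Sum>i=p..<m. ln (y i / x i)) = (\<Sum>i=p..<m. ln (y i) - ln (x i))"
      using x y by (intro sum.cong refl ln_divide_pos) auto
    ultimately show ?thesis by (simp add: sum_subtractf)
  qed
  also have "\<dots> = (\<Sum>i=p..<m. y i / x i - 1) - (\<Sum>i=p..<m. e i)"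
    by (simp add: e_def sum_subtractf)
  finally have *: "ln (prod y {p..<m}) - ln (prod x {p..<m}) = (\<Sum>i=p..<m. y i / x i - 1) - (\<Sum>i=p..<m. e i)" .
  have e_sum: "0 \<le> (\<Sum>i=p..<m. e i)" using e by (auto intro!: sum_nonneg)
  have "ln (prod y {p..<m}) \<le> ln (prod x {p..<m})" using * le0 e_sum by linarith
  then show "prod y {p..<m} \<le> prod x {p..<m}" using px py by simp
  show "x i = y i" if eq: "prod x {p..<m} = prod y {p..<m}" and i: "p \<le> i" "i < m"
  proof -
    have "(\<Sum>i=p..<m. e i) = 0" using * le0 e_sum unfolding eq by linarith
    then have "e i = 0"
      using i e by (subst (asm) sum_nonneg_eq_0_iff) auto
    then have "y i / x i = 1"
      using ln_eq_minus_one[of "y i / x i"] x[OF i] y[OF i] by (simp add: e_def)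
    then show ?thesis using x[OF i] by (simp add: field_simps)
  qed
qed

section \<open>The Sylvester sequence\<close>

text \<open>In terms of the paper's sequence, \<open>sylp m = s\<^bsub>m+1\<^esub> - 1 = s\<^sub>1 \<cdots> s\<^sub>m\<close>.\<close>

definition sylp :: "nat \<Rightarrow> real" where
  "sylp m = real (sylv (Suc m)) - 1"

lemma sylv_Suc_eq: "sylv (Suc m) = (\<Prod>j\<in>{1..m}. sylv j) + 1"
  by (cases m) (auto simp: atLeastLessThanSuc_atLeastAtMost simp del: sylv.simps
    intro: sylv.simps[THEN trans])

declare sylv.simps [simp del]

lemma sylp_0 [simp]: "sylp 0 = 1"
  by (simp add: sylp_def sylv_Suc_eq)

lemma sylp_Suc: "sylp (Suc m) = sylp m * (sylp m + 1)"
  by (simp add: sylp_def sylv_Suc_eq[of "Suc m"] sylv_Suc_eq[of m] algebra_simps)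

lemma sylp_ge_1: "1 \<le> sylp m"
proof (induction m)
  case (Suc m)
  then show ?case using mult_mono[of 1 "sylp m" 1 "sylp m + 1"] by (simp add: sylp_Suc)
qed simp

lemma sylp_pos [simp]: "0 < sylp m"
  using sylp_ge_1[of m] by linarith

lemma sylp_plus_1_pos [simp]: "0 < sylp m + 1"
  using sylp_ge_1[of m] by linarith

lemma sylp_neq [simp]: "sylp m \<noteq> 0" "sylp m + 1 \<noteq> 0"
  using sylp_ge_1[of m] by linarith+

lemma sylv_eq_sylp: "real (sylv (Suc m)) = sylp m + 1"
  by (simp add: sylp_def)

text \<open>Makes the Sylvester reciprocals telescope: the first \<open>k\<close> of them fall short
  of 1 by exactly \<open>1 / sylp k\<close>.\<close>

lemma inverse_sylp_diff: "1 / (sylp m + 1) = 1 / sylp m - 1 / sylp (Suc m)"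
  by (simp add: sylp_Suc divide_simps)

lemma sylp_mono: "m \<le> k \<Longrightarrow> sylp m \<le> sylp k"
proof (rule lift_Suc_mono_le[of sylp])
  show "sylp n \<le> sylp (Suc n)" for n
    using sylp_ge_1[of n] by (simp add: sylp_Suc)
qed auto

lemma sylp_1: "sylp (Suc 0) = 2" and sylp_2: "sylp 2 = 6"
  by (simp_all add: sylp_Suc numeral_2_eq_2)

lemma sum_inverse_sylv: "m \<le> k \<Longrightarrow> (\<Sum>i=m..<k. 1 / (sylp i + 1)) = 1 / sylp m - 1 / sylp k"
  by (induction k rule: dec_induct) (auto simp: inverse_sylp_diff)

lemma prod_inverse_sylv: "m \<le> k \<Longrightarrow> (\<Prod>i=m..<k. 1 / (sylp i + 1)) = sylp m / sylp k"
  by (induction k rule: dec_induct) (auto simp: sylp_Suc)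

section \<open>Products of equal blocks decrease as the block is shortened\<close>

lemma linear_less_power:
  fixes c :: real
  assumes "1 \<le> c" "3 * c * real q < (c + 1) ^ q" "1 \<le> q" "q \<le> r"
  shows "3 * c * real r < (c + 1) ^ r"
  using assms(4)
proof (induction r rule: dec_induct)
  case base
  then show ?case using assms by simp
next
  case (step n)
  have "3 * c * real (Suc n) \<le> 3 * c * real n * 2"
    using step assms by (simp add: algebra_simps)
  also have "\<dots> < (c + 1) ^ n * 2" using step by simp
  also have "\<dots> \<le> (c + 1) ^ n * (c + 1)" using assms by (intro mult_left_mono) auto
  finally show ?case by (simp add: mult.commute)
qed

lemma Suc_power_le: 
  assumes "1 \<le> q"
  shows "real (Suc q) ^ q \<le> 3 * real q ^ q"
proof -
  have "(1 + 1 / real q) ^ q \<le> exp 1"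
    using exp_ge_one_plus_x_over_n_power_n[of q 1] assms by simp
  then have "(1 + 1 / real q) ^ q \<le> 3" using exp_le by linarith
  moreover have "1 + 1 / real q = real (Suc q) / real q"
    using assms by (simp add: field_simps)
  ultimately show ?thesis using assms by (simp add: power_divide field_simps)
qed

text \<open>This is \<open>eqblock d (Suc m) < eqblock d m\<close> with common powers cancelled.
  With \<open>q = d - m\<close> and \<open>c = sylp m\<close>, the bound (1 + 1/q)^q \<le> e \<le> 3
  reduces it to \<open>3 * c * q < (c + 1) ^ q\<close>, which persists for larger \<open>q\<close>
  once it holds.\<close>

lemma sylp_power_step:
  assumes "4 \<le> d" "Suc m < d"
  shows "sylp m * real (Suc (d - m)) ^ (d - m) < (sylp m + 1) ^ (d - m) * real (d - m) ^ (d - m - 1)"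
proof -
  define q where "q = d - m"
  define c where "c = sylp m"
  have q: "2 \<le> q" using assms by (simp add: q_def)
  have c: "1 \<le> c" using sylp_ge_1 by (simp add: c_def)
  have main: "c * real (Suc q) ^ q < (c + 1) ^ q * real q ^ (q - 1)"
    if *: "3 * c * real q < (c + 1) ^ q"
  proof -
    have "c * real (Suc q) ^ q \<le> c * (3 * real q ^ q)"
      using Suc_power_le[of q] q c by (intro mult_left_mono) auto
    also have "\<dots> = 3 * c * real q * real q ^ (q - 1)"
      using q by (cases q) auto
    also have "\<dots> < (c + 1) ^ q * real q ^ (q - 1)"
      using * q by (intro mult_strict_right_mono) auto
    finally show ?thesis .
  qed
  \<comment> \<open>\<open>4 \<le> d\<close> gives \<open>4 \<le> q\<close> if \<open>m = 0\<close>
    and \<open>3 \<le> q\<close> if \<open>m = 1\<close>. For \<open>m = 1\<close> and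
    \<open>q = 2\<close>, that is \<open>d = 3\<close>, both sides would be 18.\<close>
  consider "m = 0" | "m = 1" | "2 \<le> m" "q = 2" | "2 \<le> m" "3 \<le> q"
    using q by linarith
  then have "c * real (Suc q) ^ q < (c + 1) ^ q * real q ^ (q - 1)"
  proof cases
    case 1
    then have "c = 1" "4 \<le> q" using assms by (auto simp: c_def q_def)
    then show ?thesis using linear_less_power[of c 4 q] by (intro main) auto
  next
    case 2
    then have "c = 2" "3 \<le> q" using assms by (auto simp: c_def q_def sylp_1)
    then show ?thesis using linear_less_power[of c 3 q] by (intro main) auto
  next
    case 3
    have "6 \<le> c" using sylp_mono[of 2 m] 3 by (simp add: c_def sylp_2)
    then have "0 \<le> (c - 6) * (2 * c - 2)" by (intro mult_nonneg_nonneg) auto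
    then have "c * 9 < (c + 1) ^ 2 * 2" using c \<open>6 \<le> c\<close> by (simp add: power2_eq_square algebra_simps)
    then show ?thesis using 3 by simp
  next
    case 4
    have "6 \<le> c" using sylp_mono[of 2 m] 4 by (simp add: c_def sylp_2)
    have "3 * c * real 3 < c * (6 * 6)" using \<open>6 \<le> c\<close> by simp
    also have "\<dots> \<le> c * (c * c)" using \<open>6 \<le> c\<close> by (intro mult_left_mono mult_mono) auto
    also have "\<dots> \<le> (c + 1) * ((c + 1) * (c + 1))" using c by (intro mult_mono) auto
    finally have "3 * c * real 3 < (c + 1) ^ 3" by (simp add: power3_eq_cube)
    then show ?thesis using linear_less_power[of c 3 q] 4 c by (intro main) auto
  qed
  then show ?thesis by (simp add: q_def c_def)
qed

text \<open>The product of the first \<open>d\<close> entries of \<open>1/s\<^sub>1, \<dots>, 1/s\<^sub>m\<close> followed by \<open>d - m + 1\<close> equal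
  entries with total sum \<open>1\<close>.\<close>

definition eqblock :: "nat \<Rightarrow> nat \<Rightarrow> real" where
  "eqblock d m = 1 / (sylp m ^ Suc (d - m) * real (Suc (d - m)) ^ (d - m))"

lemma eqblock_Suc:
  assumes "4 \<le> d" "Suc m < d"
  shows "eqblock d (Suc m) < eqblock d m"
proof -
  obtain q where q: "d - m = Suc q" "d - Suc m = q"
    using assms by (metis Suc_diff_Suc Suc_lessD)
  have "sylp m ^ Suc q * (sylp m * real (Suc (Suc q)) ^ Suc q) <
      sylp m ^ Suc q * ((sylp m + 1) ^ Suc q * real (Suc q) ^ q)"
    using sylp_power_step[OF assms] q by (intro mult_strict_left_mono) auto
  then have "sylp m ^ Suc (Suc q) * real (Suc (Suc q)) ^ Suc q < sylp (Suc m) ^ Suc q * real (Suc q) ^ q"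
    by (simp add: sylp_Suc power_mult_distrib mult_ac)
  then show ?thesis
    unfolding eqblock_def q by (intro divide_strict_left_mono) (auto simp del: power_Suc of_nat_Suc)
qed

lemma eqblock_antimono:
  assumes "4 \<le> d" "k \<le> m" "m < d"
  shows "eqblock d m \<le> eqblock d k"
  using assms(2,3)
proof (induction m rule: dec_induct)
  case (step n)
  then show ?case using eqblock_Suc[of d n] assms by fastforce
qed simp

lemma eqblock_last:
  assumes "1 \<le> d"
  shows "eqblock d (d - 1) = 1 / (2 * sylp (d - 1) ^ 2)"
  using assms by (cases d) (auto simp: eqblock_def power2_eq_square)

section \<open>Barycentric coordinates under the product-sum inequalities\<close>

text \<open>\<open>ln (u b)\<close> is a combination of logarithms of affine functions and hence
  concave, so between \<open>a0\<close> and \<open>a1\<close> it lies above the smaller endpoint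
  value; strictly, since \<open>th > 0\<close> gives weight to the larger one.\<close>

lemma log_concave_min:
  fixes a :: real
  assumes "0 < a0" "a0 < a" "a \<le> a1" "real q * a1 < t" "1 \<le> q"
    and u: "\<And>b. u b = (t - real q * b) * b ^ (q - 1)"
    and less: "u a0 < u a1"
  shows "u a0 < u a"
proof -
  define th where "th = (a - a0) / (a1 - a0)"
  have th: "0 < th" "th \<le> 1" using assms by (auto simp: th_def field_simps)
  have a: "a = (1 - th) * a0 + th * a1"
  proof -
    have "th * (a1 - a0) = a - a0" using assms by (simp add: th_def)
    then show ?thesis by (simp add: algebra_simps)
  qed
  have ln_cc: "(1 - th) * ln b + th * ln c \<le> ln ((1 - th) * b + th * c)" if "0 < b" "0 < c" for b c :: real
    using concave_onD[OF ln_concave, of th b c] th that by simp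
  have lin: "real q * a0 < t" "real q * a < t"
    using assms by (meson le_less_trans mult_left_mono of_nat_0_le_iff less_imp_le order_trans)+
  have ulog: "0 < u b" "ln (u b) = ln (t - real q * b) + real (q - 1) * ln b" if "0 < b" "real q * b < t" for b
    using that by (auto simp: u ln_mult ln_realpow)
  have e: "t - real q * a = (1 - th) * (t - real q * a0) + th * (t - real q * a1)"
    by (subst a) (simp add: algebra_simps)
  have "(1 - th) * ln (u a0) + th * ln (u a1) =
      ((1 - th) * ln (t - real q * a0) + th * ln (t - real q * a1)) + real (q - 1) * ((1 - th) * ln a0 + th * ln a1)"
    using assms lin by (simp add: ulog algebra_simps)
  also have "\<dots> \<le> ln (t - real q * a) + real (q - 1) * ln a"
    using ln_cc[of "t - real q * a0" "t - real q * a1"] ln_cc[of a0 a1] assms lin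
    unfolding e[symmetric] a[symmetric] by (intro add_mono mult_left_mono) auto
  also have "\<dots> = ln (u a)" using ulog(2)[of a] assms lin by simp
  finally have "(1 - th) * ln (u a0) + th * ln (u a1) \<le> ln (u a)" .
  moreover have "th * ln (u a0) < th * ln (u a1)"
    using th less ulog(1)[of a0] ulog(1)[of a1] assms lin by simp
  ultimately have "ln (u a0) < ln (u a)" by (simp add: algebra_simps)
  then show ?thesis using ulog(1)[of a0] ulog(1)[of a] assms lin by simp
qed

locale product_sum =
  fixes d :: nat and x :: "nat \<Rightarrow> real"
  assumes d_ge: "1 \<le> d"
    and x_pos: "i \<le> d \<Longrightarrow> 0 < x i"
    and x_dec: "i < d \<Longrightarrow> x (Suc i) \<le> x i"
    and x_sum: "sum x {0..<Suc d} = 1"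
    and product_sum: "1 \<le> m \<Longrightarrow> m \<le> d \<Longrightarrow> prod x {0..<m} \<le> sum x {m..<Suc d}"
begin

lemma antimono: "i \<le> j \<Longrightarrow> j \<le> d \<Longrightarrow> x j \<le> x i"
proof (induction j rule: dec_induct)
  case (step n)
  then show ?case using x_dec[of n] by simp
qed simp

lemma tail_sum_split: "k \<le> m \<Longrightarrow> m \<le> Suc d \<Longrightarrow> sum x {k..<Suc d} = sum x {k..<m} + sum x {m..<Suc d}"
  by (rule sum.atLeastLessThan_concat[symmetric])

text \<open>Suppose the tail at \<open>m\<close> is at most \<open>1 / sylp m\<close>. Subtracting
  it from the earlier tails shows that the sums over \<open>{k..<m}\<close> dominate those of the
  Sylvester reciprocals, so the product of the first \<open>m\<close> entries is at least
  \<open>1 / sylp m\<close>. By \<open>product_sum\<close> so is the tail; everything is then an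
  equality, and the comparison identifies the first \<open>m\<close> entries.\<close>

lemma tail_ge: "m \<le> d \<Longrightarrow> 1 / sylp m \<le> sum x {m..<Suc d}"
  and tail_eq: "m \<le> d \<Longrightarrow> sum x {m..<Suc d} = 1 / sylp m \<Longrightarrow> i < m \<Longrightarrow> x i = 1 / (sylp i + 1)"
proof -
  have "1 / sylp m \<le> sum x {m..<Suc d} \<and>
      (sum x {m..<Suc d} = 1 / sylp m \<longrightarrow> (\<forall>i<m. x i = 1 / (sylp i + 1)))"
    if "m \<le> d" for m
    using that
  proof (induction m rule: less_induct)
    case (less m)
    show ?case
    proof (cases "m = 0")
      case True
      show ?thesis unfolding True x_sum by simp
    next
      case m0: False
      have *: "(\<forall>i<m. x i = 1 / (sylp i + 1)) \<and> sum x {m..<Suc d} = 1 / sylp m"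
        if le: "sum x {m..<Suc d} \<le> 1 / sylp m"
      proof -
        have tails: "(\<Sum>i=k..<m. 1 / (sylp i + 1)) \<le> sum x {k..<m}" if "k < m" for k
        proof -
          have "1 / sylp k \<le> sum x {k..<Suc d}" 
            using that less.prems by (intro less.IH[THEN conjunct1]) linarith+
          moreover have "sum x {k..<Suc d} = sum x {k..<m} + sum x {m..<Suc d}"
            using that less.prems by (intro tail_sum_split) linarith+
          ultimately show ?thesis using le sum_inverse_sylv[of k m] that by linarith
        qed
        have xp: "0 < x i" if "i < m" for i using x_pos[of i] that less.prems by simp
        have xd: "x (Suc i) \<le> x i" if "Suc i < m" for i using x_dec[of i] that less.prems by simp
        have ge: "(\<Prod>i=0..<m. 1 / (sylp i + 1)) \<le> prod x {0..<m}"
          by (intro prod_ge_of_tail_sums(1)) (simp_all add: tails xp xd)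
        have pr: "(\<Prod>i=0..<m. 1 / (sylp i + 1)) = 1 / sylp m"
          using prod_inverse_sylv[of 0 m] by simp
        have "prod x {0..<m} \<le> sum x {m..<Suc d}"
          using m0 less.prems by (intro product_sum) linarith+
        then have eq: "prod x {0..<m} = 1 / sylp m" "sum x {m..<Suc d} = 1 / sylp m"
          using ge pr le by linarith+
        have "x i = 1 / (sylp i + 1)" if "i < m" for i
          by (rule prod_ge_of_tail_sums(2)[of 0 m]) (use that in \<open>simp_all add: tails xp xd eq(1) pr\<close>)
        then show ?thesis using eq(2) by simp
      qed
      show ?thesis
      proof (cases "sum x {m..<Suc d} \<le> 1 / sylp m")
        case True
        show ?thesis using *[OF True] by (metis order_refl)
      next
        case False
        then show ?thesis by (simp only: not_le) (auto simp only: less_imp_le less_irrefl)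
      qed
    qed
  qed
  then show "m \<le> d \<Longrightarrow> 1 / sylp m \<le> sum x {m..<Suc d}"
    and "m \<le> d \<Longrightarrow> sum x {m..<Suc d} = 1 / sylp m \<Longrightarrow> i < m \<Longrightarrow> x i = 1 / (sylp i + 1)"
    by blast+
qed

lemma tail_minus_last_ge:
  "k < d \<Longrightarrow> 1 / sylp k - x d \<le> sum x {k..<d}"
  using tail_ge[of k] tail_sum_split[of k d] by simp

lemma tail_ge_last:
  "real (d - k) * x d \<le> sum x {k..<d}"
  using sum_bounded_below[of "{k..<d}" "x d" x] antimono by simp

text \<open>The comparison sequence \<open>z\<close> meets the bounds of
  \<open>tail_minus_last_ge\<close> with equality: it follows the Sylvester reciprocals and puts all
  that is left, \<open>1 / D - x d\<close>, at \<open>d - 1\<close>. Its product decreases in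
  \<open>x d\<close>, so it is least at the largest admissible value
  \<open>1 / (2 * D)\<close>.\<close>

lemma prod_tail_small_last:
  assumes "p < d" "x d \<le> 1 / (2 * sylp (d - 1))"
  shows "sylp p / (2 * sylp (d - 1) ^ 2) \<le> prod x {p..<d}"
    and "prod x {p..<d} = sylp p / (2 * sylp (d - 1) ^ 2) \<Longrightarrow>
      x d = 1 / (2 * sylp (d - 1)) \<and> sum x {p..<Suc d} = 1 / sylp p \<and>
      (\<forall>i\<in>{p..<d-1}. x i = 1 / (sylp i + 1)) \<and> x (d - 1) = 1 / (2 * sylp (d - 1))"
proof -
  define D where "D = sylp (d - 1)"
  have D: "0 < D" by (simp add: D_def)
  have a: "x d \<le> 1 / (2 * D)" using assms by (simp add: D_def)
  have a': "x d < 1 / D" using a D by (simp add: field_simps) 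
  have Suc_d: "Suc (d - 1) = d" using assms by simp
  define z where "z i = (if i < d - 1 then 1 / (sylp i + 1) else 1 / D - x d)" for i
  have zsum: "sum z {k..<d} = 1 / sylp k - x d" if "k < d" for k
  proof -
    have "sum z {k..<d} = sum z {k..<d-1} + z (d - 1)"
      using that sum.atLeastLessThan_Suc[of k "d-1" z] Suc_d by simp
    also have "sum z {k..<d-1} = (\<Sum>i=k..<d-1. 1 / (sylp i + 1))"
      by (intro sum.cong) (auto simp: z_def)
    finally show ?thesis using sum_inverse_sylv[of k "d-1"] that by (simp add: z_def D_def)
  qed
  have zprod: "prod z {p..<d} = sylp p / D * (1 / D - x d)"
  proof -
    have "prod z {p..<d} = prod z {p..<d-1} * z (d - 1)"
      using assms prod.atLeastLessThan_Suc[of p "d-1" z] Suc_d by simp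
    also have "prod z {p..<d-1} = (\<Prod>i=p..<d-1. 1 / (sylp i + 1))"
      by (intro prod.cong) (auto simp: z_def)
    finally show ?thesis using prod_inverse_sylv[of p "d-1"] assms by (simp add: z_def D_def)
  qed
  have zpos: "0 < z i" for i using a' by (simp add: z_def)
  have tails: "sum z {k..<d} \<le> sum x {k..<d}" if "k < d" for k
    using tail_minus_last_ge[OF that] zsum[OF that] by simp
  have 1: "prod z {p..<d} \<le> prod x {p..<d}"
    by (intro prod_ge_of_tail_sums(1)) (auto intro!: x_pos x_dec zpos tails)
  have 2: "x i = z i" if "prod x {p..<d} = prod z {p..<d}" "p \<le> i" "i < d" for i
    using that by (intro prod_ge_of_tail_sums(2)[of p d x z]) (auto intro!: x_pos x_dec zpos tails)
  have 3: "sylp p / (2 * D ^ 2) \<le> prod z {p..<d}"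
  proof -
    have "sylp p / (2 * D ^ 2) = sylp p / D * (1 / D - 1 / (2 * D))"
      using D by (simp add: field_simps power2_eq_square)
    also have "\<dots> \<le> sylp p / D * (1 / D - x d)" using a D by (intro mult_left_mono) (auto simp: less_imp_le)
    finally show ?thesis using zprod by simp
  qed
  show "sylp p / (2 * sylp (d - 1) ^ 2) \<le> prod x {p..<d}"
    using 1 3 by (simp add: D_def)
  assume "prod x {p..<d} = sylp p / (2 * sylp (d - 1) ^ 2)"
  then have eq: "prod x {p..<d} = prod z {p..<d}" "prod z {p..<d} = sylp p / (2 * D ^ 2)"
    using 1 3 by (simp_all add: D_def)
  have "sylp p / D * (1 / D - x d) = sylp p / D * (1 / (2 * D))"
    using eq(2) zprod D by (simp add: power2_eq_square)
  moreover have "sylp p / D \<noteq> 0" using D by simp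
  ultimately have "1 / D - x d = 1 / (2 * D)" by (meson mult_left_cancel)
  then have xd: "x d = 1 / (2 * D)" using D by (simp add: field_simps)
  have "sum x {p..<d} = sum z {p..<d}" using 2[OF eq(1)] by (intro sum.cong) auto
  then have sum_p: "sum x {p..<Suc d} = 1 / sylp p" using zsum assms by simp
  have x_pred: "x (d - 1) = 1 / (2 * D)"
    using 2[OF eq(1), of "d - 1"] assms xd \<open>1 / D - x d = 1 / (2 * D)\<close> by (auto simp: z_def)
  have x_i: "x i = 1 / (sylp i + 1)" if "i \<in> {p..<d-1}" for i
    using 2[OF eq(1), of i] that by (auto simp: z_def)
  show "x d = 1 / (2 * sylp (d - 1)) \<and> sum x {p..<Suc d} = 1 / sylp p \<and>
      (\<forall>i\<in>{p..<d-1}. x i = 1 / (sylp i + 1)) \<and> x (d - 1) = 1 / (2 * sylp (d - 1))"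
    using x_pred x_i sum_p xd unfolding D_def by blast
qed

text \<open>With \<open>a = x d\<close> fixed, the smallest product is that of the sequence \<open>z\<close> below, which follows
  \<open>1/s\<^sub>i\<close> as long as possible and then stays at \<open>a\<close>. It is log-concave in \<open>a\<close>, so on each range of \<open>a\<close>
  with the same breakpoint \<open>k\<close> it is minimal at an endpoint, where it is a value of \<open>eqblock\<close>.\<close>

lemma prod_tail_large_last:
  assumes d4: "4 \<le> d" and p: "p < d" and large: "1 / (2 * sylp (d - 1)) < x d"
  shows "sylp p / (2 * sylp (d - 1) ^ 2) < prod x {p..<d}"
proof -
  define a where "a = x d"
  \<comment> \<open>The common value of the last \<open>d - m + 1\<close> entries when the first
    \<open>m\<close> are Sylvester reciprocals and the total is 1.\<close>
  define th where "th m = 1 / (sylp m * real (Suc (d - m)))" for m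
  have th_pos: "0 < th m" for m by (simp add: th_def)
  have a0: "0 < a" using x_pos by (simp add: a_def)
  have th_last: "th (d - 1) < a" 
  proof -
    have "d - (d - 1) = 1" using p by simp
    then show ?thesis using large unfolding th_def a_def by (simp add: mult.commute)
  qed
  have last: "1 / (2 * sylp (d - 1) ^ 2) = eqblock d (d - 1)" using eqblock_last p by simp
  show ?thesis
  proof (cases "th p < a")
    \<comment> \<open>Here the bound \<open>a \<le> x i\<close> alone suffices, because
      \<open>th p ^ (d - p)\<close> is \<open>sylp p * eqblock d p\<close>.\<close>
    case True
    have "sylp p * eqblock d (d - 1) \<le> sylp p * eqblock d p"
      using eqblock_antimono[of d p "d-1"] d4 p by (intro mult_left_mono) (auto simp: less_imp_le)
    also have "\<dots> = th p ^ (d - p)"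
      by (simp add: eqblock_def th_def power_divide power_mult_distrib)
    also have "\<dots> < a ^ (d - p)"
      using True p th_pos[of p] by (intro power_strict_mono) (auto simp: less_imp_le)
    also have "\<dots> = (\<Prod>i\<in>{p..<d}. a)" by simp
    also have "\<dots> \<le> prod x {p..<d}"
      using a0 antimono by (intro prod_mono) (auto simp: a_def)
    finally show ?thesis unfolding last[symmetric] by simp
  next
    case False
    \<comment> \<open>The breakpoint: \<open>th (Suc k) < a \<le> th k\<close>.\<close>
    define k where "k = (GREATEST m. m \<le> d - 1 \<and> a \<le> th m)"
    have k: "k \<le> d - 1 \<and> a \<le> th k"
      unfolding k_def by (rule GreatestI_nat[of _ p "d-1"]) (use False p in auto)
    have pk: "p \<le> k"
      unfolding k_def by (rule Greatest_le_nat[of _ p "d-1"]) (use False p in auto)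
    have kd: "k < d - 1" using k th_last by (metis linorder_not_less order_le_less)
    have gt: "th (Suc k) < a"
    proof (rule ccontr)
      assume "\<not> ?thesis"
      then have "Suc k \<le> k"
        unfolding k_def[symmetric] using kd 
        by (subst (2) k_def) (intro Greatest_le_nat[of _ _ "d-1"], auto)
      then show False by simp
    qed
    define q where "q = d - k"
    have q: "2 \<le> q" using kd by (simp add: q_def)
    define t where "t = 1 / sylp k"
    have t_pos: "0 < t" by (simp add: t_def)
    have thk: "th k = t / real (Suc q)" by (simp add: th_def t_def q_def)
    have qa: "real q * a < t"
    proof -
      have "real q * a \<le> real q * (t / real (Suc q))" using k thk by (intro mult_left_mono) auto
      also have "\<dots> < t" using t_pos by (simp add: field_simps)
      finally show ?thesis .
    qed
    \<comment> \<open>Of the minimal tail \<open>t\<close> at \<open>k\<close>, the \<open>q\<close>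
      positions after \<open>k\<close> take \<open>a\<close> each, the position \<open>d\<close>
      included; \<open>z k\<close> is what remains.\<close>
    define z where "z i = (if i < k then 1 / (sylp i + 1) else if i = k then t - real q * a else a)" for i
    have zpos: "0 < z i" for i using qa a0 by (simp add: z_def)
    define u where "u b = (t - real q * b) * b ^ (q - 1)" for b
    have zafter: "sum z {m..<d} = real (d - m) * a" if "k < m" for m
    proof -
      have "sum z {m..<d} = (\<Sum>i=m..<d. a)" using that by (intro sum.cong) (auto simp: z_def)
      then show ?thesis by simp
    qed
    have zsum: "sum z {m..<d} = 1 / sylp m - a" if "m \<le> k" for m
    proof -
      have "sum z {m..<d} = sum z {m..<k} + sum z {k..<d}"
        using that kd by (intro sum.atLeastLessThan_concat[symmetric]) auto
      also have "sum z {k..<d} = z k + sum z {Suc k..<d}"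
        using kd by (intro sum.atLeast_Suc_lessThan) auto
      also have "sum z {m..<k} = 1 / sylp m - 1 / sylp k"
        unfolding sum_inverse_sylv[OF that, symmetric] by (intro sum.cong) (auto simp: z_def)
      also have "sum z {Suc k..<d} = real (d - Suc k) * a" by (rule zafter) simp
      finally show ?thesis using kd by (simp add: z_def t_def q_def of_nat_diff algebra_simps)
    qed
    have zprod: "prod z {p..<d} = sylp p * (t * u a)"
    proof -
      have "prod z {p..<d} = prod z {p..<k} * prod z {k..<d}"
        using pk kd by (intro prod.atLeastLessThan_concat[symmetric]) auto
      also have "prod z {k..<d} = z k * prod z {Suc k..<d}"
        using kd by (intro prod.atLeast_Suc_lessThan) auto
      also have "prod z {Suc k..<d} = (\<Prod>i=Suc k..<d. a)" by (intro prod.cong) (auto simp: z_def)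
      also have "prod z {p..<k} = sylp p / sylp k"
        unfolding prod_inverse_sylv[OF pk, symmetric] by (intro prod.cong) (auto simp: z_def)
      finally show ?thesis using kd by (simp add: z_def t_def q_def u_def)
    qed
    have "prod z {p..<d} \<le> prod x {p..<d}"
    proof (intro prod_ge_of_tail_sums(1))
      fix m assume "p \<le> m" "m < d"
      then show "sum z {m..<d} \<le> sum x {m..<d}"
        using zafter[of m] zsum[of m] tail_minus_last_ge[of m] tail_ge_last[of m]
        by (cases "m \<le> k") (auto simp: a_def)
    qed (auto intro!: x_pos x_dec zpos)
    moreover have "eqblock d (Suc k) < t * u a"
    proof -
      obtain q' where q': "q = Suc q'" using q by (cases q) auto
      have dSk: "d - Suc k = q'" using q' kd by (simp add: q_def)
      \<comment> \<open>At the two ends of the range of \<open>a\<close>, the entry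
        \<open>z k\<close> becomes the next Sylvester reciprocal or \<open>a\<close> itself, so
        \<open>z\<close> turns into the block sequence with breakpoint \<open>Suc k\<close> or
        \<open>k\<close>.\<close>
      have u0: "t * u (th (Suc k)) = eqblock d (Suc k)"
      proof -
        have "t - real q * th (Suc k) = 1 / (sylp k + 1)"
          using q' by (simp add: t_def th_def dSk sylp_Suc divide_simps del: of_nat_Suc)
        then show ?thesis
          using q' by (simp add: u_def eqblock_def dSk th_def sylp_Suc t_def power_divide power_mult_distrib
            del: of_nat_Suc)
      qed
      have u1: "t * u (th k) = eqblock d k"
      proof -
        have "t - real q * th k = t / real (Suc q)"
          unfolding thk by (simp add: field_simps)
        then show ?thesis
          using q' by (simp add: u_def thk eqblock_def q_def[symmetric] t_def power_divide power_mult_distrib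
            del: of_nat_Suc)
      qed
      have "t * u (th (Suc k)) < t * u (th k)"
        unfolding u0 u1 using eqblock_Suc[of d k] d4 kd by simp
      then have less: "u (th (Suc k)) < u (th k)" using t_pos by (metis mult_less_cancel_left_pos)
      have qth: "real q * th k < t" unfolding thk using t_pos by (simp add: field_simps)
      have "1 \<le> q" using q by linarith
      then have "u (th (Suc k)) < u a"
        by (rule log_concave_min[OF th_pos gt conjunct2[OF k] qth _ u_def less])
      then have "t * u (th (Suc k)) < t * u a"
        by (intro mult_strict_left_mono) (auto simp: t_def)
      then show ?thesis using u0 by simp
    qed
    moreover have "eqblock d (d - 1) \<le> eqblock d (Suc k)"
      using eqblock_antimono[of d "Suc k" "d-1"] d4 kd by simp
    ultimately have "sylp p * eqblock d (d - 1) < sylp p * (t * u a)" "sylp p * (t * u a) \<le> prod x {p..<d}"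
      using zprod by (auto intro!: mult_strict_left_mono)
    then show ?thesis unfolding last[symmetric] by simp
  qed
qed

theorem prod_tail_ge:
  assumes "4 \<le> d" "p < d"
  shows "sylp p / (2 * sylp (d - 1) ^ 2) \<le> prod x {p..<d}"
  using prod_tail_large_last[OF assms] prod_tail_small_last(1)[OF assms(2)] by force

theorem prod_tail_eq:
  assumes "4 \<le> d" "p < d" "prod x {p..<d} = sylp p / (2 * sylp (d - 1) ^ 2)"
  shows "i < d - 1 \<Longrightarrow> x i = 1 / (sylp i + 1)"
    and "x (d - 1) = 1 / (2 * sylp (d - 1))" and "x d = 1 / (2 * sylp (d - 1))"
proof -
  have "x d \<le> 1 / (2 * sylp (d - 1))"
    using prod_tail_large_last[OF assms(1,2)] assms(3) by linarith
  note * = prod_tail_small_last(2)[OF assms(2) this assms(3)]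
  \<comment> \<open>Entries from \<open>p\<close> on are fixed by the comparison. Those before
    \<open>p\<close> do not occur in the product; they are fixed because the tail at
    \<open>p\<close> is minimal.\<close>
  then show "i < d - 1 \<Longrightarrow> x i = 1 / (sylp i + 1)"
    using tail_eq[of p i] assms(2) by (cases "i < p") auto
  show "x (d - 1) = 1 / (2 * sylp (d - 1))" "x d = 1 / (2 * sylp (d - 1))" using * by auto
qed

end

section \<open>Linear images and Lebesgue measure\<close>

text \<open>The library proves this for well-ordered index types only.\<close>

lemma measure_linear_image_finite:
  fixes f :: "real^'n \<Rightarrow> real^'n"
  assumes "linear f" "S \<in> lmeasurable"
  shows measurable_linear_image_finite: "f ` S \<in> lmeasurable"
    and "measure lebesgue (f ` S) = \<bar>det (matrix f)\<bar> * measure lebesgue S"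
proof -
  define P where "P f \<longleftrightarrow> (\<forall>S\<in>lmeasurable. f ` S \<in> lmeasurable \<and>
      measure lebesgue (f ` S) = \<bar>det (matrix f)\<bar> * measure lebesgue S)" for f :: "real^'n \<Rightarrow> real^'n"
  \<comment> \<open>Serves the coordinate swaps and shears, whose determinants have absolute value
    1: for them preservation of volume need only be checked on boxes.\<close>
  have unit: "P h" if "linear h" "\<bar>det (matrix h)\<bar> = 1"
      "\<And>a b. cbox a b \<noteq> {} \<Longrightarrow> measure lebesgue (h ` cbox a b) = measure lebesgue (cbox a b)" for h
    unfolding P_def
  proof
    fix S :: "(real^'n) set" assume S: "S \<in> lmeasurable"
    have "measure lebesgue (h ` cbox a b) = 1 * measure lebesgue (cbox a b)" for a b
      using that(3)[of a b] by (cases "cbox a b = {}") auto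
    from measure_linear_sufficient[OF that(1) S this]
    show "h ` S \<in> lmeasurable \<and> measure lebesgue (h ` S) = \<bar>det (matrix h)\<bar> * measure lebesgue S"
      using that(2) by simp
  qed
  have "P f"
  proof (rule induct_linear_elementary[OF assms(1)])
    fix f g :: "real^'n \<Rightarrow> real^'n" assume "linear f" "linear g" "P f" "P g"
    then show "P (f \<circ> g)"
      unfolding P_def image_comp[symmetric] by (simp add: matrix_compose det_mul abs_mult)
  next
    fix f :: "real^'n \<Rightarrow> real^'n" and i assume f: "linear f" "\<And>x. f x $ i = 0"
    have "\<not> surj f"
    proof
      assume "surj f"
      then obtain x where "f x = axis i 1" by (metis surjD)
      then show False using f(2)[of x] by simp
    qed
    then have ninj: "\<not> inj f" using f(1) linear_injective_imp_surjective by blast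
    then have det0: "det (matrix f) = 0" using det_nz_iff_inj f(1) by blast
    have "negligible (f ` S)" for S using negligible_linear_singular_image f(1) ninj by blast
    then show "P f" using det0 by (simp add: P_def negligible_iff_measure)
  next
    fix c :: "'n \<Rightarrow> real"
    have "matrix (\<lambda>x. \<chi> i. c i * x $ i) = (\<chi> i j. if i = j then c i else 0)"
      by (simp add: matrix_def axis_def vec_eq_iff)
    then have "det (matrix (\<lambda>x. \<chi> i. c i * x $ i)) = prod c UNIV"
      by (simp add: det_diagonal)
    then show "P (\<lambda>x. \<chi> i. c i * x $ i)"
      by (simp add: P_def measurable_stretch measure_stretch)
  next
    fix m n :: 'n assume "m \<noteq> n"
    define \<pi> where "\<pi> = Transposition.transpose m n"
    have \<pi>: "\<pi> (\<pi> i) = i" for i by (simp add: \<pi>_def)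
    define h where "h = (\<lambda>x::real^'n. \<chi> i. x $ \<pi> i)"
    have lin: "linear h" by (auto intro!: linearI simp: h_def vec_eq_iff)
    have hh: "h (h x) = x" for x by (simp add: h_def \<pi> vec_eq_iff)
    have "matrix (h \<circ> h) = mat 1" using hh matrix_id_mat_1 by (simp add: comp_def id_def)
    then have "det (matrix h) * det (matrix h) = 1"
      using matrix_compose[OF lin lin] by (metis det_I det_mul)
    then have "\<bar>det (matrix h)\<bar> = 1"
      by (metis abs_1 abs_mult_self_eq mult.right_neutral mult_cancel_left1 abs_mult square_eq_1_iff abs_minus_cancel)
    moreover have "measure lebesgue (h ` cbox a b) = measure lebesgue (cbox a b)" if "cbox a b \<noteq> {}" for a b
    proof -
      have mem: "x \<in> cbox a b \<longleftrightarrow> h x \<in> cbox (h a) (h b)" for a b x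
        unfolding mem_box_cart h_def by simp (metis \<pi>)
      have im: "h ` cbox a b = cbox (h a) (h b)"
      proof (intro subset_antisym subsetI)
        fix y assume "y \<in> cbox (h a) (h b)"
        then have "h y \<in> cbox a b" using mem[of "h y"] hh by simp
        then show "y \<in> h ` cbox a b" using hh by (metis imageI)
      qed (use mem in auto)
      then have ne: "cbox (h a) (h b) \<noteq> {}" using that by auto
      have "prod (\<lambda>i. b $ \<pi> i - a $ \<pi> i) UNIV = prod (\<lambda>i. b $ i - a $ i) UNIV"
        by (rule prod.reindex_bij_betw) (metis \<pi> bijI')
      then show ?thesis
        unfolding im using content_cbox_cart[OF that] content_cbox_cart[OF ne] by (simp add: h_def)
    qed
    ultimately have "P h" by (intro unit lin)
    then show "P (\<lambda>x. \<chi> i. x $ Transposition.transpose m n i)"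
      by (simp add: h_def \<pi>_def)
  next
    fix m n :: 'n assume mn: "m \<noteq> n"
    define h where "h = (\<lambda>x::real^'n. \<chi> i. if i = m then x $ m + x $ n else x $ i)"
    have lin: "linear h" by (auto intro!: linearI simp: h_def vec_eq_iff algebra_simps)
    have "matrix h = (\<chi> k. if k = m then row m (mat 1) + 1 *s row n (mat 1) else row k (mat 1))"
      using mn by (auto simp: matrix_def h_def row_def mat_def axis_def vec_eq_iff)
    then have "\<bar>det (matrix h)\<bar> = 1"
      using det_row_operation[OF mn, of "mat 1 :: real^'n^'n" 1] by simp
    moreover have "measure lebesgue (h ` cbox a b) = measure lebesgue (cbox a b)" if "cbox a b \<noteq> {}" for a b
    proof -
      have ab: "cbox a b = (+) a ` cbox 0 (b - a)" by (simp flip: cbox_translation)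
      have "h ` cbox a b = (+) (h a) ` h ` cbox 0 (b - a)"
        unfolding ab image_comp by (rule image_cong) (simp_all add: linear_add[OF lin])
      then have "measure lebesgue (h ` cbox a b) = measure lebesgue (h ` cbox 0 (b - a))"
        by (simp only: measure_translation)
      also have "\<dots> = measure lebesgue (cbox 0 (b - a))"
        unfolding h_def using that ab by (intro measure_shear_interval[OF mn]) auto
      also have "\<dots> = measure lebesgue (cbox a b)"
        unfolding ab by (simp only: measure_translation)
      finally show ?thesis .
    qed
    ultimately have "P h" by (intro unit lin)
    then show "P (\<lambda>x. \<chi> i. if i = m then x $ m + x $ n else x $ i)" by (simp add: h_def)
  qed
  then show "f ` S \<in> lmeasurable"
    and "measure lebesgue (f ` S) = \<bar>det (matrix f)\<bar> * measure lebesgue S"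
    using assms(2) by (auto simp: P_def)
qed

section \<open>Minkowski's theorem on linear forms\<close>

lemma int_points_eq_range: "int_points = range (\<lambda>f::'n \<Rightarrow> int. (\<chi> i. of_int (f i)) :: real^'n)"
proof (intro subset_antisym subsetI)
  fix x :: "real^'n" assume "x \<in> int_points"
  then have "x = (\<chi> i. of_int \<lfloor>x $ i\<rfloor>)"
    by (auto simp: int_points_def vec_eq_iff floor_of_int elim!: Ints_cases allE)
  then show "x \<in> range (\<lambda>f::'n \<Rightarrow> int. \<chi> i. of_int (f i))" by (metis rangeI)
qed (auto simp: int_points_def)

lemma countable_int_points: "countable (int_points :: (real^'n) set)"
  unfolding int_points_eq_range by simp

lemma int_points_diff: "x \<in> int_points \<Longrightarrow> y \<in> int_points \<Longrightarrow> x - y \<in> int_points"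
  and int_points_add: "x \<in> int_points \<Longrightarrow> y \<in> int_points \<Longrightarrow> x + y \<in> int_points"
  and int_points_uminus: "x \<in> int_points \<Longrightarrow> - x \<in> int_points"
  and int_points_scaleR: "x \<in> int_points \<Longrightarrow> c \<in> \<int> \<Longrightarrow> c *\<^sub>R x \<in> int_points"
  and int_points_0: "0 \<in> int_points"
  by (auto simp: int_points_def)

lemma int_points_sum: "(\<And>i. i \<in> I \<Longrightarrow> f i \<in> int_points) \<Longrightarrow> sum f I \<in> int_points"
  by (induction I rule: infinite_finite_induct) (auto simp: int_points_0 int_points_add)

text \<open>The half-open unit cubes at integral points cut \<open>H\<close> into the pieces
  \<open>A z\<close>, each point in exactly one. If no two points of \<open>H\<close> differ by an
  integral vector, the translates \<open>B z\<close> of these pieces into one cube are disjoint, so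
  \<open>H\<close> has measure at most 1.\<close>

lemma blichfeldt:
  fixes H :: "(real^'n) set"
  assumes H[measurable]: "H \<in> sets borel" and large: "1 < emeasure lborel H"
  obtains x y where "x \<in> H" "y \<in> H" "x \<noteq> y" "x - y \<in> int_points"
proof (rule ccontr)
  assume neg: "\<not> thesis"
  define Q :: "(real^'n) set" where "Q = {x. \<forall>i. 0 \<le> x $ i \<and> x $ i < 1}"
  have [measurable]: "Q \<in> sets borel" unfolding Q_def by measurable
  define A where "A z = {y \<in> H. y - z \<in> Q}" for z
  define B where "B z = {x \<in> Q. z + x \<in> H}" for z
  have [measurable]: "A z \<in> sets borel" "B z \<in> sets borel" for z
    unfolding A_def B_def by measurable
  have AB: "emeasure lborel (A z) = emeasure lborel (B z)" for z
  proof -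
    have "emeasure lborel (A z) = emeasure (distr lborel borel ((+) z)) (A z)"
      by (simp add: lborel_distr_plus)
    also have "\<dots> = emeasure lborel ((+) z -` A z)"
      by (subst emeasure_distr) auto
    also have "(+) z -` A z = B z" by (auto simp: A_def B_def)
    finally show ?thesis .
  qed
  have Q_unique: "z = z'" if "z \<in> int_points" "z' \<in> int_points" "y - z \<in> Q" "y - z' \<in> Q" for y z z'
  proof -
    have "z $ i = z' $ i" for i
    proof -
      have "z $ i = of_int \<lfloor>y $ i\<rfloor>" if z: "z \<in> int_points" and yz: "y - z \<in> Q" for z
      proof -
        obtain k :: int where "z $ i = of_int k"
          using z unfolding int_points_def by (auto elim: Ints_cases)
        moreover have "0 \<le> y $ i - z $ i" "y $ i - z $ i < 1" using yz by (auto simp: Q_def)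
        ultimately have "\<lfloor>y $ i\<rfloor> = k" by (intro floor_unique) auto
        then show ?thesis using \<open>z $ i = of_int k\<close> by simp
      qed
      then show ?thesis using that by metis
    qed
    then show ?thesis by (simp add: vec_eq_iff)
  qed
  have cover: "H = (\<Union>z\<in>int_points. A z)"
  proof (intro subset_antisym subsetI)
    fix y assume "y \<in> H"
    then have "y \<in> A (\<chi> i. of_int \<lfloor>y $ i\<rfloor>)" by (auto simp: A_def Q_def) linarith
    moreover have "(\<chi> i. of_int \<lfloor>y $ i\<rfloor>) \<in> int_points" by (simp add: int_points_def)
    ultimately show "y \<in> (\<Union>z\<in>int_points. A z)" by blast
  qed (auto simp: A_def)
  have "disjoint_family_on A int_points"
    using Q_unique by (auto simp: disjoint_family_on_def A_def)
  then have "emeasure lborel H = (\<integral>\<^sup>+z. emeasure lborel (A z) \<partial>count_space int_points)"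
    by (subst cover, intro emeasure_UN_countable) (auto simp: countable_int_points)
  also have "\<dots> = (\<integral>\<^sup>+z. emeasure lborel (B z) \<partial>count_space int_points)"
    by (simp add: AB)
  also have "\<dots> = emeasure lborel (\<Union>z\<in>int_points. B z)"
  proof (rule emeasure_UN_countable[symmetric])
    show "disjoint_family_on B int_points"
      unfolding disjoint_family_on_def
    proof (intro ballI impI)
      fix z z' :: "real^'n" assume z: "z \<in> int_points" "z' \<in> int_points" "z \<noteq> z'"
      then have "False" if "x \<in> B z" "x \<in> B z'" for x
      proof -
        have "z + x \<in> H" "z' + x \<in> H" "z + x \<noteq> z' + x" "z + x - (z' + x) \<in> int_points"
          using that z int_points_diff[OF z(1,2)] by (simp_all add: B_def)
        then show False using neg \<open>\<And>x y. \<lbrakk>x \<in> H; y \<in> H; x \<noteq> y; x - y \<in> int_points\<rbrakk> \<Longrightarrow> thesis\<close> by blast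
      qed
      then show "B z \<inter> B z' = {}" by auto
    qed
  qed (auto simp: countable_int_points)
  also have "\<dots> \<le> emeasure lborel (cbox 0 (\<chi> i. 1) :: (real^'n) set)"
    by (intro emeasure_mono) (auto simp: B_def Q_def mem_box_cart less_imp_le)
  also have "\<dots> = 1"
    by (subst emeasure_lborel_cbox_eq) (auto simp: Basis_vec_def inner_axis prod.neutral)
  finally show False using large by simp
qed

text \<open>Blichfeldt's lemma for the preimage \<open>H\<close> of the open box with half-sides
  \<open>c i / 2\<close>, whose volume is \<open>prod c UNIV / \<bar>det A\<bar>\<close>: a
  difference of two points of \<open>H\<close> satisfies the bounds \<open>c i\<close>.\<close>

theorem minkowski_linear_forms:
  fixes A :: "real^'n^'n" and c :: "'n \<Rightarrow> real"
  assumes det: "det A \<noteq> 0" and c: "\<And>i. 0 < c i" and less: "\<bar>det A\<bar> < prod c UNIV"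
  obtains x where "x \<in> int_points" "x \<noteq> 0" "\<And>i. \<bar>(A *v x) $ i\<bar> < c i"
proof -
  obtain B where AB: "A ** B = mat 1"
    using det unfolding invertible_det_nz[symmetric] invertible_def by blast
  have det_B: "\<bar>det B\<bar> = 1 / \<bar>det A\<bar>"
  proof -
    have "det A * det B = 1" using AB by (metis det_I det_mul)
    then show ?thesis using det by (simp add: field_simps flip: abs_mult)
  qed
  define u where "u = (\<chi> i. c i / 2)"
  define H where "H = (*v) B ` box (- u) u"
  have lin: "linear ((*v) B)" by simp
  have box: "measure lebesgue (box (-u) u) = prod c UNIV"
  proof -
    have "measure lebesgue (box (-u) u) = measure lebesgue (cbox (-u) u)"
      by (simp add: measure_lborel_box_eq measure_lborel_cbox_eq)
    also have "\<dots> = prod c UNIV"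
    proof -
      have "0 \<in> cbox (-u) u" using c by (auto simp: mem_box_cart u_def less_imp_le)
      then have "cbox (-u) u \<noteq> {}" by blast
      from content_cbox_cart[OF this] show ?thesis by (simp add: u_def)
    qed
    finally show ?thesis .
  qed
  have m: "H \<in> lmeasurable" "measure lebesgue H = \<bar>det B\<bar> * prod c UNIV"
    using measure_linear_image_finite[OF lin, of "box (-u) u"] box by (auto simp: H_def)
  have Hvim: "H = (*v) A -` box (-u) u"
  proof -
    have "B *v (A *v x) = x" "A *v (B *v x) = x" for x
      using AB matrix_left_right_inverse[of A B] by (auto simp: matrix_vector_mul_assoc)
    then show ?thesis by (auto simp: H_def image_iff) metis
  qed
  have "H \<in> sets borel"
    unfolding Hvim by (intro borel_open open_vimage) (auto intro!: continuous_intros linear_continuous_on simp: linear_linear)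
  moreover have "1 < emeasure lborel H"
  proof -
    have "1 < measure lebesgue H" unfolding m(2) det_B using less det by (simp add: divide_simps)
    moreover have "emeasure lebesgue H = ennreal (measure lebesgue H)"
      using m(1) by (intro emeasure_eq_ennreal_measure) (auto simp: fmeasurable_def)
    ultimately have "ennreal 1 < emeasure lebesgue H" by (simp only: ennreal_less_iff zero_le_one)
    then show ?thesis using \<open>H \<in> sets borel\<close> by simp
  qed
  ultimately obtain x y where xy: "x \<in> H" "y \<in> H" "x \<noteq> y" "x - y \<in> int_points"
    by (rule blichfeldt)
  show ?thesis
  proof (rule that[of "x - y"])
    fix i
    have half: "\<bar>z $ i\<bar> < c i / 2" if "z \<in> box (-u) u" for z
    proof -
      have "(-u) $ i < z $ i" "z $ i < u $ i" using that unfolding mem_box_cart by blast+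
      then show ?thesis unfolding u_def vec_lambda_beta vector_uminus_component by linarith
    qed
    have "\<bar>(A *v x) $ i\<bar> < c i / 2" "\<bar>(A *v y) $ i\<bar> < c i / 2"
      using xy(1,2) half unfolding Hvim by simp_all
    then show "\<bar>(A *v (x - y)) $ i\<bar> < c i"
      by (simp add: matrix_vector_mult_diff_distrib)
  qed (use xy in auto)
qed

section \<open>Integral matrices and lattice bases\<close>

definition colm :: "('n \<Rightarrow> real^'n) \<Rightarrow> real^'n^'n" where
  "colm q = (\<chi> i j. q j $ i)"

lemma colm_mult_vec: "colm q *v x = (\<Sum>j\<in>UNIV. x $ j *\<^sub>R q j)"
  by (simp add: colm_def matrix_vector_mult_def vec_eq_iff mult.commute)

lemma matrix_mult_colm: "(V ** colm q) $ i $ j = V $ i \<bullet> q j"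
  by (simp add: colm_def matrix_matrix_mult_def inner_vec_def)

lemma colm_mult_axis: "colm q *v axis j 1 = q j"
  by (simp add: colm_mult_vec axis_def if_distrib[of "\<lambda>t. t *\<^sub>R _"] cong: if_cong)

lemma colm_columns: "colm (\<lambda>j. A *v axis j 1) = A"
  by (simp add: colm_def matrix_vector_mult_basis column_def vec_eq_iff)

lemma det_Ints:
  fixes A :: "real^'n^'n"
  assumes "\<And>i j. A $ i $ j \<in> \<int>"
  shows "det A \<in> \<int>"
  unfolding det_def by (intro Ints_sum Ints_mult Ints_prod Ints_of_int assms)

lemma det_nonzero_Ints_ge_1:
  fixes A :: "real^'n^'n"
  assumes "\<And>i j. A $ i $ j \<in> \<int>" "det A \<noteq> 0"
  shows "1 \<le> \<bar>det A\<bar>"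
  using det_Ints[OF assms(1)] assms(2) Ints_nonzero_abs_ge1 by blast

lemma cramer_Ints:
  fixes A :: "real^'n^'n"
  assumes A: "\<And>i j. A $ i $ j \<in> \<int>" and b: "A *v x \<in> int_points"
  shows "det A *\<^sub>R x \<in> int_points"
proof -
  have "x $ k * det A \<in> \<int>" for k
    unfolding cramer_lemma[symmetric] using A b by (intro det_Ints) (auto simp: int_points_def)
  then show ?thesis by (simp add: int_points_def mult.commute)
qed

lemma unimodular_solution_Ints:
  fixes A :: "real^'n^'n"
  assumes A: "\<And>i j. A $ i $ j \<in> \<int>" and b: "A *v x \<in> int_points" and det: "\<bar>det A\<bar> = 1"
  shows "x \<in> int_points"
proof -
  have "det A *\<^sub>R (det A *\<^sub>R x) \<in> int_points"
    using cramer_Ints[OF A b] det_Ints[OF A] by (rule int_points_scaleR)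
  moreover have "det A * det A = 1" using det by (metis abs_mult_self_eq mult_1)
  ultimately show ?thesis by simp
qed

lemma inner_Ints: "x \<in> int_points \<Longrightarrow> y \<in> int_points \<Longrightarrow> x \<bullet> y \<in> \<int>"
  by (auto simp: inner_vec_def int_points_def intro!: Ints_sum Ints_mult)

text \<open>In the application the rows of \<open>V\<close> are all vertices but one, and
  \<open>K\<close> marks those whose index belongs to the face. The vectors \<open>y j\<close> with
  \<open>j\<close> in \<open>K\<close> then span the direction space of the face of the
  polar.\<close>

locale dual_basis =
  fixes V :: "real^'n^'n" and y :: "'n \<Rightarrow> real^'n" and K :: "'n set"
  assumes V_int: "\<And>i. V $ i \<in> int_points"
    and dual: "\<And>i j. V $ i \<bullet> y j = (if i = j then 1 else 0)"
begin

text \<open>Completes a family living on \<open>K\<close> to a square one, so that lower-dimensional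
  lattices can be handled with full determinants.\<close>

definition ext :: "('n \<Rightarrow> real^'n) \<Rightarrow> 'n \<Rightarrow> real^'n" where
  "ext b j = (if j \<in> K then b j else y j)"

definition Lat :: "(real^'n) set" where
  "Lat = int_points \<inter> span (y ` K)"

lemma V_Ints: "V $ i $ j \<in> \<int>"
  using V_int by (simp add: int_points_def)

lemma V_inverse: "V ** colm y = mat 1"
  by (simp add: vec_eq_iff matrix_mult_colm dual mat_def)

lemma det_V_nz: "det V \<noteq> 0"
  using V_inverse by (metis det_I det_mul mult_zero_left zero_neq_one)

lemma V_inj: "(\<And>i. V $ i \<bullet> x = V $ i \<bullet> z) \<Longrightarrow> x = z"
proof -
  assume *: "\<And>i. V $ i \<bullet> x = V $ i \<bullet> z"
  then have "V *v x = V *v z" by (simp add: vec_eq_iff matrix_vector_mul_component)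
  then have "colm y *v (V *v x) = colm y *v (V *v z)" by simp
  then show "x = z"
    using V_inverse matrix_left_right_inverse[of V "colm y"] by (simp add: matrix_vector_mul_assoc)
qed

lemma expand: "x = (\<Sum>j\<in>UNIV. (V $ j \<bullet> x) *\<^sub>R y j)"
  by (rule V_inj) (simp add: inner_sum_right dual if_distrib cong: if_cong)

lemma span_y_iff: "x \<in> span (y ` K) \<longleftrightarrow> (\<forall>i. i \<notin> K \<longrightarrow> V $ i \<bullet> x = 0)"
proof
  assume "x \<in> span (y ` K)"
  then show "\<forall>i. i \<notin> K \<longrightarrow> V $ i \<bullet> x = 0"
    by (induction rule: span_induct_alt) (auto simp: inner_add_right dual split: if_splits)
next
  assume *: "\<forall>i. i \<notin> K \<longrightarrow> V $ i \<bullet> x = 0"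
  have "(\<Sum>j\<in>UNIV. (V $ j \<bullet> x) *\<^sub>R y j) \<in> span (y ` K)"
  proof (rule span_sum)
    fix j show "(V $ j \<bullet> x) *\<^sub>R y j \<in> span (y ` K)"
      using * by (cases "j \<in> K") (auto intro: span_scale span_base simp: span_zero)
  qed
  then show "x \<in> span (y ` K)" using expand[of x] by simp
qed

lemma Lat_sum: "(\<And>j. j \<in> K \<Longrightarrow> b j \<in> Lat) \<Longrightarrow> (\<Sum>j\<in>K. of_int (c j) *\<^sub>R b j) \<in> Lat"
  unfolding Lat_def by (auto intro!: int_points_sum int_points_scaleR span_sum span_scale)

text \<open>Rows outside \<open>K\<close> annihilate the span, so in
  \<open>V ** colm (ext b)\<close> they are unit rows. The determinant of that matrix therefore only
  sees the pairing of \<open>V\<close> with \<open>b\<close> on \<open>K\<close>.\<close>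

lemma outside_ext:
  assumes b: "\<And>j. j \<in> K \<Longrightarrow> b j \<in> span (y ` K)" and i: "i \<notin> K"
  shows "V $ i \<bullet> (colm (ext b) *v x) = x $ i"
proof -
  have "V $ i \<bullet> (colm (ext b) *v x) = (\<Sum>j\<in>UNIV. x $ j * (V $ i \<bullet> ext b j))"
    by (simp add: colm_mult_vec inner_sum_right)
  also have "\<dots> = (\<Sum>j\<in>UNIV. if j = i then x $ i else 0)"
    using b i by (intro sum.cong) (auto simp: ext_def span_y_iff dual)
  finally show ?thesis by simp
qed

lemma colm_ext_split:
  "colm (ext b) *v x = (\<Sum>j\<in>K. x $ j *\<^sub>R b j) + (\<Sum>j\<in>-K. x $ j *\<^sub>R y j)"
proof -
  have "(\<Sum>j\<in>UNIV. x $ j *\<^sub>R ext b j) = (\<Sum>j\<in>K. x $ j *\<^sub>R ext b j) + (\<Sum>j\<in>-K. x $ j *\<^sub>R ext b j)"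
    using sum.union_disjoint[of K "-K" "\<lambda>j. x $ j *\<^sub>R ext b j"] by (simp add: Compl_partition)
  then show ?thesis by (simp add: colm_mult_vec ext_def)
qed

lemma P_Ints:
  assumes "\<And>j. j \<in> K \<Longrightarrow> b j \<in> Lat"
  shows "(V ** colm (ext b)) $ i $ j \<in> \<int>"
  using assms[of j] by (auto simp: matrix_mult_colm ext_def dual Lat_def intro: inner_Ints V_int)

text \<open>\<open>K\<close>-indexed version of \<^const>\<open>lattice_basis\<close>.\<close>

definition Lat_basis :: "('n \<Rightarrow> real^'n) \<Rightarrow> bool" where
  "Lat_basis b \<longleftrightarrow> (\<forall>c. (\<Sum>j\<in>K. c j *\<^sub>R b j) = 0 \<longrightarrow> (\<forall>j\<in>K. c j = 0)) \<and>
     Lat = {(\<Sum>j\<in>K. of_int (c j) *\<^sub>R b j) | c. True}"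

lemma Lat_basis_eq: "Lat_basis b \<Longrightarrow> Lat = {(\<Sum>j\<in>K. of_int (c j) *\<^sub>R b j) | c. True}"
  by (simp add: Lat_basis_def)

lemma Lat_basis_mem:
  assumes "Lat_basis b" "j \<in> K"
  shows "b j \<in> Lat"
proof -
  define c :: "'n \<Rightarrow> int" where "c k = (if k = j then 1 else 0)" for k
  have "b j = (\<Sum>k\<in>K. if k = j then b k else 0)" using assms(2) by simp
  also have "\<dots> = (\<Sum>k\<in>K. of_int (c k) *\<^sub>R b k)"
    by (intro sum.cong) (auto simp: c_def)
  finally show ?thesis
    unfolding Lat_basis_eq[OF assms(1)] by blast
qed

lemma det_ext_nz_iff:
  assumes b: "\<And>j. j \<in> K \<Longrightarrow> b j \<in> Lat"
  shows "det (colm (ext b)) \<noteq> 0 \<longleftrightarrow> (\<forall>c. (\<Sum>j\<in>K. c j *\<^sub>R b j) = 0 \<longrightarrow> (\<forall>j\<in>K. c j = 0))"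
proof -
  have b': "b j \<in> span (y ` K)" if "j \<in> K" for j using b[OF that] by (simp add: Lat_def)
  have lin: "linear ((*v) (colm (ext b)))" by simp
  have "det (colm (ext b)) \<noteq> 0 \<longleftrightarrow> inj ((*v) (colm (ext b)))"
    using det_nz_iff_inj[OF lin] by simp
  also have "\<dots> \<longleftrightarrow> (\<forall>x. colm (ext b) *v x = 0 \<longrightarrow> x = 0)"
    using linear_injective_0[OF lin] by blast
  also have "\<dots> \<longleftrightarrow> (\<forall>c. (\<Sum>j\<in>K. c j *\<^sub>R b j) = 0 \<longrightarrow> (\<forall>j\<in>K. c j = 0))"
  proof (intro iffI allI impI)
    fix c assume *: "\<forall>x. colm (ext b) *v x = 0 \<longrightarrow> x = 0" and c: "(\<Sum>j\<in>K. c j *\<^sub>R b j) = 0"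
    have "colm (ext b) *v (\<chi> j. if j \<in> K then c j else 0) = 0"
      using c by (simp add: colm_ext_split)
    then have eq0: "(\<chi> j. if j \<in> K then c j else 0) = 0" using * by blast
    show "\<forall>j\<in>K. c j = 0"
    proof
      fix j assume "j \<in> K"
      then show "c j = 0" using arg_cong[OF eq0, of "\<lambda>v. v $ j"] by simp
    qed
  next
    fix x assume *: "\<forall>c. (\<Sum>j\<in>K. c j *\<^sub>R b j) = 0 \<longrightarrow> (\<forall>j\<in>K. c j = 0)" and x: "colm (ext b) *v x = 0"
    have out: "x $ i = 0" if "i \<notin> K" for i using outside_ext[of b i x, OF b' that] x by simp
    then have "(\<Sum>j\<in>-K. x $ j *\<^sub>R y j) = 0" by (intro sum.neutral) auto
    then have "(\<Sum>j\<in>K. x $ j *\<^sub>R b j) = 0" using x unfolding colm_ext_split by simp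
    then have "\<forall>j\<in>K. x $ j = 0" using *[rule_format, of "\<lambda>j. x $ j"] by blast
    then show "x = 0" using out by (auto simp: vec_eq_iff)
  qed
  finally show ?thesis .
qed

text \<open>A family with minimal nonzero determinant generates the lattice: a fractional coordinate
  \<open>c $ k\<close> of a lattice point would allow an exchange that multiplies the determinant by its fractional part.\<close>

lemma ex_Lat_basis: "\<exists>b. Lat_basis b"
proof -
  \<comment> \<open>Measured against \<open>V\<close>, the determinant of a family in
    \<open>Lat\<close> is an integer; this is why a minimal one exists.\<close>
  define D where "D b = nat \<lfloor>\<bar>det (V ** colm (ext b))\<bar>\<rfloor>" for b
  define good where "good b \<longleftrightarrow> (\<forall>j\<in>K. b j \<in> Lat) \<and> det (colm (ext b)) \<noteq> 0" for b
  have D: "real (D b) = \<bar>det (V ** colm (ext b))\<bar>" if "good b" for b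
  proof -
    have "\<bar>det (V ** colm (ext b))\<bar> \<in> \<int>"
      using that by (intro Ints_abs det_Ints P_Ints) (auto simp: good_def)
    then show ?thesis unfolding D_def by (auto elim!: Ints_cases)
  qed
  \<comment> \<open>A family to start from: by Cramer's rule, \<open>det V\<close> clears the
    denominators of the dual vectors.\<close>
  have "good (\<lambda>j. det V *\<^sub>R y j)"
  proof -
    have mem: "det V *\<^sub>R y j \<in> Lat" if "j \<in> K" for j
    proof -
      have "V *v y j = axis j 1"
        by (simp add: vec_eq_iff matrix_vector_mul_component dual axis_def)
      then have "V *v y j \<in> int_points" by (simp add: int_points_def axis_def)
      then show ?thesis
        using cramer_Ints[OF V_Ints, of "y j"] that by (auto simp: Lat_def intro: span_scale span_base)
    qed
    moreover have "\<forall>j\<in>K. c j = 0" if "(\<Sum>j\<in>K. c j *\<^sub>R det V *\<^sub>R y j) = 0" for c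
    proof
      fix i assume "i \<in> K"
      have "0 = V $ i \<bullet> (\<Sum>j\<in>K. c j *\<^sub>R det V *\<^sub>R y j)" using that by simp
      also have "\<dots> = (\<Sum>j\<in>K. if j = i then c i * det V else 0)"
        unfolding inner_sum_right by (intro sum.cong) (auto simp: dual)
      finally show "c i = 0" using \<open>i \<in> K\<close> det_V_nz by simp
    qed
    ultimately show ?thesis
      using det_ext_nz_iff[of "\<lambda>j. det V *\<^sub>R y j"] unfolding good_def by blast
  qed
  then obtain b where b: "good b" and min: "\<And>b'. good b' \<Longrightarrow> D b \<le> D b'"
    using arg_min_natI[of good _ D] arg_min_nat_le[of good _ D] by metis
  have bL: "b j \<in> Lat" if "j \<in> K" for j using b that by (simp add: good_def)
  have bS: "b j \<in> span (y ` K)" if "j \<in> K" for j using bL[OF that] by (simp add: Lat_def)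
  have ind: "\<forall>c. (\<Sum>j\<in>K. c j *\<^sub>R b j) = 0 \<longrightarrow> (\<forall>j\<in>K. c j = 0)"
    using b det_ext_nz_iff[OF bL] by (simp add: good_def)
  have "x \<in> {(\<Sum>j\<in>K. of_int (c j) *\<^sub>R b j) | c. True}" if x: "x \<in> Lat" for x
  proof -
    have "surj ((*v) (colm (ext b)))"
      using b det_nz_iff_inj[of "(*v) (colm (ext b))"] linear_injective_imp_surjective[of "(*v) (colm (ext b))"]
      by (simp add: good_def)
    then obtain c where c: "x = colm (ext b) *v c" by (metis surjD)
    have out: "c $ i = 0" if "i \<notin> K" for i
      using outside_ext[of b i c, OF bS that] x that c by (auto simp: Lat_def span_y_iff)
    have "(\<Sum>j\<in>-K. c $ j *\<^sub>R y j) = 0" using out by (intro sum.neutral) auto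
    then have x_eq: "x = (\<Sum>j\<in>K. c $ j *\<^sub>R b j)" using c unfolding colm_ext_split by simp
    have int: "c $ k \<in> \<int>" if k: "k \<in> K" for k
    proof (rule ccontr)
      assume nint: "c $ k \<notin> \<int>"
      define b' where "b' = b(k := x - of_int \<lfloor>c $ k\<rfloor> *\<^sub>R b k)"
      define e where "e = c - of_int \<lfloor>c $ k\<rfloor> *\<^sub>R axis k 1"
      have ek: "e $ k = frac (c $ k)" by (simp add: e_def frac_def)
      have "colm (ext b) *v e = x - of_int \<lfloor>c $ k\<rfloor> *\<^sub>R b k"
        using k by (simp add: e_def matrix_vector_mult_diff_distrib c matrix_vector_mult_scaleR colm_mult_axis ext_def)
      then have "colm (ext b') = (\<chi> i j. if j = k then (colm (ext b) *v e) $ i else colm (ext b) $ i $ j)"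
        using k by (auto simp: colm_def ext_def b'_def vec_eq_iff)
      then have det': "det (colm (ext b')) = frac (c $ k) * det (colm (ext b))"
        using cramer_lemma[of k "colm (ext b)" e] ek by simp
      have fr: "0 < frac (c $ k)" "frac (c $ k) < 1" using nint by (auto simp: frac_gt_0_iff frac_lt_1)
      have "b' j \<in> Lat" if "j \<in> K" for j
        using x bL[OF that] bL[OF k] unfolding b'_def Lat_def
        by (auto intro!: int_points_diff int_points_scaleR span_diff span_scale)
      then have good': "good b'" using det' fr b by (auto simp: good_def)
      have "real (D b') = frac (c $ k) * real (D b)"
        using D[OF b] D[OF good'] det' fr by (simp add: det_mul abs_mult)
      moreover have "0 < real (D b)"
        using D[OF b] b det_V_nz by (simp add: good_def det_mul)
      ultimately have "real (D b') < real (D b)" using fr by simp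
      then show False using min[OF good'] by simp
    qed
    have "x = (\<Sum>j\<in>K. of_int ((\<lambda>j. \<lfloor>c $ j\<rfloor>) j) *\<^sub>R b j)"
      unfolding x_eq using int by (intro sum.cong refl) (auto elim!: Ints_cases dest!: int)
    then show ?thesis by (intro CollectI exI[of _ "\<lambda>j. \<lfloor>c $ j\<rfloor>"]) simp
  qed
  moreover have "(\<Sum>j\<in>K. of_int (c j) *\<^sub>R b j) \<in> Lat" for c using Lat_sum bL by blast
  ultimately have "Lat = {(\<Sum>j\<in>K. of_int (c j) *\<^sub>R b j) | c. True}" by blast
  then show ?thesis using ind unfolding Lat_basis_def by blast
qed

text \<open>Transfers existence from families on \<open>K\<close> to the basis that
  \<open>volZ\<close> selects by \<open>SOME\<close>, and its properties back.\<close>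

lemma lattice_basis_iff:
  assumes e: "bij_betw e {..<k} K"
  shows "lattice_basis Lat k b \<longleftrightarrow> Lat_basis (\<lambda>j. b (the_inv_into {..<k} e j))" (is "_ \<longleftrightarrow> Lat_basis ?b")
proof -
  have inj: "inj_on e {..<k}" and img: "e ` {..<k} = K" using e by (auto simp: bij_betw_def)
  have be: "?b (e i) = b i" if "i < k" for i using inj that by (simp add: the_inv_into_f_f)
  have reindex: "(\<Sum>j\<in>K. f j *\<^sub>R ?b j) = (\<Sum>i<k. f (e i) *\<^sub>R b i)" for f
    unfolding sum.reindex_bij_betw[OF e, symmetric] by (intro sum.cong) (auto simp: be)
  have ind: "inj_on b {..<k} \<and> independent (b ` {..<k}) \<longleftrightarrow>
      (\<forall>c. (\<Sum>i<k. c i *\<^sub>R b i) = 0 \<longrightarrow> (\<forall>i<k. c i = 0))"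
  proof (intro iffI conjI allI impI; (elim conjE)?)
    fix c i assume *: "inj_on b {..<k}" "independent (b ` {..<k})" "(\<Sum>i<k. c i *\<^sub>R b i) = 0" "i < k"
    have "(\<Sum>v\<in>b ` {..<k}. c (the_inv_into {..<k} b v) *\<^sub>R v) = (\<Sum>i<k. c i *\<^sub>R b i)"
      using *(1) by (subst sum.reindex) (auto simp: the_inv_into_f_f intro!: sum.cong)
    then have "\<forall>v\<in>b ` {..<k}. c (the_inv_into {..<k} b v) = 0"
      using *(2,3) unfolding independent_explicit_finite_subsets by fastforce
    then show "c i = 0" using *(1,4) by (auto simp: the_inv_into_f_f)
  next
    assume *: "\<forall>c. (\<Sum>i<k. c i *\<^sub>R b i) = 0 \<longrightarrow> (\<forall>i<k. c i = 0)"
    have inj_b: "inj_on b {..<k}"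
    proof (rule inj_onI, rule ccontr)
      fix i j assume ij: "i \<in> {..<k}" "j \<in> {..<k}" "b i = b j" "i \<noteq> j"
      have "(\<Sum>m<k. (if m = i then 1 else if m = j then -1 else 0) *\<^sub>R b m) =
          (\<Sum>m<k. (if m = i then b i else 0) + (if m = j then - b j else 0))"
        using ij by (intro sum.cong) auto
      also have "\<dots> = 0" using ij by (simp add: sum.distrib)
      finally show False using *[rule_format, of "\<lambda>m. if m = i then 1 else if m = j then -1 else 0" i] ij by simp
    qed
    then show "inj_on b {..<k}" .
    show "independent (b ` {..<k})"
    proof (rule independent_if_scalars_zero)
      fix f v assume f: "(\<Sum>x\<in>b ` {..<k}. f x *\<^sub>R x) = 0" and "v \<in> b ` {..<k}"
      then obtain i where i: "i < k" "v = b i" by auto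
      have "(\<Sum>i<k. f (b i) *\<^sub>R b i) = 0" using f inj_b by (simp add: sum.reindex)
      then show "f v = 0" using *[rule_format, of "\<lambda>i. f (b i)" i] i by simp
    qed simp
  qed
  have 1: "(\<forall>c. (\<Sum>j\<in>K. c j *\<^sub>R ?b j) = 0 \<longrightarrow> (\<forall>j\<in>K. c j = 0)) \<longleftrightarrow>
      (\<forall>c. (\<Sum>i<k. c i *\<^sub>R b i) = 0 \<longrightarrow> (\<forall>i<k. c i = 0))" (is "?l \<longleftrightarrow> ?r")
  proof
    assume l: ?l
    show ?r
    proof (intro allI impI)
      fix c i assume c: "(\<Sum>i<k. c i *\<^sub>R b i) = 0" and "i < k"
      have "(\<Sum>j\<in>K. c (the_inv_into {..<k} e j) *\<^sub>R ?b j) = (\<Sum>i<k. c i *\<^sub>R b i)"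
        unfolding reindex using inj by (intro sum.cong) (auto simp: the_inv_into_f_f)
      then have "\<forall>j\<in>K. c (the_inv_into {..<k} e j) = 0"
        using l[rule_format, of "\<lambda>j. c (the_inv_into {..<k} e j)"] c by simp
      then show "c i = 0" using \<open>i < k\<close> inj img by (metis imageI lessThan_iff the_inv_into_f_f)
    qed
  next
    assume r: ?r
    show ?l
    proof (intro allI impI)
      fix c assume "(\<Sum>j\<in>K. c j *\<^sub>R ?b j) = 0"
      then have "\<forall>i<k. c (e i) = 0" using r[rule_format, of "\<lambda>i. c (e i)"] unfolding reindex by blast
      then show "\<forall>j\<in>K. c j = 0" using img by auto
    qed
  qed
  have 2: "{(\<Sum>j\<in>K. of_int (c j) *\<^sub>R ?b j) | c :: 'n \<Rightarrow> int. True} = {(\<Sum>i<k. of_int (c i) *\<^sub>R b i) | c :: nat \<Rightarrow> int. True}"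
  proof (intro subset_antisym subsetI)
    fix x assume "x \<in> {(\<Sum>j\<in>K. of_int (c j) *\<^sub>R ?b j) | c :: 'n \<Rightarrow> int. True}"
    then obtain c :: "'n \<Rightarrow> int" where "x = (\<Sum>i<k. of_int (c (e i)) *\<^sub>R b i)"
      unfolding reindex by blast
    then show "x \<in> {(\<Sum>i<k. of_int (c i) *\<^sub>R b i) | c :: nat \<Rightarrow> int. True}"
      by (intro CollectI exI[of _ "\<lambda>i. c (e i)"]) simp
  next
    fix x assume "x \<in> {(\<Sum>i<k. of_int (c i) *\<^sub>R b i) | c :: nat \<Rightarrow> int. True}"
    then obtain c :: "nat \<Rightarrow> int" where "x = (\<Sum>i<k. of_int (c i) *\<^sub>R b i)" by blast
    also have "\<dots> = (\<Sum>j\<in>K. of_int (c (the_inv_into {..<k} e j)) *\<^sub>R ?b j)"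
      unfolding reindex using inj by (intro sum.cong) (auto simp: the_inv_into_f_f)
    finally show "x \<in> {(\<Sum>j\<in>K. of_int (c j) *\<^sub>R ?b j) | c :: 'n \<Rightarrow> int. True}"
      by (intro CollectI exI[of _ "\<lambda>j. c (the_inv_into {..<k} e j)"]) simp
  qed
  show ?thesis
    unfolding lattice_basis_def Lat_basis_def 1 2 conj_assoc[symmetric] ind ..
qed

text \<open>Pairing with the rows in \<open>K\<close> embeds \<open>Lat\<close> into the integral
  vectors on \<open>K\<close> with index \<open>\<bar>det (V ** colm (ext b))\<bar>\<close>. The
  vector \<open>y j\<close> is the real preimage of the \<open>j\<close>-th unit vector, so the
  index is 1 exactly if all these preimages lie in the lattice.\<close>

lemma Lat_basis_det_1_iff:
  assumes b: "Lat_basis b"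
  shows "\<bar>det (V ** colm (ext b))\<bar> = 1 \<longleftrightarrow> (\<forall>j\<in>K. y j \<in> int_points)"
proof -
  define P where "P = V ** colm (ext b)"
  have bL: "b j \<in> Lat" if "j \<in> K" for j using Lat_basis_mem b that by blast
  have bS: "b j \<in> span (y ` K)" if "j \<in> K" for j using bL[OF that] by (simp add: Lat_def)
  have P_int: "P $ i $ j \<in> \<int>" for i j unfolding P_def by (rule P_Ints[OF bL])
  show ?thesis unfolding P_def[symmetric]
  proof
    assume det: "\<bar>det P\<bar> = 1"
    show "\<forall>j\<in>K. y j \<in> int_points"
    proof
      fix j assume j: "j \<in> K"
      have "invertible P" using det by (auto simp: invertible_det_nz)
      then obtain R where R: "P ** R = mat 1" unfolding invertible_def by blast
      define m where "m = R *v axis j 1"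
      have Pm: "P *v m = axis j 1" using R by (simp add: m_def matrix_vector_mul_assoc)
      then have "P *v m \<in> int_points" by (simp add: int_points_def axis_def)
      then have m: "m \<in> int_points" using P_int det unimodular_solution_Ints by blast
      have yj: "y j = colm (ext b) *v m"
      proof (rule V_inj)
        fix i
        have "V $ i \<bullet> (colm (ext b) *v m) = (P *v m) $ i"
          unfolding P_def by (simp add: matrix_vector_mul_assoc[symmetric] matrix_vector_mul_component)
        then show "V $ i \<bullet> y j = V $ i \<bullet> (colm (ext b) *v m)"
          unfolding Pm by (simp add: dual axis_def)
      qed
      have m0: "m $ i = 0" if "i \<notin> K" for i
        using outside_ext[of b i m, OF bS that] j that dual[of i j] by (auto simp flip: yj split: if_splits)
      have "(\<Sum>j\<in>-K. m $ j *\<^sub>R y j) = 0" using m0 by (intro sum.neutral) auto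
      then have "y j = (\<Sum>j\<in>K. m $ j *\<^sub>R b j)" using yj unfolding colm_ext_split by simp
      also have "\<dots> \<in> int_points"
        using m bL by (intro int_points_sum int_points_scaleR) (auto simp: Lat_def int_points_def)
      finally show "y j \<in> int_points" .
    qed
  next
    assume yint: "\<forall>j\<in>K. y j \<in> int_points"
    have "\<forall>j\<in>K. \<exists>c::'n \<Rightarrow> int. y j = (\<Sum>k\<in>K. of_int (c k) *\<^sub>R b k)"
    proof
      fix j assume "j \<in> K"
      then have "y j \<in> Lat" using yint by (auto simp: Lat_def intro: span_base)
      then show "\<exists>c::'n \<Rightarrow> int. y j = (\<Sum>k\<in>K. of_int (c k) *\<^sub>R b k)"
        unfolding Lat_basis_eq[OF b] by blast
    qed
    then obtain c :: "'n \<Rightarrow> 'n \<Rightarrow> int" where c: "\<And>j. j \<in> K \<Longrightarrow> y j = (\<Sum>k\<in>K. of_int (c j k) *\<^sub>R b k)"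
      by metis
    \<comment> \<open>The coordinates of all \<open>y j\<close> with respect to
      \<open>ext b\<close>, which makes \<open>M\<close> an integral inverse of
      \<open>P\<close>.\<close>
    define M :: "real^'n^'n" where
      "M = colm (\<lambda>j. if j \<in> K then (\<chi> k. if k \<in> K then of_int (c j k) else 0) else axis j 1)"
    have col: "colm (ext b) *v (M *v axis j 1) = y j" for j
    proof (cases "j \<in> K")
      case True
      then show ?thesis by (simp add: M_def colm_mult_axis colm_ext_split c)
    next
      case False
      then show ?thesis by (simp add: M_def colm_mult_axis ext_def)
    qed
    have "(P ** M) *v axis j 1 = axis j 1" for j
    proof -
      have "(P ** M) *v axis j 1 = V *v (colm (ext b) *v (M *v axis j 1))"
        by (simp add: P_def matrix_vector_mul_assoc matrix_mul_assoc)
      then show ?thesis unfolding col by (simp add: vec_eq_iff matrix_vector_mul_component dual axis_def)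
    qed
    then have "colm (\<lambda>j. (P ** M) *v axis j 1) = colm (\<lambda>j. mat 1 *v axis j 1)" by simp
    then have "P ** M = mat 1" by (simp only: colm_columns)
    then have prod: "det P * det M = 1" by (metis det_I det_mul)
    have "M $ i $ j \<in> \<int>" for i j by (simp add: M_def colm_def axis_def)
    then have "1 \<le> \<bar>det P\<bar>" "1 \<le> \<bar>det M\<bar>"
      using prod P_int by (auto intro!: det_nonzero_Ints_ge_1)
    moreover have "\<bar>det P\<bar> * \<bar>det M\<bar> = 1" using prod by (simp flip: abs_mult)
    ultimately show "\<bar>det P\<bar> = 1"
      using mult_left_mono[of 1 "\<bar>det M\<bar>" "\<bar>det P\<bar>"] by simp
  qed
qed

end

section \<open>Lattice volume of a simplex\<close>

lemma emeasure_lborel_cart_prod: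
  fixes A :: "'n::finite \<Rightarrow> real set"
  assumes A: "\<And>j. A j \<in> sets borel"
  shows "emeasure lborel {x::real^'n. \<forall>j. x $ j \<in> A j} = (\<Prod>j\<in>UNIV. emeasure lborel (A j))"
proof -
  interpret product_sigma_finite "\<lambda>_::real^'n. lborel :: real measure" by standard
  define ax where "ax j = (axis j 1 :: real^'n)" for j :: 'n
  have bij: "bij_betw ax UNIV Basis"
    by (auto simp: bij_betw_def inj_on_def axis_eq_axis ax_def Basis_vec_def)
  define ix where "ix = the_inv_into UNIV ax"
  have ix: "ix (ax j) = j" for j
    unfolding ix_def using bij by (intro the_inv_into_f_f) (auto simp: bij_betw_def)
  define S where "S = {x::real^'n. \<forall>j. x $ j \<in> A j}"
  have [measurable]: "S \<in> sets borel"
    unfolding S_def using A by measurable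
  define g where "g = (\<lambda>f. \<Sum>b\<in>Basis. f b *\<^sub>R b :: real^'n)"
  have g_comp: "g f $ j = f (ax j)" for f j
  proof -
    have "g f $ j = g f \<bullet> ax j" by (simp add: ax_def inner_axis)
    also have "\<dots> = f (ax j)" unfolding g_def by (rule inner_sum_left_Basis) (simp add: ax_def)
    finally show ?thesis .
  qed
  have "emeasure lborel S = emeasure (distr (PiM Basis (\<lambda>_. lborel)) borel g) S"
    unfolding g_def by (subst lborel_eq) simp
  also have "\<dots> = emeasure (PiM Basis (\<lambda>_. lborel)) (g -` S \<inter> space (PiM Basis (\<lambda>_. lborel)))"
    by (rule emeasure_distr) (auto simp: g_def)
  also have "g -` S \<inter> space (PiM Basis (\<lambda>_. lborel)) = (\<Pi>\<^sub>E b\<in>Basis. A (ix b))"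
  proof -
    have "(\<forall>j. f (ax j) \<in> A j) \<longleftrightarrow> (\<forall>b\<in>Basis. f b \<in> A (ix b))" for f
      using bij ix by (metis bij_betw_imp_surj_on rangeI image_iff)
    then show ?thesis by (auto simp: S_def g_comp space_PiM PiE_def Pi_def)
  qed
  also have "emeasure (PiM Basis (\<lambda>_. lborel)) (\<Pi>\<^sub>E b\<in>Basis. A (ix b)) = (\<Prod>b\<in>Basis. emeasure lborel (A (ix b)))"
    using A by (intro emeasure_PiM) auto
  also have "\<dots> = (\<Prod>j\<in>UNIV. emeasure lborel (A j))"
    unfolding prod.reindex_bij_betw[OF bij, symmetric] by (simp add: ix)
  finally show ?thesis by (simp add: S_def)
qed

text \<open>Multiplying by a unit cube in the unused coordinates moves a measure problem in
  dimension \<open>k \<le> CARD('n)\<close> to the type \<open>real^'n\<close>, where determinants are available.\<close>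

lemma emeasure_PiM_eq_cylinder:
  fixes K :: "'n::finite set" and k :: nat
  assumes e: "bij_betw e {..<k} K" and A: "A \<in> sets (PiM {..<k} (\<lambda>_. lborel :: real measure))"
  shows "emeasure (PiM {..<k} (\<lambda>_. lborel)) A =
    emeasure lborel {x::real^'n. (\<lambda>i\<in>{..<k}. x $ e i) \<in> A \<and> (\<forall>j. j \<notin> K \<longrightarrow> 0 \<le> x $ j \<and> x $ j \<le> 1)}"
proof -
  interpret product_sigma_finite "\<lambda>_::nat. lborel :: real measure" by standard
  define M where "M = PiM {..<k} (\<lambda>_. lborel :: real measure)"
  define g where "g = (\<lambda>x::real^'n. \<lambda>i\<in>{..<k}. x $ e i)"
  define cyl where "cyl = {x::real^'n. \<forall>j. j \<notin> K \<longrightarrow> 0 \<le> x $ j \<and> x $ j \<le> 1}"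
  have [measurable]: "cyl \<in> sets borel" unfolding cyl_def by measurable
  have [measurable]: "g \<in> borel \<rightarrow>\<^sub>M M" unfolding g_def M_def by measurable
  \<comment> \<open>Push-forward of Lebesgue measure on the cylinder. It is the product measure
    because on rectangles the unit sides outside \<open>K\<close> contribute the factor 1.\<close>
  define P where "P = distr (density lborel (indicator cyl)) M g"
  have P: "emeasure P B = emeasure lborel {x. g x \<in> B \<and> x \<in> cyl}" if [measurable]: "B \<in> sets M" for B
  proof -
    have "emeasure P B = emeasure (density lborel (indicator cyl)) (g -` B)"
      unfolding P_def by (subst emeasure_distr) auto
    also have "\<dots> = (\<integral>\<^sup>+x. indicator cyl x * indicator (g -` B) x \<partial>lborel)"
    proof (rule emeasure_density)
      have "g -` B \<inter> space borel \<in> sets borel" by measurable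
      then show "g -` B \<in> sets lborel" by simp
    qed auto
    also have "\<dots> = (\<integral>\<^sup>+x. indicator {x. g x \<in> B \<and> x \<in> cyl} x \<partial>lborel)"
      by (intro nn_integral_cong) (auto simp: indicator_def)
    also have "\<dots> = emeasure lborel {x. g x \<in> B \<and> x \<in> cyl}"
      by (rule nn_integral_indicator) simp
    finally show ?thesis .
  qed
  have "P = PiM {..<k} (\<lambda>_. lborel)"
  proof (rule PiM_eqI)
    fix B :: "nat \<Rightarrow> real set" assume B: "\<And>i. i \<in> {..<k} \<Longrightarrow> B i \<in> sets lborel"
    define ie where "ie = the_inv_into {..<k} e"
    have ie: "ie (e i) = i" if "i < k" for i
      unfolding ie_def using e that by (intro the_inv_into_f_f) (auto simp: bij_betw_def)
    have ie_mem: "ie j < k" "e (ie j) = j" if "j \<in> K" for j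
      using e that ie by (auto simp: bij_betw_def)
    define C where "C j = (if j \<in> K then B (ie j) else {0..1})" for j
    have C: "C j \<in> sets borel" for j using B ie_mem by (auto simp: C_def)
    have "PiE {..<k} B \<in> sets M" unfolding M_def using B by (intro sets_PiM_I_finite) auto
    then have "emeasure P (PiE {..<k} B) = emeasure lborel {x. g x \<in> PiE {..<k} B \<and> x \<in> cyl}"
      by (rule P)
    also have "{x. g x \<in> PiE {..<k} B \<and> x \<in> cyl} = {x. \<forall>j. x $ j \<in> C j}"
    proof (intro subset_antisym subsetI CollectI allI conjI)
      fix x j assume "x \<in> {x. g x \<in> PiE {..<k} B \<and> x \<in> cyl}"
      then show "x $ j \<in> C j"
        using ie_mem[of j] by (auto simp: C_def g_def cyl_def PiE_iff) (metis lessThan_iff)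
    next
      fix x assume x: "x \<in> {x. \<forall>j. x $ j \<in> C j}"
      then have xC: "x $ j \<in> C j" for j by blast
      moreover have "e i \<in> K" if "i < k" for i using e that by (auto simp: bij_betw_def)
      ultimately have "x $ e i \<in> B i" if "i < k" for i using that ie[OF that] by (metis C_def)
      then show "g x \<in> PiE {..<k} B" by (simp add: g_def PiE_iff)
      have "0 \<le> x $ j \<and> x $ j \<le> 1" if "j \<notin> K" for j using xC[of j] that by (simp add: C_def)
      then show "x \<in> cyl" by (simp add: cyl_def)
    qed
    also have "emeasure lborel \<dots> = (\<Prod>j\<in>UNIV. emeasure lborel (C j))"
      by (rule emeasure_lborel_cart_prod[OF C])
    also have "\<dots> = (\<Prod>j\<in>K. emeasure lborel (C j))"
      by (rule prod.mono_neutral_right) (auto simp: C_def)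
    also have "\<dots> = (\<Prod>i<k. emeasure lborel (C (e i)))"
      by (rule prod.reindex_bij_betw[OF e, symmetric])
    also have "\<dots> = (\<Prod>i<k. emeasure lborel (B i))"
      using e by (intro prod.cong) (auto simp: C_def ie bij_betw_def)
    finally show "emeasure P (PiE {..<k} B) = (\<Prod>i\<in>{..<k}. emeasure lborel (B i))" .
  qed (auto simp: P_def M_def)
  then show ?thesis using P[of A] A by (simp add: M_def g_def cyl_def)
qed

definition std_cyl :: "'n::finite set \<Rightarrow> (real^'n) set" where
  "std_cyl K = {x. (\<forall>j\<in>K. 0 \<le> x $ j) \<and> (\<Sum>j\<in>K. x $ j) \<le> 1 \<and> (\<forall>j. j \<notin> K \<longrightarrow> 0 \<le> x $ j \<and> x $ j \<le> 1)}"

lemma bounded_std_cyl: "bounded (std_cyl K)"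
proof (rule bounded_subset[OF bounded_cbox])
  show "std_cyl K \<subseteq> cbox 0 (\<chi> i. 1)"
  proof
    fix x assume x: "x \<in> std_cyl K"
    have "0 \<le> x $ i \<and> x $ i \<le> 1" for i
    proof (cases "i \<in> K")
      case True
      have "x $ i \<le> (\<Sum>j\<in>K. x $ j)" using True x by (intro member_le_sum) (auto simp: std_cyl_def)
      then show ?thesis using x True by (auto simp: std_cyl_def)
    qed (use x in \<open>auto simp: std_cyl_def\<close>)
    then show "x \<in> cbox 0 (\<chi> i. 1)" by (simp add: mem_box_cart)
  qed
qed

lemma closed_std_cyl: "closed (std_cyl K)"
proof -
  have "std_cyl K = (\<Inter>j\<in>K. {x. 0 \<le> x $ j}) \<inter> {x. (\<Sum>j\<in>K. x $ j) \<le> 1} \<inter>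
      (\<Inter>j\<in>-K. {x. 0 \<le> x $ j} \<inter> {x. x $ j \<le> 1})"
    by (auto simp: std_cyl_def)
  also have "closed \<dots>"
    by (intro closed_Int closed_INT ballI closed_Collect_le continuous_intros)
  finally show ?thesis .
qed

lemma measure_std_cyl: "measure lebesgue (std_cyl (K :: 'n::finite set)) = 1 / fact (card K)"
proof -
  define k where "k = card K"
  obtain e where e: "bij_betw e {..<k} K"
    using ex_bij_betw_nat_finite[of K] by (auto simp: k_def atLeast0LessThan)
  let ?M = "PiM {..<k} (\<lambda>_. lborel :: real measure)"
  define A where "A = {x :: nat \<Rightarrow> real. (\<forall>i\<in>{..<k}. 0 \<le> x i) \<and> sum x {..<k} \<le> 1} \<inter> space ?M"
  have A: "A \<in> sets ?M"
  proof -
    have "A = {x \<in> space ?M. (\<forall>i\<in>{..<k}. 0 \<le> x i) \<and> sum x {..<k} \<le> 1}" by (auto simp: A_def)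
    also have "\<dots> \<in> sets ?M" by measurable
    finally show ?thesis .
  qed
  have "ennreal (1 / fact k) = emeasure ?M A"
    unfolding A_def using emeasure_std_simplex_aux[of "{..<k}" 1] by simp
  also have "\<dots> = emeasure lborel {x::real^'n. (\<lambda>i\<in>{..<k}. x $ e i) \<in> A \<and> (\<forall>j. j \<notin> K \<longrightarrow> 0 \<le> x $ j \<and> x $ j \<le> 1)}"
    by (rule emeasure_PiM_eq_cylinder[OF e A])
  also have "{x::real^'n. (\<lambda>i\<in>{..<k}. x $ e i) \<in> A \<and> (\<forall>j. j \<notin> K \<longrightarrow> 0 \<le> x $ j \<and> x $ j \<le> 1)} = std_cyl K"
  proof -
    have "(\<Sum>i<k. x $ e i) = (\<Sum>j\<in>K. x $ j)" for x :: "real^'n" by (rule sum.reindex_bij_betw[OF e])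
    moreover have "K = e ` {..<k}" using e by (auto simp: bij_betw_def)
    ultimately show ?thesis by (auto simp: A_def std_cyl_def space_PiM)
  qed
  finally have "emeasure lborel (std_cyl K) = ennreal (1 / fact k)" by simp
  then show ?thesis
    using closed_std_cyl[of K] by (simp add: measure_def k_def borel_closed)
qed

section \<open>The lattice volume as a quotient of determinants\<close>

context dual_basis
begin

lemma det_V_ext_scaled: "det (V ** colm (ext (\<lambda>j. g j *\<^sub>R y j))) = prod g K"
proof -
  have "det (V ** colm (ext (\<lambda>j. g j *\<^sub>R y j))) = (\<Prod>i\<in>UNIV. if i \<in> K then g i else 1)"
    by (subst det_diagonal) (auto simp: matrix_mult_colm ext_def dual intro!: prod.cong)
  also have "\<dots> = prod g K" by (subst prod.If_cases) auto
  finally show ?thesis .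
qed

text \<open>\<open>G\<close> takes the unit vectors of \<open>K\<close> to the edges at
  \<open>w0\<close>, \<open>Q\<close> takes them to a lattice basis, and both agree outside
  \<open>K\<close>. Lattice coordinates of the simplex thus come from the standard simplex by
  \<open>R = Qi ** G\<close>, and \<open>\<bar>det R\<bar>\<close> is the quotient of
  \<open>\<bar>det (V ** G)\<bar>\<close>, a diagonal determinant, by the integer
  \<open>D = \<bar>det (V ** Q)\<bar>\<close>.\<close>

theorem volZ_simplex:
  assumes g: "\<And>j. j \<in> K \<Longrightarrow> g j \<noteq> 0"
    and F: "F = convex hull (insert w0 ((\<lambda>j. w0 + g j *\<^sub>R y j) ` K))"
    and dim: "aff_dim F = int (card K)"
  obtains D :: real where "1 \<le> D" "volZ F = (\<Prod>j\<in>K. \<bar>g j\<bar>) / (fact (card K) * D)"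
    "D = 1 \<longleftrightarrow> (\<forall>j\<in>K. y j \<in> int_points)"
proof -
  define G where "G = colm (ext (\<lambda>j. g j *\<^sub>R y j))"
  define \<Delta> where "\<Delta> = {x::real^'n. (\<forall>i. 0 \<le> x $ i) \<and> (\<Sum>i\<in>K. x $ i) \<le> 1 \<and> (\<forall>i. i \<notin> K \<longrightarrow> x $ i = 0)}"
  have span_scaled: "g j *\<^sub>R y j \<in> span (y ` K)" if "j \<in> K" for j
    using that by (intro span_scale span_base) auto
  have outside_G: "V $ i \<bullet> (G *v x) = x $ i" if "i \<notin> K" for i x
    unfolding G_def by (rule outside_ext[OF span_scaled that])
  have \<Delta>: "\<Delta> = convex hull (insert 0 ((\<lambda>i. axis i 1) ` K))"
  proof -
    have "convex hull (insert 0 ((\<lambda>i. axis i 1) ` K)) =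
        {x::real^'n. (\<forall>i\<in>Basis. 0 \<le> x \<bullet> i) \<and> (\<Sum>i\<in>(\<lambda>i. axis i 1) ` K. x \<bullet> i) \<le> 1 \<and>
          (\<forall>i\<in>Basis. i \<notin> (\<lambda>i. axis i 1) ` K \<longrightarrow> x \<bullet> i = 0)}"
      by (rule substd_simplex) (auto simp: Basis_vec_def)
    also have "\<dots> = \<Delta>"
    proof -
      have "(\<Sum>i\<in>(\<lambda>i. axis i 1) ` K. x \<bullet> i) = (\<Sum>i\<in>K. x $ i)" for x :: "real^'n"
        by (subst sum.reindex) (auto simp: inj_on_def axis_eq_axis inner_axis)
      moreover have "axis i (1::real) \<in> (\<lambda>i. axis i 1) ` K \<longleftrightarrow> i \<in> K" for i :: 'n
        by (auto simp: axis_eq_axis)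
      ultimately show ?thesis
        by (auto simp: \<Delta>_def Basis_vec_def inner_axis simp del: image_iff)
    qed
    finally show ?thesis by simp
  qed
  have F_eq: "F = (\<lambda>x. w0 + G *v x) ` \<Delta>"
  proof -
    have "(\<lambda>x. w0 + G *v x) ` \<Delta> = (+) w0 ` (*v) G ` (convex hull (insert 0 ((\<lambda>i. axis i 1) ` K)))"
      by (simp add: \<Delta> image_image)
    also have "\<dots> = (+) w0 ` (convex hull ((*v) G ` (insert 0 ((\<lambda>i. axis i 1) ` K))))"
      by (simp add: convex_hull_linear_image)
    also have "\<dots> = convex hull ((+) w0 ` (*v) G ` (insert 0 ((\<lambda>i. axis i 1) ` K)))"
      by (simp only: convex_hull_translation)
    also have "(+) w0 ` (*v) G ` (insert 0 ((\<lambda>i. axis i 1) ` K)) = insert w0 ((\<lambda>j. w0 + g j *\<^sub>R y j) ` K)"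
      by (auto simp: G_def colm_mult_axis ext_def image_iff)
    finally show ?thesis by (simp add: F)
  qed
  have F_ne: "F \<noteq> {}" by (simp add: F)
  have span_F: "span {x - z | x z. x \<in> F \<and> z \<in> F} = span (y ` K)"
    unfolding span_eq
  proof (intro conjI subsetI)
    fix v assume "v \<in> {x - z | x z. x \<in> F \<and> z \<in> F}"
    then obtain p q where "p \<in> \<Delta>" "q \<in> \<Delta>" and v: "v = (w0 + G *v p) - (w0 + G *v q)"
      unfolding F_eq by blast
    then have "\<forall>i. i \<notin> K \<longrightarrow> (p - q) $ i = 0" by (simp add: \<Delta>_def)
    moreover have "v = G *v (p - q)" using v by (simp add: matrix_vector_mult_diff_distrib)
    ultimately show "v \<in> span (y ` K)" unfolding span_y_iff using outside_G by simp
  next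
    fix v assume "v \<in> y ` K"
    then obtain j where j: "j \<in> K" "v = y j" by blast
    have "w0 \<in> F" "w0 + g j *\<^sub>R y j \<in> F" using j unfolding F by (auto intro!: hull_inc)
    then have "(w0 + g j *\<^sub>R y j) - w0 \<in> {x - z | x z. x \<in> F \<and> z \<in> F}" by blast
    then have "(1 / g j) *\<^sub>R ((w0 + g j *\<^sub>R y j) - w0) \<in> span {x - z | x z. x \<in> F \<and> z \<in> F}"
      by (intro span_scale span_base)
    then show "v \<in> span {x - z | x z. x \<in> F \<and> z \<in> F}" using g j by simp
  qed
  define k where "k = card K"
  obtain e where e: "bij_betw e {..<k} K"
    using ex_bij_betw_nat_finite[of K] by (auto simp: k_def atLeast0LessThan)
  define b where "b = (SOME b. lattice_basis Lat k b)"
  define bb where "bb j = b (the_inv_into {..<k} e j)" for j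
  define x0 where "x0 = (SOME x. x \<in> F)"
  let ?M = "PiM {..<k} (\<lambda>_. lborel :: real measure)"
  define A where "A = {t \<in> space ?M. x0 + (\<Sum>i<k. t i *\<^sub>R b i) \<in> F}"
  have vol: "volZ F = measure ?M A"
    unfolding volZ_def span_F dim Let_def nat_int k_def[symmetric] Lat_def[symmetric] b_def[symmetric]
      x0_def[symmetric] A_def ..
  have "x0 \<in> F" unfolding x0_def using F_ne by (simp add: some_in_eq)
  \<comment> \<open>\<open>volZ\<close> measures coordinates from some point \<open>x0\<close> of
    \<open>F\<close>, not necessarily a vertex; \<open>a\<close> records its position and later
    enters as a translation.\<close>
  then obtain a where a: "a \<in> \<Delta>" "x0 = w0 + G *v a" unfolding F_eq by blast
  have a0: "a $ i = 0" if "i \<notin> K" for i using a(1) that by (simp add: \<Delta>_def)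
  have bb: "Lat_basis bb"
  proof -
    obtain b0 where b0: "Lat_basis b0" using ex_Lat_basis by blast
    have "e (the_inv_into {..<k} e j) = j" if "j \<in> K" for j
      using e that by (intro f_the_inv_into_f) (auto simp: bij_betw_def)
    then have "Lat_basis (\<lambda>j. b0 (e (the_inv_into {..<k} e j)))"
      using b0 unfolding Lat_basis_def by (simp cong: sum.cong)
    then have "lattice_basis Lat k (\<lambda>i. b0 (e i))" using lattice_basis_iff[OF e, of "\<lambda>i. b0 (e i)"] by simp
    then have "lattice_basis Lat k b" unfolding b_def by (rule someI[where P = "lattice_basis Lat k"])
    then show ?thesis using lattice_basis_iff[OF e] unfolding bb_def by blast
  qed
  have bbL: "bb j \<in> Lat" if "j \<in> K" for j using Lat_basis_mem[OF bb that] .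
  have bbS: "bb j \<in> span (y ` K)" if "j \<in> K" for j using bbL[OF that] by (simp add: Lat_def)
  define Q where "Q = colm (ext bb)"
  have detQ: "det Q \<noteq> 0"
    using bb det_ext_nz_iff[of bb, OF bbL] unfolding Q_def Lat_basis_def by blast
  have detG: "det (V ** G) = prod g K" unfolding G_def by (rule det_V_ext_scaled)
  have prod_nz: "prod g K \<noteq> 0" using g by simp
  then have detG_nz: "det G \<noteq> 0" using detG by (auto simp: det_mul)
  obtain Qi where Qi: "Q ** Qi = mat 1" "Qi ** Q = mat 1"
    using detQ unfolding invertible_det_nz[symmetric] invertible_def by blast
  obtain Gi where Gi: "G ** Gi = mat 1" "Gi ** G = mat 1"
    using detG_nz unfolding invertible_det_nz[symmetric] invertible_def by blast
  have QQi: "Q *v (Qi *v x) = x" "Qi *v (Q *v x) = x" "G *v (Gi *v x) = x" "Gi *v (G *v x) = x" for x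
    using Qi Gi by (simp_all add: matrix_vector_mul_assoc)
  define R where "R = Qi ** G"
  define T where "T = std_cyl K"
  define X where "X = {x. x0 + (\<Sum>j\<in>K. x $ j *\<^sub>R bb j) \<in> F \<and> (\<forall>j. j \<notin> K \<longrightarrow> 0 \<le> x $ j \<and> x $ j \<le> 1)}"
  have X_iff: "x \<in> X \<longleftrightarrow> Gi *v (Q *v x) + a \<in> T" for x
  proof -
    define l where "l = Gi *v (Q *v x) + a"
    have Gl: "G *v l = Q *v x + G *v a" by (simp add: l_def matrix_vector_right_distrib QQi)
    have out: "l $ i = x $ i" if "i \<notin> K" for i
    proof -
      have "l $ i = V $ i \<bullet> (G *v l)" using outside_G[OF that] by simp
      also have "\<dots> = V $ i \<bullet> (Q *v x) + V $ i \<bullet> (G *v a)" by (simp add: Gl inner_add_right)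
      also have "\<dots> = x $ i" unfolding Q_def by (simp add: outside_ext[of bb, OF bbS that] outside_G[OF that] a0[OF that])
      finally show ?thesis .
    qed
    define l' where "l' = (\<chi> i. if i \<in> K then l $ i else 0)"
    have "G *v l = G *v l' + (\<Sum>j\<in>-K. l $ j *\<^sub>R y j)"
      unfolding G_def colm_ext_split by (simp add: l'_def)
    moreover have "(\<Sum>j\<in>-K. l $ j *\<^sub>R y j) = (\<Sum>j\<in>-K. x $ j *\<^sub>R y j)"
      using out by (intro sum.cong) auto
    moreover have "Q *v x = (\<Sum>j\<in>K. x $ j *\<^sub>R bb j) + (\<Sum>j\<in>-K. x $ j *\<^sub>R y j)"
      unfolding Q_def by (rule colm_ext_split)
    ultimately have eq: "x0 + (\<Sum>j\<in>K. x $ j *\<^sub>R bb j) = w0 + G *v l'"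
      using Gl a(2) by (simp add: algebra_simps)
    have "w0 + G *v l' \<in> F \<longleftrightarrow> l' \<in> \<Delta>"
    proof
      assume "w0 + G *v l' \<in> F"
      then obtain m where "m \<in> \<Delta>" "G *v l' = G *v m" unfolding F_eq by auto
      then show "l' \<in> \<Delta>" using QQi(4) by metis
    qed (auto simp: F_eq)
    then have "x \<in> X \<longleftrightarrow> l' \<in> \<Delta> \<and> (\<forall>j. j \<notin> K \<longrightarrow> 0 \<le> l $ j \<and> l $ j \<le> 1)"
      using out by (simp add: X_def eq)
    also have "\<dots> \<longleftrightarrow> l \<in> T" by (auto simp: \<Delta>_def T_def std_cyl_def l'_def)
    finally show ?thesis by (simp add: l_def)
  qed
  have X_image: "X = (*v) R ` ((+) (- a) ` T)"
  proof (intro subset_antisym subsetI)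
    fix x assume "x \<in> X"
    then have "Gi *v (Q *v x) + a \<in> T" by (simp add: X_iff)
    moreover have "x = R *v (- a + (Gi *v (Q *v x) + a))"
      by (simp add: R_def QQi flip: matrix_vector_mul_assoc)
    ultimately show "x \<in> (*v) R ` ((+) (- a) ` T)" by blast
  next
    fix x assume "x \<in> (*v) R ` ((+) (- a) ` T)"
    then obtain t where t: "t \<in> T" "x = R *v (- a + t)" by blast
    then have "Gi *v (Q *v x) + a = t" by (simp add: R_def QQi flip: matrix_vector_mul_assoc)
    then show "x \<in> X" using t X_iff by simp
  qed
  have T_meas: "T \<in> lmeasurable"
    unfolding T_def by (intro lmeasurable_compact) (simp add: compact_eq_bounded_closed bounded_std_cyl closed_std_cyl)
  have "measure lebesgue X = \<bar>det R\<bar> * measure lebesgue T"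
  proof -
    have "(+) (- a) ` T \<in> lmeasurable" using T_meas by (rule measurable_translation)
    then have "measure lebesgue X = \<bar>det (matrix ((*v) R))\<bar> * measure lebesgue ((+) (- a) ` T)"
      unfolding X_image by (rule measure_linear_image_finite(2)[rotated]) simp
    then show ?thesis by (simp only: measure_translation matrix_of_matrix_vector_mul)
  qed
  also have "measure lebesgue T = 1 / fact k" by (simp add: T_def measure_std_cyl k_def)
  finally have mX: "measure lebesgue X = \<bar>det R\<bar> / fact k" by simp
  have F_closed: "closed F"
    unfolding F by (intro compact_imp_closed finite_imp_compact_convex_hull) auto
  have [measurable]: "F \<in> sets borel" using F_closed by (rule borel_closed)
  have A_sets: "A \<in> sets ?M" unfolding A_def by measurable
  have X_sets: "X \<in> sets borel" unfolding X_def by measurable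
  have "emeasure ?M A = emeasure lborel X"
  proof -
    have "(\<Sum>i<k. (\<lambda>i\<in>{..<k}. x $ e i) i *\<^sub>R b i) = (\<Sum>j\<in>K. x $ j *\<^sub>R bb j)" for x
    proof -
      have "(\<Sum>j\<in>K. x $ j *\<^sub>R bb j) = (\<Sum>i<k. x $ e i *\<^sub>R bb (e i))"
        by (rule sum.reindex_bij_betw[OF e, symmetric])
      also have "\<dots> = (\<Sum>i<k. (\<lambda>i\<in>{..<k}. x $ e i) i *\<^sub>R b i)"
        using e by (intro sum.cong) (auto simp: bb_def the_inv_into_f_f bij_betw_def)
      finally show ?thesis by simp
    qed
    then have "{x. (\<lambda>i\<in>{..<k}. x $ e i) \<in> A \<and> (\<forall>j. j \<notin> K \<longrightarrow> 0 \<le> x $ j \<and> x $ j \<le> 1)} = X"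
      by (auto simp: A_def X_def space_PiM)
    then show ?thesis using emeasure_PiM_eq_cylinder[OF e A_sets] by simp
  qed
  then have "volZ F = measure lebesgue X"
    unfolding vol using X_sets by (simp add: measure_def)
  then have volF: "volZ F = \<bar>det R\<bar> / fact k" using mX by simp
  define D where "D = \<bar>det (V ** Q)\<bar>"
  have VQ_nz: "det (V ** Q) \<noteq> 0" using detQ det_V_nz by (simp add: det_mul)
  have "1 \<le> D"
    unfolding D_def using VQ_nz P_Ints[of bb, OF bbL] by (intro det_nonzero_Ints_ge_1) (auto simp: Q_def)
  moreover have "\<bar>det R\<bar> = (\<Prod>j\<in>K. \<bar>g j\<bar>) / D"
  proof -
    have "(V ** Q) ** R = V ** G"
      unfolding R_def using Qi(1) by (metis matrix_mul_assoc matrix_mul_lid)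
    then have "det (V ** Q) * det R = prod g K" using detG by (metis det_mul)
    then have "D * \<bar>det R\<bar> = (\<Prod>j\<in>K. \<bar>g j\<bar>)" by (simp add: D_def abs_prod flip: abs_mult)
    then show ?thesis using \<open>1 \<le> D\<close> by (simp add: field_simps)
  qed
  moreover have "D = 1 \<longleftrightarrow> (\<forall>j\<in>K. y j \<in> int_points)"
    unfolding D_def Q_def by (rule Lat_basis_det_1_iff[OF bb])
  ultimately show ?thesis using volF by (intro that[of D]) (auto simp: k_def mult.commute)
qed

end

section \<open>Simplices with the origin in the interior and their polars\<close>

lemma polar_set_convex_hull: "polar_set (convex hull A) = {z. \<forall>x\<in>A. x \<bullet> z \<le> 1}"
proof (intro subset_antisym subsetI)
  fix z assume "z \<in> {z. \<forall>x\<in>A. x \<bullet> z \<le> 1}"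
  then have "A \<subseteq> {x. z \<bullet> x \<le> 1}" by (auto simp: inner_commute)
  then have "convex hull A \<subseteq> {x. z \<bullet> x \<le> 1}" by (intro hull_minimal convex_halfspace_le)
  then show "z \<in> polar_set (convex hull A)" by (auto simp: polar_set_def inner_commute)
qed (auto simp: polar_set_def hull_inc)

lemma convex_polar_set: "convex (polar_set A)"
proof -
  have "polar_set A = (\<Inter>x\<in>A. {z. x \<bullet> z \<le> 1})" by (auto simp: polar_set_def)
  then show ?thesis by (auto intro: convex_INT convex_halfspace_le)
qed

lemma sum_in_convex_hull:
  fixes p :: "'i \<Rightarrow> 'a::real_vector"
  assumes "finite I" "\<And>i. i \<in> I \<Longrightarrow> 0 \<le> c i" "sum c I = 1"
  shows "(\<Sum>i\<in>I. c i *\<^sub>R p i) \<in> convex hull (p ` I)"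
  using assms by (intro convex_sum convex_convex_hull) (auto intro: hull_inc)

locale bary_simplex =
  fixes d :: nat and v :: "nat \<Rightarrow> real^'n" and \<beta> :: "nat \<Rightarrow> real"
  assumes d_eq: "d = CARD('n)"
    and \<beta>_pos: "\<And>i. i \<le> d \<Longrightarrow> 0 < \<beta> i"
    and \<beta>_sum: "(\<Sum>i\<le>d. \<beta> i) = 1"
    and bary: "(\<Sum>i\<le>d. \<beta> i *\<^sub>R v i) = 0"
    and aff_indep: "\<And>c. (\<Sum>i\<le>d. c i *\<^sub>R v i) = 0 \<Longrightarrow> (\<Sum>i\<le>d. c i) = 0 \<Longrightarrow> \<forall>i\<le>d. c i = 0"
begin

text \<open>Subtracting the right multiple of \<open>\<beta>\<close> turns a linear relation into an
  affine one, which is trivial.\<close>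

lemma relation_unique:
  assumes c: "(\<Sum>i\<le>d. c i *\<^sub>R v i) = 0" and i: "i \<le> d"
  shows "c i = (\<Sum>j\<le>d. c j) * \<beta> i"
proof -
  define s where "s = (\<Sum>j\<le>d. c j)"
  have "(\<Sum>i\<le>d. (c i - s * \<beta> i) *\<^sub>R v i) = (\<Sum>i\<le>d. c i *\<^sub>R v i) - s *\<^sub>R (\<Sum>i\<le>d. \<beta> i *\<^sub>R v i)"
    by (simp add: algebra_simps sum_subtractf scaleR_sum_right)
  then have "(\<Sum>i\<le>d. (c i - s * \<beta> i) *\<^sub>R v i) = 0" using c bary by simp
  moreover have "(\<Sum>i\<le>d. c i - s * \<beta> i) = 0"
    using \<beta>_sum by (simp add: sum_subtractf s_def flip: sum_distrib_left)
  ultimately have "c i - s * \<beta> i = 0" using aff_indep[of "\<lambda>i. c i - s * \<beta> i"] i by blast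
  then show ?thesis by (simp add: s_def)
qed

lemma sum_remove_base:
  fixes f :: "nat \<Rightarrow> 'b::comm_monoid_add"
  assumes "bij_betw h UNIV ({..d} - {i0})" "i0 \<le> d"
  shows "(\<Sum>i\<le>d. f i) = f i0 + (\<Sum>j\<in>UNIV. f (h j))"
  using sum.remove[of "{..d}" i0 f] sum.reindex_bij_betw[OF assms(1), of f] assms(2) by simp

lemma ex_base_index:
  assumes "i0 \<le> d"
  shows "\<exists>h :: 'n \<Rightarrow> nat. bij_betw h UNIV ({..d} - {i0})"
  using assms d_eq by (intro finite_same_card_bij) auto

text \<open>Any \<open>d\<close> of the vertices are linearly independent: a relation that omits
  \<open>i0\<close> has coefficient sum 0, because \<open>\<beta> i0 \<noteq> 0\<close>, and so
  vanishes.\<close>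

lemma ex_dual_basis:
  assumes h: "bij_betw h (UNIV :: 'n set) ({..d} - {i0})" and i0: "i0 \<le> d"
  shows "\<exists>y. \<forall>i j. v (h i) \<bullet> y j = (if i = j then 1 else 0)"
proof -
  define V where "V = (\<chi> i. v (h i))"
  have V: "V $ i = v (h i)" for i by (simp add: V_def)
  have hle: "h j \<le> d" "h j \<noteq> i0" for j using h by (auto simp: bij_betw_def)
  have "x = 0" if x: "colm (\<lambda>j. v (h j)) *v x = 0" for x
  proof -
    define c where "c i = (if i = i0 then 0 else x $ the_inv_into UNIV h i)" for i
    have ch: "c (h j) = x $ j" for j
      using hle[of j] h by (simp add: c_def the_inv_into_f_f bij_betw_def)
    have "(\<Sum>i\<le>d. c i *\<^sub>R v i) = 0"
      using x by (simp add: sum_remove_base[OF h i0] ch colm_mult_vec) (simp add: c_def)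
    then have rel: "c i = (\<Sum>j\<le>d. c j) * \<beta> i" if "i \<le> d" for i using relation_unique that by blast
    then have "(\<Sum>j\<le>d. c j) = 0" using \<beta>_pos[OF i0] i0 by (force simp: c_def)
    then have "x $ j = 0" for j using rel[OF hle(1), of j] ch by simp
    then show ?thesis by (simp add: vec_eq_iff)
  qed
  then have "inj ((*v) (colm (\<lambda>j. v (h j))))" by (subst linear_injective_0) auto
  then have "det (colm (\<lambda>j. v (h j))) \<noteq> 0"
    using det_nz_iff_inj[of "(*v) (colm (\<lambda>j. v (h j)))"] by simp
  moreover have "colm (\<lambda>j. v (h j)) = transpose V" by (simp add: colm_def transpose_def V vec_eq_iff)
  ultimately have "det V \<noteq> 0" by simp
  then obtain Y where "V ** Y = mat 1"
    unfolding invertible_det_nz[symmetric] invertible_def by blast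
  then have "V ** colm (\<lambda>j. Y *v axis j 1) = mat 1" by (simp only: colm_columns)
  then have "V $ i \<bullet> (Y *v axis j 1) = mat 1 $ i $ j" for i j by (metis matrix_mult_colm)
  then have "\<forall>i j. v (h i) \<bullet> (Y *v axis j 1) = (if i = j then 1 else 0)"
    by (simp add: V mat_def)
  then show ?thesis by (intro exI[of _ "\<lambda>j. Y *v axis j 1"])
qed

lemma inner_v_inj:
  assumes "\<And>i. i \<le> d \<Longrightarrow> v i \<bullet> x = v i \<bullet> z"
  shows "x = z"
proof -
  obtain h :: "'n \<Rightarrow> nat" where h: "bij_betw h UNIV ({..d} - {0})" using ex_base_index[of 0] by auto
  then obtain y where y: "\<forall>i j. v (h i) \<bullet> y j = (if i = j then 1 else 0)"
    using ex_dual_basis[of h 0] by auto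
  define V where "V = (\<chi> i. v (h i))"
  have V: "V $ i = v (h i)" for i by (simp add: V_def)
  have "V ** colm y = mat 1" by (simp add: vec_eq_iff matrix_mult_colm V y mat_def)
  then have inv: "colm y ** V = mat 1" by (simp add: matrix_left_right_inverse)
  have "V *v x = V *v z"
    using assms h by (auto simp: vec_eq_iff matrix_vector_mul_component V bij_betw_def)
  then have "colm y *v (V *v x) = colm y *v (V *v z)" by simp
  then show ?thesis using inv by (simp add: matrix_vector_mul_assoc)
qed

text \<open>The sum of the dual vectors of the vertices other than \<open>k\<close> has value 1 on
  each of these; the barycentric relation then dictates its value on \<open>v k\<close>.\<close>

lemma ex_dual_vertex:
  assumes k: "k \<le> d"
  shows "\<exists>z. \<forall>i\<le>d. v i \<bullet> z = 1 - (if i = k then 1 / \<beta> k else 0)"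
proof -
  obtain h :: "'n \<Rightarrow> nat" where h: "bij_betw h UNIV ({..d} - {k})" using ex_base_index[OF k] by auto
  then obtain y where y: "\<And>i j. v (h i) \<bullet> y j = (if i = j then 1 else 0)"
    using ex_dual_basis[OF h k] by auto
  define z where "z = (\<Sum>j\<in>UNIV. y j)"
  have vz: "v (h i) \<bullet> z = 1" for i by (simp add: z_def inner_sum_right y)
  have "0 = (\<Sum>i\<le>d. \<beta> i *\<^sub>R v i) \<bullet> z" by (simp add: bary)
  also have "\<dots> = \<beta> k * (v k \<bullet> z) + (\<Sum>j\<in>UNIV. \<beta> (h j))"
    by (simp add: inner_add_left inner_sum_left sum_remove_base[OF h k] vz)
  also have "(\<Sum>j\<in>UNIV. \<beta> (h j)) = 1 - \<beta> k" using sum_remove_base[OF h k, of \<beta>] \<beta>_sum by simp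
  finally have "v k \<bullet> z = 1 - 1 / \<beta> k" using \<beta>_pos[OF k] by (simp add: field_simps)
  moreover have "v i \<bullet> z = 1" if "i \<le> d" "i \<noteq> k" for i
  proof -
    have "i \<in> h ` UNIV" using h that by (auto simp: bij_betw_def)
    then show ?thesis using vz by auto
  qed
  ultimately show ?thesis by (intro exI[of _ z]) auto
qed

definition w :: "nat \<Rightarrow> real^'n" where
  "w k = (SOME z. \<forall>i\<le>d. v i \<bullet> z = 1 - (if i = k then 1 / \<beta> k else 0))"

lemma inner_v_w: "i \<le> d \<Longrightarrow> k \<le> d \<Longrightarrow> v i \<bullet> w k = 1 - (if i = k then 1 / \<beta> k else 0)"
  using someI_ex[OF ex_dual_vertex[of k]] unfolding w_def by blast

lemma polar_eq: "polar_set (convex hull (v ` {..d})) = convex hull (w ` {..d})"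
proof (intro subset_antisym subsetI)
  fix z assume "z \<in> polar_set (convex hull (v ` {..d}))"
  then have le: "v i \<bullet> z \<le> 1" if "i \<le> d" for i using that unfolding polar_set_convex_hull by auto
  \<comment> \<open>The barycentric coordinates of \<open>z\<close> in the polar: nonnegative by the
    inequalities for \<open>z\<close>, with sum 1 because \<open>\<beta>\<close> annihilates the
    vertices.\<close>
  define c where "c i = \<beta> i * (1 - v i \<bullet> z)" for i
  have "(\<Sum>i\<le>d. \<beta> i * (v i \<bullet> z)) = (\<Sum>i\<le>d. \<beta> i *\<^sub>R v i) \<bullet> z" by (simp add: inner_sum_left)
  then have c_sum: "(\<Sum>i\<le>d. c i) = 1"
    using \<beta>_sum bary by (simp add: c_def right_diff_distrib sum_subtractf)
  have c_nonneg: "0 \<le> c i" if "i \<le> d" for i using le[OF that] \<beta>_pos[OF that] by (simp add: c_def)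
  have "z = (\<Sum>i\<le>d. c i *\<^sub>R w i)"
  proof (rule inner_v_inj)
    fix k assume k: "k \<le> d"
    have "v k \<bullet> (\<Sum>i\<le>d. c i *\<^sub>R w i) = (\<Sum>i\<le>d. c i - (if i = k then c k / \<beta> k else 0))"
      unfolding inner_sum_right using k by (intro sum.cong) (auto simp: inner_v_w algebra_simps)
    also have "\<dots> = v k \<bullet> z" using k \<beta>_pos[OF k] c_sum by (simp add: sum_subtractf c_def)
    finally show "v k \<bullet> z = v k \<bullet> (\<Sum>i\<le>d. c i *\<^sub>R w i)" by simp
  qed
  also have "\<dots> \<in> convex hull (w ` {..d})" using c_sum c_nonneg by (intro sum_in_convex_hull) auto
  finally show "z \<in> convex hull (w ` {..d})" .
next
  have "w k \<in> polar_set (convex hull (v ` {..d}))" if "k \<le> d" for k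
    using that \<beta>_pos[OF that] unfolding polar_set_convex_hull by (auto simp: inner_v_w)
  then have "convex hull (w ` {..d}) \<subseteq> polar_set (convex hull (v ` {..d}))"
    by (intro hull_minimal convex_polar_set) auto
  then show "z \<in> polar_set (convex hull (v ` {..d}))" if "z \<in> convex hull (w ` {..d})" for z
    using that by blast
qed

lemma inj_w: "inj_on w {..d}"
proof (rule inj_onI, rule ccontr)
  fix i j assume "i \<in> {..d}" "j \<in> {..d}" "w i = w j" "i \<noteq> j"
  then show False using inner_v_w[of i i] inner_v_w[of i j] \<beta>_pos[of i] by simp
qed

lemma aff_indep_w: "\<not> affine_dependent (w ` {..d})"
proof
  assume "affine_dependent (w ` {..d})"
  then obtain U where U: "sum U (w ` {..d}) = 0" "\<exists>x\<in>w ` {..d}. U x \<noteq> 0" "(\<Sum>x\<in>w ` {..d}. U x *\<^sub>R x) = 0"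
    by (subst (asm) affine_dependent_explicit_finite) auto
  define c where "c i = U (w i)" for i
  have c: "(\<Sum>i\<le>d. c i) = 0" "(\<Sum>i\<le>d. c i *\<^sub>R w i) = 0"
    using U(1,3) inj_w by (simp_all add: sum.reindex c_def)
  have "c k = 0" if k: "k \<le> d" for k
  proof -
    have "0 = v k \<bullet> (\<Sum>i\<le>d. c i *\<^sub>R w i)" by (simp add: c)
    also have "\<dots> = (\<Sum>i\<le>d. c i - (if i = k then c k / \<beta> k else 0))"
      unfolding inner_sum_right using k by (intro sum.cong) (auto simp: inner_v_w algebra_simps)
    also have "\<dots> = - (c k / \<beta> k)" using k c by (simp add: sum_subtractf)
    finally show ?thesis using \<beta>_pos[OF k] by simp
  qed
  then show False using U(2) by (auto simp: c_def)
qed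

lemma aff_dim_face:
  assumes "I \<subseteq> {..d}"
  shows "aff_dim (convex hull (w ` I)) = int (card I) - 1"
proof -
  have "\<not> affine_dependent (w ` I)"
    using assms aff_indep_w by (meson affine_independent_subset image_mono)
  moreover have "card (w ` I) = card I" using assms inj_w by (meson card_image inj_on_subset)
  ultimately show ?thesis using aff_dim_affine_independent[of "w ` I"] by (simp add: aff_dim_convex_hull)
qed

lemma polar_face_iff:
  "F face_of polar_set (convex hull (v ` {..d})) \<and> aff_dim F = int l \<longleftrightarrow>
    (\<exists>I\<subseteq>{..d}. card I = Suc l \<and> F = convex hull (w ` I))"
proof -
  have "F face_of polar_set (convex hull (v ` {..d})) \<longleftrightarrow> (\<exists>I\<subseteq>{..d}. F = convex hull (w ` I))"
    unfolding polar_eq face_of_convex_hull_affine_independent[OF aff_indep_w] by (metis subset_image_iff)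
  then show ?thesis using aff_dim_face by auto
qed

text \<open>The edges at \<open>w i0\<close> are the multiples \<open>- 1 / \<beta> (h j)\<close> of
  the basis dual to the vertices other than \<open>v i0\<close>, which is the situation of
  \<open>volZ_simplex\<close>.\<close>

lemma face_volume:
  assumes I: "I \<subseteq> {..d}" "i0 \<in> I" and h: "bij_betw h (UNIV :: 'n set) ({..d} - {i0})"
    and y: "\<And>i j. v (h i) \<bullet> y j = (if i = j then 1 else 0)"
    and v_int: "\<And>j. v (h j) \<in> int_points"
  obtains D :: real where "1 \<le> D"
    "volZ (convex hull (w ` I)) * ((\<Prod>i\<in>I - {i0}. \<beta> i) * fact (card I - 1) * D) = 1"
    "D = 1 \<longleftrightarrow> (\<forall>j. h j \<in> I \<longrightarrow> y j \<in> int_points)"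
proof -
  define V where "V = (\<chi> i. v (h i))"
  have V: "V $ i = v (h i)" for i by (simp add: V_def)
  define K where "K = {j. h j \<in> I}"
  interpret dual_basis V y K
    by standard (simp_all add: V y v_int)
  define g where "g j = - 1 / \<beta> (h j)" for j
  have i0: "i0 \<le> d" using I by auto
  have hle: "h j \<le> d" "h j \<noteq> i0" for j using h by (auto simp: bij_betw_def)
  have h_inj: "h i = h j \<longleftrightarrow> i = j" for i j using h by (auto simp: bij_betw_def inj_on_def)
  have hK: "bij_betw h K (I - {i0})"
    using h I unfolding bij_betw_def K_def by (auto simp: inj_on_def)
  have w_eq: "w (h j) = w i0 + g j *\<^sub>R y j" for j
  proof (rule V_inj)
    fix i show "V $ i \<bullet> w (h j) = V $ i \<bullet> (w i0 + g j *\<^sub>R y j)"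
      using hle[of i] hle[of j] i0 by (auto simp: V inner_v_w inner_diff_right y g_def h_inj)
  qed
  have "I = insert i0 (h ` K)" using hK I(2) by (auto simp: bij_betw_def)
  then have F: "convex hull (w ` I) = convex hull (insert (w i0) ((\<lambda>j. w i0 + g j *\<^sub>R y j) ` K))"
    by (simp add: image_image w_eq)
  have cardK: "card K = card I - 1"
    using bij_betw_same_card[OF hK] I finite_subset[OF I(1)] by simp
  have "aff_dim (convex hull (w ` I)) = int (card K)"
    using aff_dim_face[OF I(1)] cardK I finite_subset[OF I(1)] by (cases "card I") auto
  moreover have "g j \<noteq> 0" for j using \<beta>_pos[OF hle(1)[of j]] by (simp add: g_def)
  ultimately obtain D :: real where D: "1 \<le> D"
      "volZ (convex hull (w ` I)) = (\<Prod>j\<in>K. \<bar>g j\<bar>) / (fact (card K) * D)"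
      "D = 1 \<longleftrightarrow> (\<forall>j\<in>K. y j \<in> int_points)"
    using volZ_simplex[OF _ F] by blast
  have "(\<Prod>j\<in>K. \<bar>g j\<bar>) = (\<Prod>j\<in>K. 1 / \<beta> (h j))"
    using \<beta>_pos hle by (intro prod.cong) (auto simp: g_def abs_of_pos)
  also have "\<dots> = 1 / (\<Prod>i\<in>I - {i0}. \<beta> i)"
    by (simp add: prod_dividef prod.reindex_bij_betw[OF hK])
  finally have "volZ (convex hull (w ` I)) = 1 / (\<Prod>i\<in>I - {i0}. \<beta> i) / (fact (card I - 1) * D)"
    using D(2) cardK by simp
  moreover have "(\<Prod>i\<in>I - {i0}. \<beta> i) > 0" using I \<beta>_pos by (intro prod_pos) auto
  ultimately show ?thesis
    using D by (intro that[of D]) (auto simp: K_def)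
qed

end

section \<open>Product-sum inequalities from Minkowski's theorem\<close>

text \<open>The determinant of a rank-one perturbation of the identity, built up by perturbing one
  row at a time.\<close>

lemma det_identity_minus_rows:
  fixes u :: "'n::finite \<Rightarrow> real"
  shows "det (\<chi> i j. (if i = j then 1 else 0) - u i :: real^'n^'n) = 1 - sum u UNIV"
proof -
  define A where "A J = (\<chi> i j. (if i = j then 1 else 0) - (if i \<in> J then u i else 0) :: real^'n^'n)" for J
  \<comment> \<open>Appears when the newly perturbed row \<open>a\<close> is split by linearity: its
    all-ones part clears the perturbations of the other rows.\<close>
  define B where "B a J = (\<chi> i j. if i = a then 1 else A J $ i $ j :: real^'n^'n)" for a J
  have detB: "det (B a J) = 1" if "a \<notin> J" for a J
    using finite[of J] that
  proof (induction J rule: finite_induct)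
    case empty
    have sum_rows: "(\<Sum>i\<in>UNIV. (\<chi> i. 1) $ i *s row i (mat 1 :: real^'n^'n)) = (\<chi> i. 1)"
      by (simp add: vec_eq_iff row_def mat_def if_distrib cong: if_cong)
    have "B a {} = (\<chi> i. if i = a then (\<Sum>i\<in>UNIV. (\<chi> i. 1) $ i *s row i (mat 1)) else row i (mat 1))"
      unfolding sum_rows by (auto simp: B_def A_def row_def mat_def vec_eq_iff)
    then show ?case using cramer_lemma_transpose[of a "\<chi> i. 1" "mat 1 :: real^'n^'n"] by simp
  next
    case (insert b J)
    have "B a (insert b J) = (\<chi> k. if k = b then row b (B a J) + (- u b) *s row a (B a J) else row k (B a J))"
      using insert by (auto simp: B_def A_def row_def vec_eq_iff)
    then show ?case using det_row_operation[of b a "B a J" "- u b"] insert by auto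
  qed
  have "det (A J) = 1 - sum u J" for J
    using finite[of J]
  proof (induction J rule: finite_induct)
    case empty
    have "A {} = mat 1" by (simp add: A_def mat_def vec_eq_iff)
    then show ?case by simp
  next
    case (insert a J)
    have "A (insert a J) = (\<chi> i. if i = a then axis a 1 + (- u a) *s (\<chi> j. 1) else A J $ i)"
      using insert by (auto simp: A_def axis_def vec_eq_iff)
    also have "det \<dots> = det (\<chi> i. if i = a then axis a 1 else A J $ i) + det (\<chi> i. if i = a then (- u a) *s (\<chi> j. 1) else A J $ i)"
      by (rule det_row_add)
    also have "det (\<chi> i. if i = a then (- u a) *s (\<chi> j. 1) else A J $ i) =
        - u a * det (\<chi> i. if i = a then (\<chi> j. 1) else A J $ i)" by (rule det_row_mul)
    also have "(\<chi> i. if i = a then (\<chi> j. 1) else A J $ i) = B a J"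
      by (auto simp: B_def vec_eq_iff)
    also have "(\<chi> i. if i = a then axis a 1 else A J $ i) = A J"
      using insert by (auto simp: A_def axis_def vec_eq_iff)
    finally show ?case using insert detB[of a J] by simp
  qed
  from this[of UNIV] show ?thesis by (simp add: A_def)
qed

locale one_point_simplex = bary_simplex d v \<beta>
  for d :: nat and v :: "nat \<Rightarrow> real^'n" and \<beta> :: "nat \<Rightarrow> real" +
  assumes v_int: "\<And>i. i \<le> d \<Longrightarrow> v i \<in> int_points"
    and one_point: "\<And>x c. x \<in> int_points \<Longrightarrow> (\<And>i. i \<le> d \<Longrightarrow> 0 < c i) \<Longrightarrow> (\<Sum>i\<le>d. c i) = 1 \<Longrightarrow>
      x = (\<Sum>i\<le>d. c i *\<^sub>R v i) \<Longrightarrow> x = 0"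
begin

text \<open>Up to the sign of \<open>x\<close>, such a point is interior to the simplex: the hypothesis bounds the
  change of the first \<open>d\<close> barycentric coordinates, and the sign is chosen to increase the last one.\<close>

lemma small_point_zero:
  assumes x: "x \<in> int_points" "x = (\<Sum>i<d. c i *\<^sub>R v i)"
    and small: "\<And>i. i < d \<Longrightarrow> c i = 0 \<or> \<bar>c i - \<beta> i * (\<Sum>j<d. c j)\<bar> < \<beta> i"
  shows "x = 0"
proof -
  have main: "- x = 0" if x: "x \<in> int_points" "x = (\<Sum>i<d. c i *\<^sub>R v i)" and s: "0 \<le> (\<Sum>j<d. c j)"
    and small: "\<And>i. i < d \<Longrightarrow> c i = 0 \<or> \<bar>c i - \<beta> i * (\<Sum>j<d. c j)\<bar> < \<beta> i" for x c
  proof -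
    define s where "s = (\<Sum>j<d. c j)"
    \<comment> \<open>Barycentric coordinates of \<open>- x\<close>:
      \<open>\<beta> i - (c i - s * \<beta> i)\<close> for \<open>i < d\<close> and
      \<open>(1 + s) * \<beta> d\<close> at the end. A coefficient \<open>c i = 0\<close> is
      harmless, since it leaves \<open>(1 + s) * \<beta> i\<close>.\<close>
    define b where "b i = (1 + s) * \<beta> i - (if i < d then c i else 0)" for i
    have lessThan: "(\<Sum>i\<le>d. if i < d then f i else 0) = sum f {..<d}" for f :: "nat \<Rightarrow> 'b::comm_monoid_add"
      by (rule sum.mono_neutral_cong_right) auto
    show ?thesis
    proof (rule one_point[of "- x" b])
      show "- x \<in> int_points" using x by (simp add: int_points_uminus)
      show "(\<Sum>i\<le>d. b i) = 1"
        by (simp add: b_def sum_subtractf lessThan \<beta>_sum s_def flip: sum_distrib_left)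
      have "(\<Sum>i\<le>d. b i *\<^sub>R v i) = (1 + s) *\<^sub>R (\<Sum>i\<le>d. \<beta> i *\<^sub>R v i) - (\<Sum>i\<le>d. (if i < d then c i else 0) *\<^sub>R v i)"
        by (simp add: b_def algebra_simps sum_subtractf sum.distrib scaleR_sum_right)
      also have "(\<Sum>i\<le>d. (if i < d then c i else 0) *\<^sub>R v i) = (\<Sum>i\<le>d. if i < d then c i *\<^sub>R v i else 0)"
        by (intro sum.cong) auto
      finally show "- x = (\<Sum>i\<le>d. b i *\<^sub>R v i)" using x(2) bary by (simp add: lessThan)
      fix i assume i: "i \<le> d"
      have "0 < (1 + s) * \<beta> i" using \<beta>_pos[OF i] that(3) by (simp add: s_def)
      then show "0 < b i"
        using small[of i] by (auto simp: b_def s_def algebra_simps abs_less_iff)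
    qed
  qed
  show ?thesis
  proof (cases "0 \<le> (\<Sum>j<d. c j)")
    case True
    then show ?thesis using main[OF x True small] by simp
  next
    case False
    have neg: "(\<Sum>j<d. - c j) = - (\<Sum>j<d. c j)" by (simp add: sum_negf)
    have "- (- x) = 0"
    proof (rule main[of "- x" "\<lambda>i. - c i"])
      show "- x \<in> int_points" using x by (simp add: int_points_uminus)
      show "- x = (\<Sum>i<d. - c i *\<^sub>R v i)" using x by (simp add: sum_negf)
      show "0 \<le> (\<Sum>j<d. - c j)" unfolding neg using False by simp
      fix i assume "i < d"
      then show "- c i = 0 \<or> \<bar>- c i - \<beta> i * (\<Sum>j<d. - c j)\<bar> < \<beta> i"
        unfolding neg using small[of i] by (auto simp: abs_minus_commute)
    qed
    then show ?thesis by simp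
  qed
qed

context
  fixes h :: "'n \<Rightarrow> nat" and m :: nat
  assumes h: "bij_betw h UNIV {..<d}" and m: "m \<le> d"
begin

lemma h_less: "h j < d" and h_inj: "h i = h j \<longleftrightarrow> i = j"
  using h by (auto simp: bij_betw_def inj_on_def)

text \<open>For a point with coefficients \<open>c\<close>, a row below \<open>m\<close> is the
  difference between its barycentric coordinate and that of the origin, to be kept below
  \<open>\<beta>\<close>. A row from \<open>m\<close> on is the coefficient itself, which an
  integrality argument with bound 1 makes zero. The determinant is the tail sum.\<close>

definition form :: "real^'n^'n" where
  "form = (\<chi> i j. (if i = j then 1 else 0) - (if h i < m then \<beta> (h i) else 0))"

lemma form_mult: "(form *v c) $ i = c $ i - (if h i < m then \<beta> (h i) * (\<Sum>j\<in>UNIV. c $ j) else 0)"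
  by (simp add: form_def matrix_vector_mult_def left_diff_distrib sum_subtractf if_distrib[of "\<lambda>t. t * _"] sum_distrib_left
    cong: if_cong)

lemma det_form: "det form = (\<Sum>i=m..<Suc d. \<beta> i)"
proof -
  have "det form = 1 - (\<Sum>j\<in>UNIV. if h j < m then \<beta> (h j) else 0)"
    unfolding form_def by (rule det_identity_minus_rows)
  also have "(\<Sum>j\<in>UNIV. if h j < m then \<beta> (h j) else 0) = (\<Sum>i<d. if i < m then \<beta> i else 0)"
    by (rule sum.reindex_bij_betw[OF h])
  also have "\<dots> = (\<Sum>i<m. \<beta> i)" using m by (intro sum.mono_neutral_cong_right) auto
  also have "1 - \<dots> = (\<Sum>i=m..<Suc d. \<beta> i)"
    using sum.atLeastLessThan_concat[of 0 m "Suc d" \<beta>] m \<beta>_sum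
    by (simp add: atLeast0LessThan lessThan_Suc_atMost)
  finally show ?thesis .
qed

lemma det_form_pos: "0 < det form"
  unfolding det_form using m \<beta>_pos by (intro sum_pos) auto

definition bound :: "'n \<Rightarrow> real" where
  "bound i = (if h i < m then \<beta> (h i) else 1)"

lemma bound_pos: "0 < bound i"
  using \<beta>_pos h_less[of i] by (simp add: bound_def)

lemma prod_bound: "prod bound UNIV = prod \<beta> {0..<m}"
proof -
  have "prod bound UNIV = (\<Prod>i<d. if i < m then \<beta> i else 1)"
    unfolding bound_def by (rule prod.reindex_bij_betw[OF h])
  also have "\<dots> = prod \<beta> {0..<m}" using m by (intro prod.mono_neutral_cong_right) auto
  finally show ?thesis .
qed

lemma small_form_zero:
  assumes x: "x \<in> int_points" "x = (\<Sum>j\<in>UNIV. c $ j *\<^sub>R v (h j))"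
    and small: "\<And>i. \<bar>(form *v c) $ i\<bar> < bound i" and int: "\<And>i. m \<le> h i \<Longrightarrow> c $ i \<in> \<int>"
  shows "x = 0"
proof -
  define c' where "c' i = c $ the_inv_into UNIV h i" for i
  have ch: "c' (h j) = c $ j" for j using h by (simp add: c'_def the_inv_into_f_f bij_betw_def)
  have s: "(\<Sum>i<d. c' i) = (\<Sum>j\<in>UNIV. c $ j)"
    using sum.reindex_bij_betw[OF h, of c'] by (simp add: ch)
  show ?thesis
  proof (rule small_point_zero[OF x(1)])
    show "x = (\<Sum>i<d. c' i *\<^sub>R v i)"
      using sum.reindex_bij_betw[OF h, of "\<lambda>i. c' i *\<^sub>R v i"] x(2) by (simp add: ch)
    fix i assume "i < d"
    then obtain j where j: "i = h j" using h by (auto simp: bij_betw_def)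
    show "c' i = 0 \<or> \<bar>c' i - \<beta> i * (\<Sum>j<d. c' j)\<bar> < \<beta> i"
    proof (cases "h j < m")
      case True
      then show ?thesis using small[of j] by (simp add: j ch s form_mult bound_def)
    next
      case False
      then have "\<bar>c $ j\<bar> < 1" "c $ j \<in> \<int>" using small[of j] int[of j] by (auto simp: form_mult bound_def)
      then have "c $ j = 0" using Ints_nonzero_abs_less1 by blast
      then show ?thesis by (simp add: j ch)
    qed
  qed
qed

text \<open>Otherwise the linear forms produce a nonzero integral combination of the vertices
  \<open>v (h j)\<close> that \<open>small_form_zero\<close> shows to be zero, against their linear
  independence.\<close>

lemma product_sum_le: "prod \<beta> {0..<m} \<le> (\<Sum>i=m..<Suc d. \<beta> i)"
proof (rule ccontr)
  assume "\<not> ?thesis"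
  then have "\<bar>det form\<bar> < prod bound UNIV" using det_form det_form_pos prod_bound by simp
  then obtain c where c: "c \<in> int_points" "c \<noteq> 0" "\<And>i. \<bar>(form *v c) $ i\<bar> < bound i"
    using minkowski_linear_forms[of form bound] det_form_pos bound_pos by auto
  define x where "x = (\<Sum>j\<in>UNIV. c $ j *\<^sub>R v (h j))"
  have "x \<in> int_points" unfolding x_def
    using c(1) h_less v_int by (intro int_points_sum int_points_scaleR) (auto simp: int_points_def less_imp_le)
  then have "x = 0" using small_form_zero[OF _ x_def c(3)] c(1) by (simp add: int_points_def)
  have "{..d} - {d} = {..<d}" by auto
  then obtain y where y: "\<And>i j. v (h i) \<bullet> y j = (if i = j then 1 else 0)"
    using ex_dual_basis[of h d] h by auto
  have "c $ j = 0" for j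
  proof -
    have "0 = x \<bullet> y j" by (simp add: \<open>x = 0\<close>)
    also have "\<dots> = c $ j" by (simp add: x_def inner_sum_left y if_distrib cong: if_cong)
    finally show ?thesis by simp
  qed
  then show False using c(2) by (simp add: vec_eq_iff)
qed

text \<open>The same argument for all integral points instead of the lattice generated by the
  vertices. The coefficients of \<open>x\<close> are now \<open>y j \<bullet> x\<close>, which
  divides the determinant of the forms by \<open>\<bar>det V\<bar>\<close>; the coefficients from
  \<open>m\<close> on remain integral because those \<open>y j\<close> are.\<close>

lemma det_vertices_le:
  assumes y: "\<And>i j. v (h i) \<bullet> y j = (if i = j then 1 else 0)"
    and y_int: "\<And>j. m \<le> h j \<Longrightarrow> y j \<in> int_points"
  shows "\<bar>det (\<chi> i. v (h i))\<bar> * prod \<beta> {0..<m} \<le> (\<Sum>i=m..<Suc d. \<beta> i)"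
proof (rule ccontr)
  assume neg: "\<not> ?thesis"
  define V where "V = (\<chi> i. v (h i))"
  define Y where "Y = transpose (colm y)"
  have VY: "V ** colm y = mat 1" by (simp add: V_def vec_eq_iff matrix_mult_colm y mat_def)
  then have dets: "det V * det Y = 1" unfolding Y_def det_transpose by (metis det_I det_mul)
  then have detV: "det V \<noteq> 0" by auto
  have Y_mult: "(Y *v x) $ j = y j \<bullet> x" for x j
    by (simp add: Y_def transpose_def colm_def matrix_vector_mult_def inner_vec_def)
  have expand: "x = (\<Sum>j\<in>UNIV. (Y *v x) $ j *\<^sub>R v (h j))" for x
  proof -
    have "transpose V ** Y = mat 1"
      using VY unfolding Y_def by (metis matrix_left_right_inverse matrix_transpose_mul transpose_mat)
    then have "x = transpose V *v (Y *v x)" by (simp add: matrix_vector_mul_assoc)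
    also have "transpose V = colm (\<lambda>j. v (h j))" by (simp add: V_def colm_def transpose_def vec_eq_iff)
    finally show ?thesis unfolding colm_mult_vec .
  qed
  have "\<bar>det (form ** Y)\<bar> = det form / \<bar>det V\<bar>"
  proof -
    have "det Y = 1 / det V" using dets detV by (simp add: field_simps)
    then show ?thesis using det_form_pos by (simp add: det_mul abs_mult abs_divide)
  qed
  also have "\<dots> < prod bound UNIV"
    using neg detV det_form prod_bound by (simp add: V_def field_simps)
  finally have "\<bar>det (form ** Y)\<bar> < prod bound UNIV" .
  moreover have "det (form ** Y) \<noteq> 0" using det_form_pos dets by (auto simp: det_mul)
  ultimately obtain x where x: "x \<in> int_points" "x \<noteq> 0" "\<And>i. \<bar>((form ** Y) *v x) $ i\<bar> < bound i"
    using minkowski_linear_forms[of "form ** Y" bound] bound_pos by auto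
  have "x = 0"
    using x y_int by (intro small_form_zero[OF x(1) expand])
      (auto simp: Y_mult matrix_vector_mul_assoc intro: inner_Ints)
  then show False using x by simp
qed

end

end

section \<open>The extremal simplex\<close>

lemma bij_coord_index: "bij_betw coord_index (UNIV :: 'n::finite set) {1..CARD('n)}"
proof -
  have "\<exists>\<pi>. bij_betw \<pi> (UNIV :: 'n set) {1..CARD('n)}"
    by (intro finite_same_card_bij) auto
  then show ?thesis unfolding coord_index_def by (rule someI_ex)
qed

definition coord0 :: "'n::finite \<Rightarrow> nat" where
  "coord0 j = coord_index j - 1"

lemma coord_index_eq: "coord_index (j::'n::finite) = Suc (coord0 j)"
proof -
  have "coord_index j \<in> {1..CARD('n)}" using bij_coord_index by (auto simp: bij_betw_def)
  then show ?thesis by (simp add: coord0_def)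
qed

lemma bij_coord0: "bij_betw coord0 (UNIV :: 'n::finite set) {..<CARD('n)}"
proof -
  have "bij_betw (\<lambda>i. i - 1) {1..CARD('n)} {..<CARD('n)}"
    by (rule bij_betwI[of _ _ _ Suc]) auto
  then have "bij_betw ((\<lambda>i. i - 1) \<circ> coord_index) (UNIV :: 'n set) {..<CARD('n)}"
    using bij_coord_index bij_betw_trans by blast
  then show ?thesis by (simp add: coord0_def[abs_def] comp_def)
qed

text \<open>The barycentric coordinates of \<open>ones\<close> in \<open>sylv_simplex\<close>, index
  \<open>d\<close> belonging to the vertex 0: the rest \<open>1 / sylp (d - 1)\<close> after the
  Sylvester reciprocals is split evenly between the last two.\<close>

definition ext_weight :: "nat \<Rightarrow> nat \<Rightarrow> real" where
  "ext_weight d i = (if i < d - 1 then 1 / (sylp i + 1) else 1 / (2 * sylp (d - 1)))"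

lemma ext_weight_pos: "0 < ext_weight d i"
  by (simp add: ext_weight_def)

lemma sum_ext_weight:
  assumes "1 \<le> d"
  shows "(\<Sum>i<d. ext_weight d i) = 1 - ext_weight d d"
proof -
  obtain e where d: "d = Suc e" using assms by (cases d) auto
  have "(\<Sum>i<e. ext_weight d i) = (\<Sum>i=0..<e. 1 / (sylp i + 1))"
    by (auto simp: ext_weight_def d atLeast0LessThan intro!: sum.cong)
  then show ?thesis using sum_inverse_sylv[of 0 e] by (simp add: d ext_weight_def field_simps)
qed

text \<open>The polar vertex that comes from the facet of \<open>sylv_simplex\<close> opposite 0;
  the coordinate facets give the vertices \<open>- axis j 1\<close>.\<close>

definition apex :: "real^'n" where
  "apex = (\<chi> j. ext_weight CARD('n) (coord0 j) / ext_weight CARD('n) CARD('n))"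

lemma sum_over_coord0: "(\<Sum>j\<in>UNIV. f (coord0 (j::'n::finite))) = (\<Sum>i<CARD('n). f i)"
  by (rule sum.reindex_bij_betw[OF bij_coord0])

lemma sum_apex: "1 + (\<Sum>j\<in>UNIV. (apex :: real^'n) $ j) = 1 / ext_weight CARD('n) CARD('n)"
proof -
  have "1 \<le> CARD('n)" using zero_less_card_finite[where 'a = 'n] by linarith
  then have "(\<Sum>j\<in>UNIV. (apex :: real^'n) $ j) = (1 - ext_weight CARD('n) CARD('n)) / ext_weight CARD('n) CARD('n)"
    by (simp add: apex_def sum_over_coord0[of "ext_weight CARD('n)"] sum_ext_weight flip: sum_divide_distrib)
  then show ?thesis using ext_weight_pos[of "CARD('n)" "CARD('n)"] by (simp add: field_simps)
qed

lemma sylv_simplex_eq: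
  "(sylv_simplex :: (real^'n) set) =
    convex hull (insert 0 (range (\<lambda>j. (1 / ext_weight CARD('n) (coord0 j)) *\<^sub>R axis j 1)))"
proof -
  define d where "d = CARD('n)"
  have d1: "1 \<le> d" using zero_less_card_finite[where 'a = 'n] by (simp add: d_def)
  have "(if coord_index j = CARD('n) then 2 * (real (sylv CARD('n)) - 1)
      else real (sylv (coord_index j))) = 1 / ext_weight CARD('n) (coord0 j)" for j :: 'n
  proof -
    have "coord0 j < d" using bij_coord0[where 'n = 'n] by (auto simp: bij_betw_def d_def)
    moreover have "real (sylv d) - 1 = sylp (d - 1)" using d1 by (simp add: sylp_def)
    ultimately show ?thesis
      by (auto simp: coord_index_eq sylv_eq_sylp ext_weight_def d_def[symmetric])
  qed
  then show ?thesis unfolding sylv_simplex_def by (simp add: full_SetCompr_eq)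
qed

lemma polar_sylv_simplex:
  "polar_set ((\<lambda>x. x - ones) ` sylv_simplex) = convex hull (insert apex (range (\<lambda>j::'n::finite. - axis j 1)))"
proof -
  define d where "d = CARD('n)"
  define b where "b j = ext_weight d (coord0 j)" for j :: 'n
  define b0 where "b0 = ext_weight d d"
  have b: "0 < b j" "0 < b0" for j by (simp_all add: b_def b0_def ext_weight_pos)
  have d1: "1 \<le> d" using zero_less_card_finite[where 'a = 'n] by (simp add: d_def)
  have b_sum: "(\<Sum>j\<in>UNIV. b j) = 1 - b0"
    unfolding b_def b0_def sum_over_coord0[of "ext_weight d"] d_def[symmetric] by (rule sum_ext_weight[OF d1])
  have "sylv_simplex = convex hull (insert 0 (range (\<lambda>j::'n. (1 / b j) *\<^sub>R axis j 1)))"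
    unfolding b_def d_def by (rule sylv_simplex_eq)
  then have "(\<lambda>x. x - ones) ` sylv_simplex =
      convex hull ((\<lambda>x. x - ones) ` insert 0 (range (\<lambda>j::'n. (1 / b j) *\<^sub>R axis j 1)))"
    using convex_hull_translation[of "- ones" "insert 0 (range (\<lambda>j::'n. (1 / b j) *\<^sub>R axis j 1))"] by simp
  then have polar: "polar_set ((\<lambda>x. x - ones) ` sylv_simplex) =
      {z::real^'n. - (\<Sum>i\<in>UNIV. z $ i) \<le> 1 \<and> (\<forall>j. z $ j / b j - (\<Sum>i\<in>UNIV. z $ i) \<le> 1)}"
    by (auto simp: polar_set_convex_hull inner_diff_left inner_axis' ones_def inner_vec_def[of "\<chi> i. 1"])
  have apex: "apex $ j = b j / b0" for j :: 'n by (simp add: apex_def b_def b0_def d_def)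
  have apex_sum: "(\<Sum>j\<in>UNIV. (apex :: real^'n) $ j) = 1 / b0 - 1"
    using sum_apex[where 'n = 'n] by (simp add: b0_def d_def)
  show ?thesis
  proof (intro subset_antisym subsetI)
    fix z :: "real^'n" assume "z \<in> polar_set ((\<lambda>x. x - ones) ` sylv_simplex)"
    then have z: "- (\<Sum>i\<in>UNIV. z $ i) \<le> 1" "\<And>j. z $ j / b j - (\<Sum>i\<in>UNIV. z $ i) \<le> 1"
      unfolding polar by auto
    define s where "s = 1 + (\<Sum>i\<in>UNIV. z $ i)"
    define p :: "'n option \<Rightarrow> real^'n" where "p i = (case i of None \<Rightarrow> apex | Some j \<Rightarrow> - axis j 1)" for i
    \<comment> \<open>The solution of \<open>z = \<Sum> c i p i\<close> with coefficient sum 1. Its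
      nonnegativity is precisely the system of inequalities defining the polar.\<close>
    define c :: "'n option \<Rightarrow> real" where "c i = (case i of None \<Rightarrow> b0 * s | Some j \<Rightarrow> b j * s - z $ j)" for i
    have opt: "sum f UNIV = f None + (\<Sum>j\<in>UNIV. f (Some j))" for f :: "'n option \<Rightarrow> 'b::comm_monoid_add"
      unfolding UNIV_option_conv by (subst sum.insert) (auto simp: sum.reindex)
    have "(\<Sum>i\<in>UNIV. c i *\<^sub>R p i) \<in> convex hull (p ` UNIV)"
    proof (rule sum_in_convex_hull)
      fix i show "0 \<le> c i"
      proof (cases i)
        case None
        then show ?thesis using z(1) b by (simp add: c_def s_def)
      next
        case (Some j)
        have "z $ j / b j \<le> s" using z(2)[of j] by (simp add: s_def)
        then show ?thesis using Some b(1)[of j] by (simp add: c_def field_simps)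
      qed
      have "(\<Sum>j\<in>UNIV. b j * s) = (1 - b0) * s" unfolding sum_distrib_right[symmetric] b_sum ..
      then have "sum c UNIV = b0 * s + ((1 - b0) * s - (\<Sum>j\<in>UNIV. z $ j))"
        by (simp add: opt c_def sum_subtractf)
      then show "sum c UNIV = 1" by (simp add: s_def algebra_simps)
    qed simp
    also have "(\<Sum>i\<in>UNIV. c i *\<^sub>R p i) = z"
    proof -
      have "(\<Sum>j\<in>UNIV. (b j * s - z $ j) *\<^sub>R - axis j 1) $ k = z $ k - b k * s" for k
        by (simp add: axis_def if_distrib[of "\<lambda>t. _ * t"] sum_negf cong: if_cong)
      then show ?thesis using b by (simp add: vec_eq_iff opt c_def p_def apex)
    qed
    also have "p ` UNIV = insert apex (range (\<lambda>j. - axis j 1))"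
      unfolding UNIV_option_conv by (auto simp: p_def image_image)
    finally show "z \<in> convex hull (insert apex (range (\<lambda>j. - axis j 1)))" .
  next
    have "insert apex (range (\<lambda>j. - axis j 1)) \<subseteq> polar_set ((\<lambda>x. x - ones) ` (sylv_simplex :: (real^'n) set))"
    proof -
      have "apex \<in> polar_set ((\<lambda>x. x - ones) ` (sylv_simplex :: (real^'n) set))"
        unfolding polar using apex_sum b by (auto simp: apex less_imp_le)
      moreover have "- axis j 1 \<in> polar_set ((\<lambda>x. x - ones) ` (sylv_simplex :: (real^'n) set))" for j
        unfolding polar using b by (auto simp: axis_def sum_negf less_imp_le)
      ultimately show ?thesis by auto
    qed
    then have "convex hull (insert apex (range (\<lambda>j. - axis j 1))) \<subseteq> polar_set ((\<lambda>x. x - ones) ` (sylv_simplex :: (real^'n) set))"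
      by (intro hull_minimal convex_polar_set)
    then show "z \<in> polar_set ((\<lambda>x. x - ones) ` sylv_simplex)"
      if "z \<in> convex hull (insert apex (range (\<lambda>j. - axis j 1)))" for z :: "real^'n" using that by blast
  qed
qed

section \<open>The volume bound and its equality case\<close>

lemma prod_subset_ge:
  fixes x :: "nat \<Rightarrow> real"
  assumes "J \<subseteq> {..<d}" "\<And>i. i < d \<Longrightarrow> 0 < x i" "\<And>i. Suc i < d \<Longrightarrow> x (Suc i) \<le> x i"
  shows "prod x {d - card J..<d} \<le> prod x J"
  using assms
proof (induction d arbitrary: J)
  case (Suc d)
  have fin: "finite J" using Suc.prems(1) finite_subset by blast
  show ?case
  proof (cases "d \<in> J")
    case True
    then obtain l where l: "card J = Suc l" using fin by (cases "card J") auto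
    have "prod x {d - card (J - {d})..<d} \<le> prod x (J - {d})"
      using Suc.prems by (intro Suc.IH) force+
    moreover have "card (J - {d}) = l" using True fin l by simp
    ultimately have "prod x {d - l..<d} * x d \<le> prod x (J - {d}) * x d"
      using Suc.prems(2)[of d] by (intro mult_right_mono) auto
    also have "\<dots> = prod x J" using prod.remove[OF fin True, of x] by (simp add: mult.commute)
    finally show ?thesis using l by simp
  next
    case False
    then have J: "J \<subseteq> {..<d}" using Suc.prems(1) by (auto simp: less_Suc_eq)
    then have "card J \<le> d" using card_mono[of "{..<d}" J] by simp
    have "prod x {Suc d - card J..<Suc d} = prod x {Suc (d - card J)..<Suc d}"
      using \<open>card J \<le> d\<close> by (simp add: Suc_diff_le)
    also have "\<dots> = (\<Prod>i=d - card J..<d. x (Suc i))" by (rule prod.shift_bounds_Suc_ivl)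
    also have "\<dots> \<le> prod x {d - card J..<d}"
      using Suc.prems by (intro prod_mono) (auto simp: less_imp_le)
    also have "\<dots> \<le> prod x J" using Suc.prems J by (intro Suc.IH) auto
    finally show ?thesis .
  qed
qed auto

definition vol_bound :: "nat \<Rightarrow> nat \<Rightarrow> real" where
  "vol_bound d l = 2 * sylp (d - 1) ^ 2 / (fact l * sylp (d - l))"

locale sorted_simplex = one_point_simplex d v \<beta>
  for d :: nat and v :: "nat \<Rightarrow> real^'n" and \<beta> :: "nat \<Rightarrow> real" +
  assumes \<beta>_dec: "\<And>i. i < d \<Longrightarrow> \<beta> (Suc i) \<le> \<beta> i"
    and d4: "4 \<le> d"
begin

sublocale product_sum d \<beta>
proof
  have "{..d} - {d} = {..<d}" by auto
  then obtain h :: "'n \<Rightarrow> nat" where h: "bij_betw h UNIV {..<d}" using ex_base_index[of d] by auto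
  show "prod \<beta> {0..<m} \<le> sum \<beta> {m..<Suc d}" if "1 \<le> m" "m \<le> d" for m
    using product_sum_le[OF h that(2)] .
  show "sum \<beta> {0..<Suc d} = 1" using \<beta>_sum by (simp add: atLeast0LessThan lessThan_Suc_atMost)
qed (use \<beta>_pos \<beta>_dec d4 in auto)

text \<open>Dropping \<open>Max I\<close> keeps the remaining indices below \<open>d\<close>, so the
  bound follows from the chain: \<open>r\<close>, the product of the last \<open>l\<close> weights
  before \<open>\<beta> d\<close>, \<open>p\<close>, \<open>p * D\<close>. Equality collapses the
  chain, which fixes the weights, the product over \<open>I - {i0}\<close> and
  \<open>D = 1\<close>.\<close>

lemma face_volume_le:
  assumes I: "I \<subseteq> {..d}" "card I = Suc l" and l: "1 \<le> l" and i0: "i0 = Max I"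
    and h: "bij_betw h (UNIV :: 'n set) ({..d} - {i0})"
    and y: "\<And>i j. v (h i) \<bullet> y j = (if i = j then 1 else 0)"
  shows "volZ (convex hull (w ` I)) \<le> vol_bound d l"
    and "volZ (convex hull (w ` I)) = vol_bound d l \<Longrightarrow>
      (\<forall>i\<le>d. \<beta> i = ext_weight d i) \<and> prod \<beta> (I - {i0}) = sylp (d - l) / (2 * sylp (d - 1) ^ 2) \<and>
      (\<forall>j. h j \<in> I \<longrightarrow> y j \<in> int_points)"
proof -
  have fin: "finite I" "I \<noteq> {}" using I finite_subset[OF I(1)] by auto
  have i0I: "i0 \<in> I" using i0 fin by simp
  have hle: "h j \<le> d" for j using h by (auto simp: bij_betw_def)
  have card: "card (I - {i0}) = l" using I(2) i0I fin by simp
  have less: "I - {i0} \<subseteq> {..<d}"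
  proof
    fix i assume "i \<in> I - {i0}"
    then have "i < i0" using i0 fin by (metis DiffE Max_ge insertI1 order_le_less singleton_iff)
    then show "i \<in> {..<d}" using i0I I by auto
  qed
  have ld: "l \<le> d" using card_mono[OF _ less] card by simp
  obtain D :: real where D: "1 \<le> D"
      "volZ (convex hull (w ` I)) * ((\<Prod>i\<in>I - {i0}. \<beta> i) * fact (card I - 1) * D) = 1"
      "D = 1 \<longleftrightarrow> (\<forall>j. h j \<in> I \<longrightarrow> y j \<in> int_points)"
    using face_volume[OF I(1) i0I h y] v_int hle by metis
  define p where "p = prod \<beta> (I - {i0})"
  define r where "r = sylp (d - l) / (2 * sylp (d - 1) ^ 2)"
  define vol where "vol = volZ (convex hull (w ` I))"
  have vol: "vol * (p * fact l * D) = 1" using D(2) I(2) by (simp add: vol_def p_def)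
  have r_pos: "0 < r" by (simp add: r_def)
  have bound: "vol_bound d l = 1 / (r * fact l)" by (simp add: vol_bound_def r_def)
  have tail: "r \<le> prod \<beta> {d - l..<d}" unfolding r_def using d4 l ld by (intro prod_tail_ge) auto
  have sub: "prod \<beta> {d - l..<d} \<le> p"
    unfolding p_def card[symmetric] using less \<beta>_pos \<beta>_dec by (intro prod_subset_ge) auto
  have p_pos: "0 < p" using tail sub r_pos by linarith
  have pD: "p \<le> p * D" using p_pos D(1) by simp
  have rpD: "r \<le> p * D" using tail sub pD by linarith
  have vol_eq: "vol = 1 / (p * D * fact l)" using vol p_pos D(1) by (simp add: field_simps)
  show "volZ (convex hull (w ` I)) \<le> vol_bound d l"
    unfolding vol_def[symmetric] vol_eq bound
    using rpD r_pos p_pos D(1) by (intro divide_left_mono mult_right_mono) auto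
  assume "volZ (convex hull (w ` I)) = vol_bound d l"
  then have "p * D * fact l = r * fact l" unfolding vol_def[symmetric] vol_eq bound by simp
  then have "p * D = r" by simp
  then have eq: "p = r" "prod \<beta> {d - l..<d} = r" "p * D = p" using tail sub pD by linarith+
  have "D = 1" using eq(3) p_pos by simp
  have "\<beta> i = ext_weight d i" if "i \<le> d" for i
  proof -
    have pd: "d - l < d" using l ld by simp
    note * = prod_tail_eq[OF d4 pd eq(2)[unfolded r_def]]
    consider "i < d - 1" | "i = d - 1" | "i = d" using \<open>i \<le> d\<close> by linarith
    then show ?thesis using * d4 by cases (auto simp: ext_weight_def)
  qed
  then show "(\<forall>i\<le>d. \<beta> i = ext_weight d i) \<and> prod \<beta> (I - {i0}) = sylp (d - l) / (2 * sylp (d - 1) ^ 2) \<and>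
      (\<forall>j. h j \<in> I \<longrightarrow> y j \<in> int_points)"
    using eq(1) D(3) \<open>D = 1\<close> unfolding p_def r_def by blast
qed

text \<open>For \<open>l = d\<close> all dual vectors are covered by \<open>D = 1\<close>. For
  \<open>l = 1\<close> the face must be the edge of the last two indices, only one dual vector is
  known to be integral, and the rest requires \<open>\<bar>det V\<bar> = 1\<close>.\<close>

lemma face_volume_eq_imp:
  assumes I: "I \<subseteq> {..d}" "card I = Suc l" and l: "l = 1 \<or> l = d"
    and eq: "volZ (convex hull (w ` I)) = vol_bound d l"
    and h: "bij_betw h (UNIV :: 'n set) {..<d}"
    and y: "\<And>i j. v (h i) \<bullet> y j = (if i = j then 1 else 0)"
  shows "\<And>i. i \<le> d \<Longrightarrow> \<beta> i = ext_weight d i" "y j \<in> int_points"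
proof -
  have fin: "finite I" "I \<noteq> {}" using I finite_subset[OF I(1)] by auto
  have l1: "1 \<le> l" using l d4 by auto
  have "Max I \<le> d" using fin I by auto
  then obtain h' :: "'n \<Rightarrow> nat" where h': "bij_betw h' UNIV ({..d} - {Max I})"
    using ex_base_index by blast
  then obtain y' where y': "\<And>i j. v (h' i) \<bullet> y' j = (if i = j then 1 else 0)"
    using ex_dual_basis[OF h' \<open>Max I \<le> d\<close>] by auto
  have w\<beta>: "\<And>i. i \<le> d \<Longrightarrow> \<beta> i = ext_weight d i"
    and pr: "prod \<beta> (I - {Max I}) = sylp (d - l) / (2 * sylp (d - 1) ^ 2)"
    using face_volume_le(2)[OF I l1 refl h' y' eq] by auto
  show "\<And>i. i \<le> d \<Longrightarrow> \<beta> i = ext_weight d i" by (rule w\<beta>)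
  have dd: "{..d} - {d} = {..<d}" by auto
  have Max_d: "Max I = d \<and> (l = 1 \<longrightarrow> I = {d - 1, d})"
  proof (cases "l = d")
    case True
    then have "I = {..d}" using I by (intro card_subset_eq) auto
    then show ?thesis using True d4 by (auto intro: Max_eqI)
  next
    case False
    then have "l = 1" using l by simp
    define i0 where "i0 = Max I"
    have i0: "i0 \<in> I" "\<And>i. i \<in> I \<Longrightarrow> i \<le> i0" using fin by (auto simp: i0_def)
    have "card (I - {i0}) = 1" using I(2) i0 fin \<open>l = 1\<close> by simp
    then obtain i where i: "I - {i0} = {i}" by (auto simp: card_1_singleton_iff)
    then have "i \<in> I" "i \<noteq> i0" by auto
    then have "i < i0" using i0(2)[of i] by simp
    have "i0 \<le> d" using i0 I by auto
    have "\<beta> i = 1 / (2 * sylp (d - 1))"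
      using pr i \<open>l = 1\<close> by (simp add: i0_def[symmetric] power2_eq_square)
    moreover have "\<beta> i = ext_weight d i" using w\<beta> \<open>i < i0\<close> \<open>i0 \<le> d\<close> by simp
    ultimately have w: "ext_weight d i = 1 / (2 * sylp (d - 1))" by simp
    \<comment> \<open>An earlier weight would need a Sylvester number equal to
      \<open>2 * sylp (d - 1)\<close>, but each one before is at most
      \<open>sylp (d - 1)\<close>.\<close>
    have "d - 1 \<le> i"
    proof (rule ccontr)
      assume "\<not> d - 1 \<le> i"
      then have lt: "i < d - 1" by simp
      then have "sylp i + 1 = 2 * sylp (d - 1)" using w by (simp add: ext_weight_def field_simps)
      moreover have "sylp i + 1 \<le> sylp (Suc i)"
        using sylp_ge_1[of i] mult_right_mono[of 1 "sylp i" "sylp i + 1"] by (simp add: sylp_Suc)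
      moreover have "sylp (Suc i) \<le> sylp (d - 1)" using lt by (intro sylp_mono) simp
      ultimately show False using sylp_pos[of "d - 1"] by linarith
    qed
    then have "i = d - 1" "i0 = d" using \<open>i < i0\<close> \<open>i0 \<le> d\<close> by linarith+
    then show ?thesis using i i0(1) by (auto simp: i0_def)
  qed
  then have hd: "bij_betw h UNIV ({..d} - {Max I})" using h dd by simp
  have y_int: "y j \<in> int_points" if "h j \<in> I" for j
    using face_volume_le(2)[OF I l1 refl hd y eq] that by blast
  have hlt: "h j < d" for j using h by (auto simp: bij_betw_def)
  show "y j \<in> int_points"
  proof (cases "l = d")
    case True
    then have "I = {..d}" using I by (intro card_subset_eq) auto
    then show ?thesis using y_int hlt[of j] by simp
  next
    case False
    then have I_eq: "I = {d - 1, d}" using l Max_d by auto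
    define V where "V = (\<chi> i. v (h i))"
    have V: "V $ i = v (h i)" for i by (simp add: V_def)
    interpret dual_basis V y UNIV
      using v_int hlt by unfold_locales (simp_all add: V y less_imp_le)
    have "h j \<in> I" if "d - 1 \<le> h j" for j
      using that hlt[of j] d4 unfolding I_eq by auto
    \<comment> \<open>At the extremal weights the product and the tail both equal
      \<open>1 / sylp (d - 1)\<close>, so the inequality leaves
      \<open>\<bar>det V\<bar> \<le> 1\<close>.\<close>
    then have "\<bar>det (\<chi> i. v (h i))\<bar> * prod \<beta> {0..<d-1} \<le> (\<Sum>i=d-1..<Suc d. \<beta> i)"
      using y_int by (intro det_vertices_le[OF h _ y]) auto
    moreover have "prod \<beta> {0..<d-1} = 1 / sylp (d - 1)"
    proof -
      have "prod \<beta> {0..<d-1} = (\<Prod>i=0..<d-1. 1 / (sylp i + 1))"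
        by (intro prod.cong) (auto simp: w\<beta> ext_weight_def)
      then show ?thesis using prod_inverse_sylv[of 0 "d-1"] by simp
    qed
    moreover have "(\<Sum>i=d-1..<Suc d. \<beta> i) = 1 / sylp (d - 1)"
    proof -
      have "{d-1..<Suc d} = {d - 1, d}" "d - 1 \<noteq> d" using d4 by auto
      then have "(\<Sum>i=d-1..<Suc d. \<beta> i) = \<beta> (d - 1) + \<beta> d" by simp
      also have "\<dots> = 1 / sylp (d - 1)" by (simp add: w\<beta> ext_weight_def)
      finally show ?thesis .
    qed
    ultimately have "\<bar>det V\<bar> \<le> 1" by (simp add: V_def divide_le_cancel)
    then have det1: "\<bar>det V\<bar> = 1" using det_nonzero_Ints_ge_1[OF V_Ints det_V_nz] by simp
    have "V *v y j = axis j 1"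
      by (simp add: vec_eq_iff matrix_vector_mul_component V y axis_def)
    then have "V *v y j \<in> int_points" by (simp add: int_points_def axis_def)
    then show ?thesis using unimodular_solution_Ints[OF V_Ints _ det1] by blast
  qed
qed

end

section \<open>Unimodular equivalence with the extremal simplex\<close>

lemma vertices_split:
  fixes d :: nat
  assumes "bij_betw h (UNIV :: 'n::finite set) {..<d}"
  shows "v ` {..d} = insert (v d) (range (\<lambda>j. v (h j)))"
proof -
  have "{..d} = insert d (range h)" using assms by (auto simp: bij_betw_def)
  then show ?thesis by (simp add: image_image)
qed

text \<open>\<open>L\<close> sends \<open>v (coord0 j)\<close> to \<open>- axis j 1\<close>; it is
  integral since the \<open>y j\<close> are, and its inverse \<open>M\<close> since the vertices
  are. The barycentric relation then forces the last vertex to go to \<open>apex\<close>.\<close>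

lemma unimod_equiv_extremal:
  fixes v :: "nat \<Rightarrow> real^'n"
  assumes "bary_simplex d v \<beta>"
    and \<beta>: "\<And>i. i \<le> d \<Longrightarrow> \<beta> i = ext_weight d i"
    and v_int: "\<And>j. v (coord0 (j::'n)) \<in> int_points"
    and y: "\<And>i j. v (coord0 i) \<bullet> y (j::'n) = (if i = j then 1 else 0)"
    and y_int: "\<And>j. y j \<in> int_points"
  shows "unimod_equiv (convex hull (v ` {..d})) (convex hull (insert apex (range (\<lambda>j. - axis j 1))))"
proof -
  interpret bary_simplex d v \<beta> by fact
  define L where "L = (\<lambda>x::real^'n. \<chi> j. - (y j \<bullet> x))"
  define M where "M z = - (\<Sum>j\<in>UNIV. z $ j *\<^sub>R v (coord0 j))" for z :: "real^'n"
  have lin: "linear L" by (rule linearI) (simp_all add: L_def vec_eq_iff inner_add_right)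
  have L_M: "L (M z) = z" for z
    by (simp add: L_def M_def vec_eq_iff inner_sum_left inner_commute[of "y _"] y if_distrib cong: if_cong)
  then have surj: "surj L" by (metis surjI)
  then have inj: "inj L" using lin linear_surjective_imp_injective by blast
  have "L ` int_points = int_points"
  proof (intro subset_antisym subsetI)
    fix z :: "real^'n" assume z: "z \<in> int_points"
    have "M z \<in> int_points"
      unfolding M_def using z v_int
      by (intro int_points_uminus int_points_sum int_points_scaleR) (auto simp: int_points_def)
    then show "z \<in> L ` int_points" using L_M by (metis imageI)
  next
    fix z assume "z \<in> L ` int_points"
    then obtain x where "x \<in> int_points" "z = L x" by blast
    moreover have "y j \<bullet> x \<in> \<int>" for j using y_int \<open>x \<in> int_points\<close> by (rule inner_Ints)
    ultimately show "z \<in> int_points" by (simp add: L_def int_points_def)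
  qed
  moreover have "L ` (convex hull (v ` {..d})) = convex hull (insert apex (range (\<lambda>j. - axis j 1)))"
  proof -
    have bij: "bij_betw coord0 (UNIV :: 'n set) {..<d}" using bij_coord0 d_eq by simp
    have dd: "{..d} - {d} = {..<d}" by auto
    have Lv: "L (v (coord0 i)) = - axis i 1" for i
      by (simp add: L_def vec_eq_iff inner_commute[of "y _"] y axis_def)
    have "L (v d) = apex"
    proof -
      have bary': "\<beta> d *\<^sub>R v d + (\<Sum>j\<in>UNIV. \<beta> (coord0 j) *\<^sub>R v (coord0 (j::'n))) = 0"
        using bary sum_remove_base[of coord0 d "\<lambda>i. \<beta> i *\<^sub>R v i"] bij dd by simp
      have "y k \<bullet> v d = - (\<beta> (coord0 k) / \<beta> d)" for k
      proof -
        have "0 = y k \<bullet> (\<beta> d *\<^sub>R v d + (\<Sum>j\<in>UNIV. \<beta> (coord0 j) *\<^sub>R v (coord0 (j::'n))))" by (simp add: bary')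
        also have "\<dots> = \<beta> d * (y k \<bullet> v d) + \<beta> (coord0 k)"
          by (simp add: inner_add_right inner_sum_right inner_commute[of "y _" "v (coord0 _)"] y if_distrib cong: if_cong)
        finally show ?thesis using \<beta>_pos[of d] by (simp add: field_simps)
      qed
      moreover have "coord0 k < d" for k :: 'n using bij by (auto simp: bij_betw_def)
      ultimately show ?thesis by (simp add: L_def apex_def vec_eq_iff \<beta> less_imp_le d_eq[symmetric])
    qed
    then have "L ` v ` {..d} = insert apex (range (\<lambda>j. - axis j 1))"
      unfolding vertices_split[OF bij] by (simp add: image_image Lv)
    then show ?thesis by (simp add: convex_hull_linear_image[OF lin])
  qed
  ultimately show ?thesis
    unfolding unimod_equiv_def using lin inj surj by (intro exI[of _ L] exI[of _ 0]) (simp add: bij_def)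
qed

section \<open>Attainment of the bound\<close>

lemma zero_in_interior_polar:
  fixes A :: "(real^'n) set"
  assumes "bounded A"
  shows "0 \<in> interior (polar_set A)"
proof -
  obtain M where M: "0 < M" "\<And>x. x \<in> A \<Longrightarrow> norm x \<le> M" using assms bounded_pos by blast
  have "ball 0 (1 / M) \<subseteq> polar_set A"
  proof
    fix z :: "real^'n" assume "z \<in> ball 0 (1 / M)"
    then have z: "norm z \<le> 1 / M" by simp
    have "x \<bullet> z \<le> 1" if "x \<in> A" for x
    proof -
      have "x \<bullet> z \<le> norm x * norm z" by (rule norm_cauchy_schwarz)
      also have "\<dots> \<le> M * (1 / M)" using M z that by (intro mult_mono) auto
      finally show ?thesis using M by simp
    qed
    then show "z \<in> polar_set A" by (simp add: polar_set_def)
  qed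
  then show ?thesis using M by (meson centre_in_ball interiorI open_ball zero_less_divide_1_iff)
qed

lemma zero_in_interior_extremal:
  "0 \<in> interior (convex hull (insert apex (range (\<lambda>j::'n::finite. - axis j 1))))"
proof -
  have "bounded ((\<lambda>x. x - ones) ` (sylv_simplex :: (real^'n) set))"
    unfolding sylv_simplex_eq
    by (intro bounded_translation_minus finite_imp_bounded_convex_hull) simp
  then show ?thesis unfolding polar_sylv_simplex[symmetric] by (rule zero_in_interior_polar)
qed

text \<open>Pulling back the vertices of the extremal simplex equips \<open>S\<close> with the
  weights \<open>ext_weight\<close> and integral dual vectors, so \<open>D = 1\<close> and a face
  over the smallest weights attains the bound.\<close>

lemma unimod_equiv_imp_face:
  fixes S :: "(real^'n) set"
  assumes unimod: "unimod_equiv S (convex hull (insert apex (range (\<lambda>j. - axis j 1))))"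
    and int: "interior S \<inter> int_points = {0}"
    and l: "l \<in> {1..CARD('n)}"
  shows "\<exists>F. F face_of polar_set S \<and> aff_dim F = int l \<and>
    volZ F = vol_bound CARD('n) l"
proof -
  define T :: "(real^'n) set" where "T = convex hull (insert apex (range (\<lambda>j. - axis j 1)))"
  obtain L c where L: "linear L" "bij (\<lambda>x. L x + c)" "(\<lambda>x. L x + c) ` int_points = int_points"
      "(\<lambda>x. L x + c) ` S = T"
    using unimod unfolding unimod_equiv_def T_def by blast
  have inj: "inj L" using L(2) by (auto simp: bij_def inj_on_def)
  then have surj: "surj L" using L(1) linear_injective_imp_surjective by blast
  have shift: "(\<lambda>x. L x + c) ` A = (+) c ` L ` A" for A by (auto simp: image_image add.commute)
  \<comment> \<open>The preimage of 0 is an integral interior point of \<open>S\<close>, hence 0: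
    the equivalence has no translation part.\<close>
  have "c = 0"
  proof -
    have "interior T = (\<lambda>x. L x + c) ` interior S"
      unfolding L(4)[symmetric] shift interior_translation
      using interior_injective_linear_image[OF L(1) inj] by simp
    then obtain x where x: "x \<in> interior S" "L x + c = 0"
      using zero_in_interior_extremal[where 'n = 'n] unfolding T_def[symmetric] by force
    have "0 \<in> (\<lambda>x. L x + c) ` int_points" unfolding L(3) by (rule int_points_0)
    then obtain z where z: "z \<in> int_points" "L z + c = 0" by force
    then have "z = x" using x(2) inj by (metis add_right_cancel injD)
    then have "x = 0" using x(1) z(1) int by blast
    then show ?thesis using x(2) L(1) by (simp add: linear_0)
  qed
  have L_int: "L ` int_points = int_points" and L_S: "L ` S = T" using L(3,4) \<open>c = 0\<close> by simp_all
  define M where "M = inv L"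
  have linM: "linear M" unfolding M_def using inj_linear_imp_inv_linear L(1) inj by blast
  have M_L: "M (L x) = x" and L_M: "L (M x) = x" for x
    using inj surj by (simp_all add: M_def surj_f_inv_f)
  define d where "d = CARD('n)"
  define q where "q i = (if i < d then - axis (the_inv_into UNIV coord0 i) 1 else apex :: real^'n)" for i
  define v where "v i = M (q i)" for i
  have bij: "bij_betw coord0 (UNIV :: 'n set) {..<d}" using bij_coord0 by (simp add: d_def)
  have lt: "coord0 j < d" for j :: 'n using bij by (auto simp: bij_betw_def)
  have qj: "q (coord0 j) = - axis j 1" for j
    using bij lt by (simp add: q_def the_inv_into_f_f bij_betw_def)
  have qd: "q d = apex" by (simp add: q_def)
  have S_eq: "S = convex hull (v ` {..d})"
  proof -
    have "S = M ` T" unfolding L_S[symmetric] by (simp add: image_image M_L)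
    also have "T = convex hull (q ` {..d})" unfolding T_def vertices_split[OF bij] by (simp add: qj qd)
    finally show ?thesis by (simp add: convex_hull_linear_image[OF linM] image_image v_def)
  qed
  define b where "b = ext_weight d"
  have split: "(\<Sum>i\<le>d. f i) = f d + (\<Sum>j\<in>UNIV. f (coord0 (j::'n)))" for f :: "nat \<Rightarrow> 'c::comm_monoid_add"
    using sum.reindex_bij_betw[OF bij, of f] by (simp add: lessThan_Suc_atMost[symmetric] add.commute)
  have L_comb: "(\<Sum>i\<le>d. f i *\<^sub>R q i) $ k = f d * apex $ k - f (coord0 k)" for f and k :: 'n
    by (simp add: split qj qd axis_def sum_negf if_distrib[of "\<lambda>t. _ * t"] cong: if_cong)
  have M_comb: "(\<Sum>i\<le>d. f i *\<^sub>R v i) = M (\<Sum>i\<le>d. f i *\<^sub>R q i)" for f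
    by (simp add: v_def linear_sum[OF linM] linear_scale[OF linM])
  have apex: "apex $ j = b (coord0 j) / b d" for j :: 'n by (simp add: apex_def b_def d_def)
  have b_pos: "0 < b i" for i by (simp add: b_def ext_weight_pos)
  have d1: "1 \<le> d" using l by (simp add: d_def)
  interpret bary_simplex d v b
  proof
    show "d = CARD('n)" by (simp add: d_def)
    show "0 < b i" for i by (rule b_pos)
    show "(\<Sum>i\<le>d. b i) = 1" using sum_ext_weight[OF d1] by (simp add: b_def lessThan_Suc_atMost[symmetric])
    have "(\<Sum>i\<le>d. b i *\<^sub>R q i) = 0"
      unfolding vec_eq_iff L_comb using b_pos[of d] by (simp add: apex)
    then show "(\<Sum>i\<le>d. b i *\<^sub>R v i) = 0" unfolding M_comb using linM by (simp add: linear_0)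
    fix f assume f: "(\<Sum>i\<le>d. f i *\<^sub>R v i) = 0" "(\<Sum>i\<le>d. f i) = 0"
    then have "(\<Sum>i\<le>d. f i *\<^sub>R q i) = 0" unfolding M_comb using L_M linear_0[OF L(1)] by metis
    then have fk: "f (coord0 k) = f d * apex $ k" for k :: 'n
      using L_comb[of f k] by simp
    have "0 = f d * (1 + (\<Sum>k\<in>UNIV. (apex :: real^'n) $ k))"
      using f(2) by (simp add: split fk algebra_simps sum_distrib_left)
    then have "f d = 0" using sum_apex[where 'n = 'n] ext_weight_pos[of d d] by (simp add: d_def)
    then show "\<forall>i\<le>d. f i = 0" using fk split bij
      by (metis (no_types, lifting) bij_betw_imp_surj_on image_iff lessThan_iff mult_zero_left order_le_less)
  qed
  have "{..d} - {d} = {..<d}" by auto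
  then have bij': "bij_betw coord0 (UNIV :: 'n set) ({..d} - {d})" using bij by simp
  obtain y where y: "\<And>i j. v (coord0 i) \<bullet> y (j::'n) = (if i = j then 1 else 0)"
    using ex_dual_basis[OF bij'] by auto
  have v_int: "v (coord0 (j::'n)) \<in> int_points" for j
  proof -
    have "- axis j 1 \<in> (int_points :: (real^'n) set)" by (auto simp: int_points_def axis_def)
    then obtain z where "z \<in> int_points" "- axis j 1 = L z" using L_int by (metis imageE)
    then show ?thesis by (simp add: v_def qj M_L)
  qed
  have y_int: "y j \<in> int_points" for j
  proof -
    have "y j $ k \<in> \<int>" for k
    proof -
      define z where "z = L (axis k 1)"
      have "z \<in> int_points" using L_int by (auto simp: z_def int_points_def axis_def)
      have "axis k 1 = M z" by (simp add: z_def M_L)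
      also have "z = (\<Sum>i\<in>UNIV. (- z $ i) *\<^sub>R q (coord0 i))"
        by (simp add: vec_eq_iff qj axis_def if_distrib[of "\<lambda>t. _ * t"] cong: if_cong)
      also have "M \<dots> = (\<Sum>i\<in>UNIV. (- z $ i) *\<^sub>R v (coord0 i))"
        by (simp only: v_def linear_sum[OF linM] linear_scale[OF linM])
      finally have "axis k 1 \<bullet> y j = - z $ j"
        by (simp add: inner_sum_left y if_distrib[of "\<lambda>t. _ * t"] sum_negf cong: if_cong)
      then have "y j $ k = - z $ j" by (simp add: inner_axis' )
      then show ?thesis using \<open>z \<in> int_points\<close> by (simp add: int_points_def)
    qed
    then show ?thesis by (simp add: int_points_def)
  qed
  \<comment> \<open>The \<open>l + 1\<close> smallest weights. With \<open>d\<close> left out, the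
    product telescopes to \<open>sylp (d - l) / sylp (d - 1)\<close> times the halved weight at
    \<open>d - 1\<close>.\<close>
  define I where "I = {d - l..d}"
  have ld: "l \<le> d" "1 \<le> l" using l by (auto simp: d_def)
  have I: "I \<subseteq> {..d}" "d \<in> I" "card I = Suc l" using ld by (auto simp: I_def)
  obtain D :: real where D: "volZ (convex hull (w ` I)) * ((\<Prod>i\<in>I - {d}. b i) * fact (card I - 1) * D) = 1"
      "D = 1 \<longleftrightarrow> (\<forall>j. coord0 (j::'n) \<in> I \<longrightarrow> y j \<in> int_points)"
    using face_volume[OF I(1,2) bij' y v_int] by blast
  have "D = 1" using D(2) y_int by blast
  have pr: "prod b (I - {d}) = sylp (d - l) / (2 * sylp (d - 1) ^ 2)"
  proof -
    have "I - {d} = insert (d - 1) {d - l..<d - 1}" using ld by (auto simp: I_def)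
    then have "prod b (I - {d}) = b (d - 1) * prod b {d - l..<d - 1}" by simp
    also have "prod b {d - l..<d - 1} = (\<Prod>i=d-l..<d-1. 1 / (sylp i + 1))"
      by (intro prod.cong) (auto simp: b_def ext_weight_def)
    also have "\<dots> = sylp (d - l) / sylp (d - 1)" using ld by (intro prod_inverse_sylv) simp
    finally show ?thesis by (simp add: b_def ext_weight_def power2_eq_square)
  qed
  have "volZ (convex hull (w ` I)) = vol_bound d l"
    using D(1) \<open>D = 1\<close> I(3) unfolding pr by (simp add: vol_bound_def field_simps)
  moreover have "convex hull (w ` I) face_of polar_set S \<and> aff_dim (convex hull (w ` I)) = int l"
    unfolding S_eq polar_face_iff using I by blast
  ultimately show ?thesis unfolding d_def by blast
qed

lemma interior_int_points:
  assumes "card (interior S \<inter> int_points) = 1" "0 \<in> interior S"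
  shows "interior S \<inter> int_points = {0}"
proof -
  obtain x where x: "interior S \<inter> int_points = {x}" using assms(1) by (auto simp: card_1_singleton_iff)
  have "0 \<in> interior S \<inter> int_points" using assms(2) int_points_0 by simp
  then show ?thesis unfolding x by simp
qed

lemma sorted_vertices:
  fixes S :: "(real^'n) set"
  assumes "CARD('n) \<ge> 4" "S \<in> lattice_simplices_one" "0 \<in> interior S"
  obtains v \<beta> where "sorted_simplex CARD('n) v \<beta>" "S = convex hull (v ` {..CARD('n)})"
proof -
  define d where "d = CARD('n)"
  obtain C where C: "C \<subseteq> int_points" "\<not> affine_dependent C" "card C = d + 1" "S = convex hull C"
    and one: "card (interior S \<inter> int_points) = 1"
    using assms(2) unfolding lattice_simplices_one_def d_def by blast
  have fin: "finite C" using C(3) by (metis card.infinite Suc_eq_plus1 nat.distinct(1))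
  have int: "interior S = {y. \<exists>u. (\<forall>x\<in>C. 0 < u x) \<and> sum u C = 1 \<and> (\<Sum>x\<in>C. u x *\<^sub>R x) = y}"
    using interior_convex_hull_explicit_minimal[OF C(2)] C(3,4) by (simp add: d_def)
  have zero: "interior S \<inter> int_points = {0}" using one assms(3) by (rule interior_int_points)
  obtain u where u: "\<forall>x\<in>C. 0 < u x" "sum u C = 1" "(\<Sum>x\<in>C. u x *\<^sub>R x) = 0"
    using assms(3) unfolding int by blast
  obtain xs0 where xs0: "set xs0 = C" "distinct xs0" using finite_distinct_list[OF fin] by blast
  \<comment> \<open>The negated key sorts by decreasing weight.\<close>
  define xs where "xs = sort_key (\<lambda>x. - u x) xs0"
  have xs: "set xs = C" "distinct xs" "length xs = d + 1" "sorted (map (\<lambda>x. - u x) xs)"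
    using xs0 C(3) distinct_card[OF xs0(2)] by (simp_all add: xs_def)
  define v where "v i = xs ! i" for i
  define b where "b i = u (v i)" for i
  have bij: "bij_betw v {..d} C"
    using bij_betw_nth[OF xs(2), of "{..d}" C] xs(1,3) by (simp add: v_def[abs_def] lessThan_Suc_atMost)
  have v_mem: "v i \<in> C" if "i \<le> d" for i using bij that by (auto simp: bij_betw_def)
  have reindex: "(\<Sum>i\<le>d. f (v i)) = (\<Sum>x\<in>C. f x)" for f :: "real^'n \<Rightarrow> 'b::comm_monoid_add"
    by (rule sum.reindex_bij_betw[OF bij])
  have inv: "the_inv_into {..d} v (v i) = i" if "i \<le> d" for i
    using bij that by (simp add: bij_betw_def the_inv_into_f_f)
  have "sorted_simplex d v b"
  proof
    show "d = CARD('n)" by (simp add: d_def)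
    show "0 < b i" if "i \<le> d" for i using u(1) v_mem[OF that] by (simp add: b_def)
    show "(\<Sum>i\<le>d. b i) = 1" unfolding b_def reindex[of u] by (rule u(2))
    show "(\<Sum>i\<le>d. b i *\<^sub>R v i) = 0" unfolding b_def reindex[of "\<lambda>x. u x *\<^sub>R x"] by (rule u(3))
    show "\<forall>i\<le>d. c i = 0" if c: "(\<Sum>i\<le>d. c i *\<^sub>R v i) = 0" "(\<Sum>i\<le>d. c i) = 0" for c
    proof -
      define U where "U x = c (the_inv_into {..d} v x)" for x
      have "sum U C = 0" "(\<Sum>x\<in>C. U x *\<^sub>R x) = 0"
        using c unfolding reindex[symmetric] by (simp_all add: U_def inv cong: sum.cong_simp)
      then have "\<forall>x\<in>C. U x = 0" using C(2) unfolding affine_dependent_explicit_finite[OF fin] by blast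
      then show ?thesis using v_mem inv unfolding U_def by metis
    qed
    show "v i \<in> int_points" if "i \<le> d" for i using v_mem[OF that] C(1) by blast
    show "x = 0" if x: "x \<in> int_points" "\<And>i. i \<le> d \<Longrightarrow> 0 < c i" "(\<Sum>i\<le>d. c i) = 1" "x = (\<Sum>i\<le>d. c i *\<^sub>R v i)" for x c
    proof -
      define U where "U x = c (the_inv_into {..d} v x)" for x
      have "sum U C = 1" "(\<Sum>x\<in>C. U x *\<^sub>R x) = x"
        using x(3,4) unfolding reindex[symmetric] by (simp_all add: U_def inv cong: sum.cong_simp)
      moreover have "\<forall>x\<in>C. 0 < U x"
      proof
        fix z assume "z \<in> C"
        then obtain i where "i \<le> d" "z = v i" using bij by (auto simp: bij_betw_def)
        then show "0 < U z" using x(2) inv by (simp add: U_def)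
      qed
      ultimately have "x \<in> interior S" unfolding int by blast
      then show ?thesis using zero x(1) by blast
    qed
    show "b (Suc i) \<le> b i" if "i < d" for i
      using sorted_nth_mono[OF xs(4), of i "Suc i"] that xs(3) by (simp add: b_def v_def)
    show "4 \<le> d" using assms(1) by (simp add: d_def)
  qed
  moreover have "S = convex hull (v ` {..d})" using C(4) bij by (simp add: bij_betw_def)
  ultimately show ?thesis using that unfolding d_def by blast
qed

theorem mainTheorem6:
  fixes S :: "(real^'n) set" and l :: nat
  assumes "CARD('n) \<ge> 4"
    and "S \<in> lattice_simplices_one"
    and "0 \<in> interior S"
    and "l \<in> {1..CARD('n)}"
  shows "(\<forall>F. F face_of polar_set S \<and> aff_dim F = int l \<longrightarrow>
            volZ F \<le> 2 * (real (sylv CARD('n)) - 1)^2 /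
                       (fact l * (real (sylv (CARD('n) - l + 1)) - 1)))
    \<and> (unimod_equiv S (polar_set ((\<lambda>x. x - ones) ` sylv_simplex)) \<longrightarrow>
         (\<exists>F. F face_of polar_set S \<and> aff_dim F = int l \<and>
            volZ F = 2 * (real (sylv CARD('n)) - 1)^2 /
                       (fact l * (real (sylv (CARD('n) - l + 1)) - 1))))
    \<and> (l \<in> {1, CARD('n)} \<longrightarrow>
         ((\<exists>F. F face_of polar_set S \<and> aff_dim F = int l \<and>
            volZ F = 2 * (real (sylv CARD('n)) - 1)^2 /
                       (fact l * (real (sylv (CARD('n) - l + 1)) - 1)))
          \<longleftrightarrow> unimod_equiv S (polar_set ((\<lambda>x. x - ones) ` sylv_simplex))))"
proof -
  define d where "d = CARD('n)"
  obtain v \<beta> where "sorted_simplex d v \<beta>" and S: "S = convex hull (v ` {..d})"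
    using sorted_vertices[OF assms(1-3)] unfolding d_def by blast
  interpret sorted_simplex d v \<beta> by fact
  have bound: "2 * (real (sylv CARD('n)) - 1)^2 / (fact l * (real (sylv (CARD('n) - l + 1)) - 1)) = vol_bound d l"
    using assms(4) by (simp add: vol_bound_def sylp_def d_def Suc_diff_le)
  have l: "1 \<le> l" "l \<le> d" using assms(4) by (simp_all add: d_def)
  have dd: "{..d} - {d} = {..<d}" by auto
  have upper: "volZ F \<le> vol_bound d l" if F: "F face_of polar_set S \<and> aff_dim F = int l" for F
  proof -
    obtain I where I: "I \<subseteq> {..d}" "card I = Suc l" "F = convex hull (w ` I)"
      using F unfolding S polar_face_iff by blast
    have "Max I \<le> d" using I by (subst Max_le_iff) (auto intro: finite_subset)
    then obtain h :: "'n \<Rightarrow> nat" where h: "bij_betw h UNIV ({..d} - {Max I})" using ex_base_index by blast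
    then obtain y where "\<And>i j. v (h i) \<bullet> y j = (if i = j then 1 else 0)"
      using ex_dual_basis[OF h \<open>Max I \<le> d\<close>] by auto
    then show ?thesis unfolding I(3) using face_volume_le(1)[OF I(1,2) l(1) refl h] by blast
  qed
  have ints: "interior S \<inter> int_points = {0}"
    using assms(2,3) unfolding lattice_simplices_one_def by (intro interior_int_points) auto
  have attained: "\<exists>F. F face_of polar_set S \<and> aff_dim F = int l \<and> volZ F = vol_bound d l"
    if "unimod_equiv S (polar_set ((\<lambda>x. x - ones) ` sylv_simplex))"
    using unimod_equiv_imp_face[OF that[unfolded polar_sylv_simplex] ints assms(4)]
    unfolding d_def[symmetric] .
  have unimod: "unimod_equiv S (polar_set ((\<lambda>x. x - ones) ` sylv_simplex))"
    if l1d: "l \<in> {1, CARD('n)}" and F: "F face_of polar_set S \<and> aff_dim F = int l" "volZ F = vol_bound d l" for F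
  proof -
    obtain I where I: "I \<subseteq> {..d}" "card I = Suc l" "F = convex hull (w ` I)"
      using F(1) unfolding S polar_face_iff by blast
    have bij: "bij_betw coord0 (UNIV :: 'n set) {..<d}" using bij_coord0 by (simp add: d_def)
    obtain y where y: "\<And>i j. v (coord0 i) \<bullet> y (j::'n) = (if i = j then 1 else 0)"
      using ex_dual_basis[of coord0 d] bij dd by auto
    have ld: "l = 1 \<or> l = d" using l1d by (auto simp: d_def)
    note eq = face_volume_eq_imp[OF I(1,2) ld F(2)[unfolded I(3)] bij y]
    have "coord0 j \<le> d" for j :: 'n using bij by (auto simp: bij_betw_def intro: less_imp_le)
    then show ?thesis
      unfolding polar_sylv_simplex S using eq y v_int by (intro unimod_equiv_extremal[OF bary_simplex_axioms]) auto
  qed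
  show ?thesis unfolding bound using upper attained unimod by blast
qed

end
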